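(* Let $\mathcal{K}$ be a FUR-class, let $\mathbb{M}$ be a monster model for $\mathcal{K}$, and suppose $A\subseteq B\subseteq C\subseteq D\subset\mathbb{M}$. Then the following hold (for $a,b\in\mathbb{M}$). (i) Local character: for each $a$ there is some finite $A_0\subseteq A$ such that $a\downarrow_{A_0}A$. (ii) Finite character: if $a\not\downarrow_A B$, then there is some $b\in B$ such that $a\not\downarrow_A b$. (iii) Stationarity: if $Lt(a/A)=Lt(b/A)$, $a\downarrow_A B$ and $b\downarrow_A B$, then $Lt(a/B)=Lt(b/B)$. (iv) Extension: for every $a$ there is some $b$ such that $Lt(b/A)=Lt(a/A)$ and $b\downarrow_A B$. (v) Monotonicity: if $a\downarrow_A D$, then $a\downarrow_B C$. (vi) Transitivity: if $a\downarrow_A B$ and $a\downarrow_B C$, then $a\downarrow_A C$. (vii) Symmetry: if $a\downarrow_A b$, then $b\downarrow_A a$. (viii) $U$-ranks: $a\downarrow_A B$ if and only if $U(a/B)=U(a/A)$. (ix) Finiteness of $U$-rank: for all $a$, $U(a/\emptyset)<\omega$. (x) Addition of ranks: for all $a,b$, $U(ab/A)=U(a/bA)+U(b/A)$. (xi) Independence of bcl: if $a\in\mathrm{bcl}(A)$, then $a\downarrow_A B$. (xii) Reflexivity: if $a\in\mathrm{bcl}(B)\setminus\mathrm{bcl}(A)$, then $a\not\downarrow_A B$. (xiii) Local character of bcl: if $a\in\mathrm{bcl}(A)$, then there is some finite $A_0\subseteq A$ such that $a\in\mathrm{bcl}(A_0)$. (xiv) Closure: $\mathrm{bcl}(\mathrm{bcl}(A))=\mathrm{bcl}(A)$.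 (xv) Models are closed: if $\mathcal{A}$ is a model, then $\mathrm{bcl}(\mathcal{A})=\mathcal{A}$.
   Context: SETTING. $(\mathcal{K},\preccurlyeq)$ is an abstract elementary class (AEC) with monster model $\mathbb{M}$: a $\delta$-model homogeneous and $\delta$-universal member of $\mathcal{K}$, $\delta$ a large cardinal. "Bounded" means of size $<\delta$. "Model" means $\mathcal{A}\in\mathcal{K}$, $\mathcal{A}\preccurlyeq\mathbb{M}$; models and parameter sets are bounded. $a\in X$ may be a finite tuple; juxtaposition denotes union or concatenation. TYPES. $\mathrm{Aut}(\mathbb{M}/A)$ is the group of automorphisms of $\mathbb{M}$ fixing $A$ pointwise. $a,b$ have the same Galois type over $A$, $t^g(a/A)=t^g(b/A)$, if $f(a)=b$ for some $f\in\mathrm{Aut}(\mathbb{M}/A)$; they have the same weak type, $t(a/A)=t(b/A)$, if $t^g(a/B)=t^g(b/B)$ for all finite $B\subseteq A$ (types of models are types of enumerations). For $A\subseteq B$ with $A$ finite, $t(a/B)$ splits over $A$ if there are $b,c\in B$ with $t(b/A)=t(c/A)$ but $t(ab/A)\ne t(ac/A)$. $a\downarrow^{ns}_B C$ means that $t(a/B\cup C)$ does not split over some finite $A\subseteq B$; $A\downarrow^{ns}_B C$ means $a\downarrow^{ns}_BC$ for each $a\in A$. FUR-CLASS. $\mathcal{K}$ is a FUR-class if it has AP and JEP, $LS(\mathcal{K})=\omega$, has arbitrarily large structures, contains no finite models, and satisfies: (AI) Every countable model $\mathcal{A}$ is s-saturated: for any $b\in\mathbb{M}$ and finite $A\subseteq\mathcal{A}$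 there is $a\in\mathcal{A}$ with $t(a/A)=t(b/A)$. (AII) For all $a$ and countable $\mathcal{A}$ there is an s-primary model $\mathcal{B}=\mathcal{A}a\cup\bigcup_{i<\omega}a_i$ over $\mathcal{A}a$. [s-primary: the $a_i$ are singletons and for all $n<\omega$ there is a finite $A_n\subset\mathcal{A}$ such that for all $(a',a_0',\dots,a_n')$ with $t(a'/\mathcal{A})=t(a/\mathcal{A})$: $t(a',a_0',\dots,a_n'/A_n)=t(a,a_0,\dots,a_n/A_n)$ implies $t(a',a_0',\dots,a_n'/\mathcal{A})=t(a,a_0,\dots,a_n/\mathcal{A})$.] (AIII) Let $\mathcal{A},\mathcal{B},\mathcal{C}$ be models with $\mathcal{A}\downarrow^{ns}_{\mathcal{B}}\mathcal{C}$ and $\mathcal{B}=\mathcal{A}\cap\mathcal{C}$. Then there is a unique (not only up to isomorphism) s-prime model $\mathcal{D}$ over $\mathcal{A}\cup\mathcal{C}$; furthermore, if $\mathcal{C}\subseteq\mathcal{C}'$ and $\mathcal{A}\downarrow^{ns}_{\mathcal{B}}\mathcal{C}'$, then $\mathcal{D}\downarrow^{ns}_{\mathcal{C}}\mathcal{C}'$. [For models $\mathcal{A}_i$, $i<\alpha$, and $A=\bigcup_{i<\alpha}\mathcal{A}_i$, a map $f:A\to\mathbb{M}$ is weakly elementary w.r.t. $(\mathcal{A}_i)_{i<\alpha}$ if $t(a/\emptyset)=t(f(a)/\emptyset)$ for all $a\in A$ and $f(\mathcal{A}_i)\preccurlyeq\mathbb{M}$ for all $i$. A model $\mathcal{D}$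 is s-prime over $A$ if for every model $\mathcal{B}$ and every $f:A\to\mathcal{B}$ weakly elementary w.r.t. $(\mathcal{A}_i)_{i<\alpha}$ there is an elementary embedding $g:\mathcal{D}\to\mathcal{B}$ with $f\subseteq g$.] (AIV) For each $a\in\mathbb{M}$ there is $n<\omega$ such that for every countable model $\mathcal{A}$ and finite $A\subset\mathcal{A}$, player II has a winning strategy in $GI(a,A,\mathcal{A})$ in $n$ moves. [$GI(a,A,\mathcal{A})$: start with $a_0=a$, $A_0=A$. At move $n$, player I chooses $a_{n+1}\in\mathbb{M}$ and a finite $A_{n+1}'\subseteq\mathcal{A}$ with $t(a_{n+1}/A_n)=t(a_n/A_n)$, $A_n\subseteq A'_{n+1}$ and $t(a_{n+1}/A'_{n+1})\ne t(a_n/A'_{n+1})$; then player II chooses a finite $A_{n+1}\subseteq\mathcal{A}$ with $A'_{n+1}\subseteq A_{n+1}$. Player II wins if player I can no longer move.] (AV) If $\mathcal{A}\subseteq\mathcal{B}$ are countable models, $a\in\mathbb{M}$ and $\mathcal{B}\downarrow^{ns}_{\mathcal{A}}a$, then $a\downarrow^{ns}_{\mathcal{A}}\mathcal{B}$. (AVI) For all models $\mathcal{A},\mathcal{B},\mathcal{D}$ with $\mathcal{A}\subseteq\mathcal{B}\cap\mathcal{D}$ there is a model $\mathcal{C}$ with $t(\mathcal{C}/\mathcal{A})=t(\mathcal{B}/\mathcal{A})$ and $\mathcal{C}\downarrow^{ns}_{\mathcal{A}}\mathcal{D}$. LASCAR TYPES AND INDEPENDENCE. For finite $A$, $E(A)$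 is the set of equivalence relations on powers $\mathbb{M}^n$ that are invariant under $\mathrm{Aut}(\mathbb{M}/A)$ and have boundedly many classes. $Lt(a/B)=Lt(b/B)$ means $(a,b)\in E$ for all finite $A\subseteq B$ and $E\in E(A)$. For $A\subseteq B$ with $A$ finite, $t(a/B)$ Lascar splits over $A$ if there are $b,c\in B$ with $Lt(b/A)=Lt(c/A)$ but $t(ab/A)\ne t(ac/A)$. $a\downarrow_B C$ means: there is a finite $A\subseteq B$ such that for all $D\supseteq B\cup C$ there is some $b$ with $t(b/B\cup C)=t(a/B\cup C)$ such that $t(b/D)$ does not Lascar split over $A$. $U$-RANK. For a model $\mathcal{A}$: $U(a/\mathcal{A})\ge0$ always; $U(a/\mathcal{A})\ge n+1$ if there is a model $\mathcal{B}\supseteq\mathcal{A}$ with $a\not\downarrow^{ns}_{\mathcal{A}}\mathcal{B}$ and $U(a/\mathcal{B})\ge n$; $U(a/\mathcal{A})$ is the largest $n$ such that $U(a/\mathcal{A})\ge n$. For finite $A$, $U(a/A)=\max\{U(a/\mathcal{A}):\mathcal{A}\supset A\text{ a model}\}$. For arbitrary $A$, $U(a/A)=\min\{U(a/B):B\subseteq A\text{ finite}\}$ (this is consistent with the previous cases). BOUNDED CLOSURE. $a\in\mathrm{bcl}(A)$ iff $t(a/A)$ has only boundedly many realizations. *)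

theory Defs
  imports Complex_Main "HOL-Library.Extended_Nat"
begin

unbundle cardinal_syntax

section \<open>Structures\<close>

definition tuples :: "nat \<Rightarrow> 'a set \<Rightarrow> 'a list set" where
  "tuples n X = {xs. set xs \<subseteq> X \<and> length xs = n}"

record ('f, 'r) vocabulary =
  fun_syms :: "'f set"
  rel_syms :: "'r set"
  fun_ar :: "'f \<Rightarrow> nat"
  rel_ar :: "'r \<Rightarrow> nat"

record ('f, 'r, 'a) struct =
  univ :: "'a set"
  fun_int :: "'f \<Rightarrow> 'a list \<Rightarrow> 'a"
  rel_int :: "'r \<Rightarrow> 'a list set"

text \<open>Interpretations are normalised outside the vocabulary and outside the universe, so that
  two structures are equal as records iff they are equal as mathematical structures.\<close>

definition is_struct :: "('f, 'r) vocabulary \<Rightarrow> ('f, 'r, 'a) struct \<Rightarrow> bool" where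
  "is_struct V N \<longleftrightarrow>
     (\<forall>f\<in>fun_syms V. \<forall>xs\<in>tuples (fun_ar V f) (univ N). fun_int N f xs \<in> univ N) \<and>
     (\<forall>f xs. f \<notin> fun_syms V \<or> xs \<notin> tuples (fun_ar V f) (univ N) \<longrightarrow>
        fun_int N f xs = undefined) \<and>
     (\<forall>R\<in>rel_syms V. rel_int N R \<subseteq> tuples (rel_ar V R) (univ N)) \<and>
     (\<forall>R. R \<notin> rel_syms V \<longrightarrow> rel_int N R = {})"

definition substruct ::
  "('f, 'r) vocabulary \<Rightarrow> ('f, 'r, 'a) struct \<Rightarrow> ('f, 'r, 'a) struct \<Rightarrow> bool" where
  "substruct V N N' \<longleftrightarrow> univ N \<subseteq> univ N' \<and>
     (\<forall>f\<in>fun_syms V. \<forall>xs\<in>tuples (fun_ar V f) (univ N). fun_int N f xs = fun_int N' f xs) \<and>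
     (\<forall>R\<in>rel_syms V. \<forall>xs\<in>tuples (rel_ar V R) (univ N). xs \<in> rel_int N R \<longleftrightarrow> xs \<in> rel_int N' R)"

definition struct_iso ::
  "('f, 'r) vocabulary \<Rightarrow> ('f, 'r, 'a) struct \<Rightarrow> ('f, 'r, 'a) struct \<Rightarrow> ('a \<Rightarrow> 'a) \<Rightarrow> bool" where
  "struct_iso V N N' h \<longleftrightarrow> bij_betw h (univ N) (univ N') \<and>
     (\<forall>f\<in>fun_syms V. \<forall>xs\<in>tuples (fun_ar V f) (univ N).
        h (fun_int N f xs) = fun_int N' f (map h xs)) \<and>
     (\<forall>R\<in>rel_syms V. \<forall>xs\<in>tuples (rel_ar V R) (univ N).
        xs \<in> rel_int N R \<longleftrightarrow> map h xs \<in> rel_int N' R)"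

text \<open>The substructure with universe \<open>X\<close> (it satisfies \<^const>\<open>is_struct\<close> only if \<open>X\<close> is closed under
  the functions of \<open>N\<close>).\<close>

definition restr ::
  "('f, 'r) vocabulary \<Rightarrow> ('f, 'r, 'a) struct \<Rightarrow> 'a set \<Rightarrow> ('f, 'r, 'a) struct" where
  "restr V N X = \<lparr> univ = X,
     fun_int = (\<lambda>f xs. if f \<in> fun_syms V \<and> xs \<in> tuples (fun_ar V f) X
                       then fun_int N f xs else undefined),
     rel_int = (\<lambda>R. if R \<in> rel_syms V then rel_int N R \<inter> tuples (rel_ar V R) X else {}) \<rparr>"

definition union_struct ::
  "('f, 'r) vocabulary \<Rightarrow> ('f, 'r, 'a) struct set \<Rightarrow> ('f, 'r, 'a) struct" where
  "union_struct V \<C> = \<lparr> univ = (\<Union>N\<in>\<C>. univ N),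
     fun_int = (\<lambda>f xs. if f \<in> fun_syms V \<and> (\<exists>N\<in>\<C>. xs \<in> tuples (fun_ar V f) (univ N))
        then fun_int (SOME N. N \<in> \<C> \<and> xs \<in> tuples (fun_ar V f) (univ N)) f xs else undefined),
     rel_int = (\<lambda>R. \<Union>N\<in>\<C>. rel_int N R) \<rparr>"


section \<open>Abstract elementary classes\<close>

text \<open>HOL has no proper classes: the class consists of structures whose universe is a subset of
  the ground type \<open>'a\<close>, i.e. it is the restriction of an AEC to structures of size at most that
  of \<open>'a\<close>. The type \<open>'a\<close> is arbitrary, and the monster model is one of these structures.\<close>

record ('f, 'r, 'a) aec =
  voc :: "('f, 'r) vocabulary"
  members :: "('f, 'r, 'a) struct set"
  strong :: "('f, 'r, 'a) struct \<Rightarrow> ('f, 'r, 'a) struct \<Rightarrow> bool"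

definition strong_emb ::
  "('f, 'r, 'a, 'z) aec_scheme \<Rightarrow> ('f, 'r, 'a) struct \<Rightarrow> ('f, 'r, 'a) struct
    \<Rightarrow> ('a \<Rightarrow> 'a) \<Rightarrow> bool" where
  "strong_emb K N N' h \<longleftrightarrow> (\<exists>N0. strong K N0 N' \<and> struct_iso (voc K) N N0 h)"

definition LS_property :: "('f, 'r, 'a, 'z) aec_scheme \<Rightarrow> 'k rel \<Rightarrow> bool" where
  "LS_property K \<kappa> \<longleftrightarrow> Cinfinite \<kappa> \<and>
     |fun_syms (voc K)| \<le>o \<kappa> \<and> |rel_syms (voc K)| \<le>o \<kappa> \<and>
     (\<forall>N\<in>members K. \<forall>X. X \<subseteq> univ N \<longrightarrow>
        (\<exists>N0. strong K N0 N \<and> X \<subseteq> univ N0 \<and> |univ N0| \<le>o |X| +c \<kappa>))"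

text \<open>All cardinals below \<open>\<kappa>\<close> are represented on the same type as \<open>\<kappa>\<close>, so the minimality clause
  loses nothing by being restricted to that type.\<close>

definition LS_number :: "('f, 'r, 'a, 'z) aec_scheme \<Rightarrow> 'k rel \<Rightarrow> bool" where
  "LS_number K \<kappa> \<longleftrightarrow> LS_property K \<kappa> \<and> (\<forall>\<kappa>' :: 'k rel. LS_property K \<kappa>' \<longrightarrow> \<kappa> \<le>o \<kappa>')"

definition strong_chain :: "('f, 'r, 'a, 'z) aec_scheme \<Rightarrow> ('f, 'r, 'a) struct set \<Rightarrow> bool" where
  "strong_chain K \<C> \<longleftrightarrow> \<C> \<noteq> {} \<and> \<C> \<subseteq> members K \<and>
     (\<forall>\<S>. \<S> \<subseteq> \<C> \<and> \<S> \<noteq> {} \<longrightarrow> (\<exists>N\<in>\<S>. \<forall>N'\<in>\<S>. strong K N N'))"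

text \<open>Chains indexed by ordinals are represented by their sets of values, which are exactly the
  nonempty subsets of the class well-ordered by \<^const>\<open>strong\<close>.
  The parameter \<open>\<kappa>\<close> of the following predicate is the Loewenheim-Skolem number.\<close>

definition is_aec :: "('f, 'r, 'a, 'z) aec_scheme \<Rightarrow> 'k rel \<Rightarrow> bool" where
  "is_aec K \<kappa> \<longleftrightarrow>
     (\<forall>N\<in>members K. is_struct (voc K) N) \<and>
     (\<forall>N N' h. N \<in> members K \<and> is_struct (voc K) N' \<and> struct_iso (voc K) N N' h \<longrightarrow>
        N' \<in> members K) \<and>
     (\<forall>N N'. strong K N N' \<longrightarrow> N \<in> members K \<and> N' \<in> members K \<and> substruct (voc K) N N') \<and>
     (\<forall>N0 N N0' N' h. strong K N0 N \<and> N' \<in> members K \<and> struct_iso (voc K) N N' h \<and>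
        is_struct (voc K) N0' \<and> substruct (voc K) N0' N' \<and> univ N0' = h ` univ N0 \<longrightarrow>
        strong K N0' N') \<and>
     (\<forall>N\<in>members K. strong K N N) \<and>
     (\<forall>N N' N''. strong K N N' \<and> strong K N' N'' \<longrightarrow> strong K N N'') \<and>
     (\<forall>\<C>. strong_chain K \<C> \<longrightarrow>
        union_struct (voc K) \<C> \<in> members K \<and>
        (\<forall>N\<in>\<C>. strong K N (union_struct (voc K) \<C>)) \<and>
        (\<forall>N. (\<forall>N'\<in>\<C>. strong K N' N) \<longrightarrow> strong K (union_struct (voc K) \<C>) N)) \<and>
     (\<forall>N0 N1 N. strong K N0 N \<and> strong K N1 N \<and> univ N0 \<subseteq> univ N1 \<longrightarrow> strong K N0 N1) \<and>
     LS_number K \<kappa>"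

definition amalgamation :: "('f, 'r, 'a, 'z) aec_scheme \<Rightarrow> bool" where
  "amalgamation K \<longleftrightarrow> (\<forall>N0 N1 N2. strong K N0 N1 \<and> strong K N0 N2 \<longrightarrow>
     (\<exists>N3\<in>members K. \<exists>f g. strong_emb K N1 N3 f \<and> strong_emb K N2 N3 g \<and>
        (\<forall>x\<in>univ N0. f x = g x)))"

definition joint_embedding :: "('f, 'r, 'a, 'z) aec_scheme \<Rightarrow> bool" where
  "joint_embedding K \<longleftrightarrow> (\<forall>N1\<in>members K. \<forall>N2\<in>members K.
     \<exists>N3\<in>members K. \<exists>f g. strong_emb K N1 N3 f \<and> strong_emb K N2 N3 g)"


section \<open>Monster model\<close>

text \<open>As \<open>delta\<close> lives on \<open>'a\<close>, the class has room for structures of size \<open>delta\<close>. That \<open>delta\<close>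
  is a large cardinal is taken in the usual minimal sense: it is strongly inaccessible.\<close>

record ('f, 'r, 'a) aec_monster = "('f, 'r, 'a) aec" +
  monster :: "('f, 'r, 'a) struct"
  delta :: "'a rel"

abbreviation (input) carr :: "('f, 'r, 'a) aec_monster \<Rightarrow> 'a set" where
  "carr M \<equiv> univ (monster M)"

definition bounded_set :: "('f, 'r, 'a) aec_monster \<Rightarrow> 'x set \<Rightarrow> bool" where
  "bounded_set M X \<longleftrightarrow> |X| <o delta M"

definition strongly_inaccessible :: "'a rel \<Rightarrow> bool" where
  "strongly_inaccessible \<delta> \<longleftrightarrow> Card_order \<delta> \<and> natLeq <o \<delta> \<and> regularCard \<delta> \<and>
     (\<forall>X :: 'a set. |X| <o \<delta> \<longrightarrow> |Pow X| <o \<delta>)"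

definition is_model :: "('f, 'r, 'a) aec_monster \<Rightarrow> 'a set \<Rightarrow> bool" where
  "is_model M X \<longleftrightarrow> X \<subseteq> carr M \<and> restr (voc M) (monster M) X \<in> members M \<and>
     strong M (restr (voc M) (monster M) X) (monster M) \<and> bounded_set M X"

definition model_homogeneous :: "('f, 'r, 'a) aec_monster \<Rightarrow> bool" where
  "model_homogeneous M \<longleftrightarrow> (\<forall>X Y f. is_model M X \<and> is_model M Y \<and>
     struct_iso (voc M) (restr (voc M) (monster M) X) (restr (voc M) (monster M) Y) f \<longrightarrow>
     (\<exists>g. struct_iso (voc M) (monster M) (monster M) g \<and> (\<forall>x\<in>X. g x = f x)))"

definition universal :: "('f, 'r, 'a) aec_monster \<Rightarrow> bool" where
  "universal M \<longleftrightarrow> (\<forall>N\<in>members M. bounded_set M (univ N) \<longrightarrow> (\<exists>h. strong_emb M N (monster M) h))"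

definition monster_model :: "('f, 'r, 'a) aec_monster \<Rightarrow> bool" where
  "monster_model M \<longleftrightarrow> monster M \<in> members M \<and> strongly_inaccessible (delta M) \<and>
     model_homogeneous M \<and> universal M"


section \<open>Types and non-splitting independence\<close>

definition Aut :: "('f, 'r, 'a) aec_monster \<Rightarrow> 'a set \<Rightarrow> ('a \<Rightarrow> 'a) set" where
  "Aut M A = {f. struct_iso (voc M) (monster M) (monster M) f \<and> (\<forall>x\<in>A. f x = x)}"

text \<open>Finite tuples are lists, and concatenation is \<open>@\<close>. \<open>gtp_eq M A a b\<close> is
  \<open>t\<^sup>g(a/A) = t\<^sup>g(b/A)\<close> and \<open>tp_eq M A a b\<close> is \<open>t(a/A) = t(b/A)\<close>.\<close>

definition gtp_eq :: "('f, 'r, 'a) aec_monster \<Rightarrow> 'a set \<Rightarrow> 'a list \<Rightarrow> 'a list \<Rightarrow> bool" where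
  "gtp_eq M A a b \<longleftrightarrow> (\<exists>f\<in>Aut M A. map f a = b)"

definition tp_eq :: "('f, 'r, 'a) aec_monster \<Rightarrow> 'a set \<Rightarrow> 'a list \<Rightarrow> 'a list \<Rightarrow> bool" where
  "tp_eq M A a b \<longleftrightarrow> (\<forall>B. finite B \<and> B \<subseteq> A \<longrightarrow> gtp_eq M B a b)"

text \<open>Equality of the weak types over \<open>A\<close> of the sets \<open>X\<close> and \<open>Y\<close> for suitable enumerations:
  \<open>X\<close> is indexed by itself and \<open>Y\<close> is enumerated by \<open>h\<close>.\<close>

definition set_tp_eq :: "('f, 'r, 'a) aec_monster \<Rightarrow> 'a set \<Rightarrow> 'a set \<Rightarrow> 'a set \<Rightarrow> bool" where
  "set_tp_eq M A X Y \<longleftrightarrow> (\<exists>h. h ` X = Y \<and>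
     (\<forall>B. finite B \<and> B \<subseteq> A \<longrightarrow> (\<exists>f\<in>Aut M B. \<forall>x\<in>X. f x = h x)))"

definition splits :: "('f, 'r, 'a) aec_monster \<Rightarrow> 'a list \<Rightarrow> 'a set \<Rightarrow> 'a set \<Rightarrow> bool" where
  "splits M a B A \<longleftrightarrow> (\<exists>b c. set b \<subseteq> B \<and> set c \<subseteq> B \<and>
     tp_eq M A b c \<and> \<not> tp_eq M A (a @ b) (a @ c))"

text \<open>Both predicates express independence from \<open>C\<close> over the base \<open>B\<close>; in \<open>indep\<close> below the
  arguments come in the same order.\<close>

definition ns_indep :: "('f, 'r, 'a) aec_monster \<Rightarrow> 'a list \<Rightarrow> 'a set \<Rightarrow> 'a set \<Rightarrow> bool" where
  "ns_indep M a B C \<longleftrightarrow> (\<exists>A. finite A \<and> A \<subseteq> B \<and> \<not> splits M a (B \<union> C) A)"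

definition ns_indep_set :: "('f, 'r, 'a) aec_monster \<Rightarrow> 'a set \<Rightarrow> 'a set \<Rightarrow> 'a set \<Rightarrow> bool" where
  "ns_indep_set M X B C \<longleftrightarrow> (\<forall>a. set a \<subseteq> X \<longrightarrow> ns_indep M a B C)"


section \<open>FUR-classes\<close>

definition s_saturated :: "('f, 'r, 'a) aec_monster \<Rightarrow> 'a set \<Rightarrow> bool" where
  "s_saturated M X \<longleftrightarrow> (\<forall>b A. set b \<subseteq> carr M \<and> finite A \<and> A \<subseteq> X \<longrightarrow>
     (\<exists>a. set a \<subseteq> X \<and> tp_eq M A a b))"

text \<open>\<open>s_primary M X a Y\<close>: the model \<open>Y\<close> is s-primary over \<open>Xa\<close>. The list \<open>s'\<close> is
  \<open>a\<^sub>0', \<dots>, a\<^sub>n'\<close>.\<close>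

definition s_primary :: "('f, 'r, 'a) aec_monster \<Rightarrow> 'a set \<Rightarrow> 'a list \<Rightarrow> 'a set \<Rightarrow> bool" where
  "s_primary M X a Y \<longleftrightarrow> is_model M Y \<and> (\<exists>s :: nat \<Rightarrow> 'a.
     Y = X \<union> set a \<union> range s \<and>
     (\<forall>n. \<exists>A. finite A \<and> A \<subseteq> X \<and>
        (\<forall>a' s'. set a' \<subseteq> carr M \<and> set s' \<subseteq> carr M \<and> length s' = Suc n \<and>
           tp_eq M X a' a \<and> tp_eq M A (a' @ s') (a @ map s [0..<Suc n]) \<longrightarrow>
           tp_eq M X (a' @ s') (a @ map s [0..<Suc n]))))"

text \<open>The family \<open>(\<A>\<^sub>i)\<close> enters these notions only through its set \<open>\<F>\<close> of values.\<close>

definition weakly_elementary ::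
  "('f, 'r, 'a) aec_monster \<Rightarrow> 'a set set \<Rightarrow> ('a \<Rightarrow> 'a) \<Rightarrow> bool" where
  "weakly_elementary M \<F> f \<longleftrightarrow>
     (\<forall>a. set a \<subseteq> \<Union>\<F> \<longrightarrow> tp_eq M {} a (map f a)) \<and> (\<forall>X\<in>\<F>. is_model M (f ` X))"

definition s_prime :: "('f, 'r, 'a) aec_monster \<Rightarrow> 'a set set \<Rightarrow> 'a set \<Rightarrow> bool" where
  "s_prime M \<F> D \<longleftrightarrow> is_model M D \<and> \<Union>\<F> \<subseteq> D \<and>
     (\<forall>Y f. is_model M Y \<and> f ` \<Union>\<F> \<subseteq> Y \<and> weakly_elementary M \<F> f \<longrightarrow>
        (\<exists>g. strong_emb M (restr (voc M) (monster M) D) (restr (voc M) (monster M) Y) g \<and>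
           (\<forall>x\<in>\<Union>\<F>. g x = f x)))"

text \<open>The game \<open>GI(a, A, X)\<close>. A position is a pair \<open>(a\<^sub>n, A\<^sub>n)\<close>, a move of player I is a pair
  \<open>(a\<^sub>n\<^sub>+\<^sub>1, A'\<^sub>n\<^sub>+\<^sub>1)\<close>. A strategy \<open>\<sigma>\<close> of player II maps the list of all moves made so far by player I
  to the response of player II.\<close>

definition GI_legal ::
  "('f, 'r, 'a) aec_monster \<Rightarrow> 'a set \<Rightarrow> 'a list \<times> 'a set \<Rightarrow> 'a list \<times> 'a set \<Rightarrow> bool" where
  "GI_legal M X p m \<longleftrightarrow> set (fst m) \<subseteq> carr M \<and> finite (snd m) \<and> snd m \<subseteq> X \<and>
     tp_eq M (snd p) (fst m) (fst p) \<and> snd p \<subseteq> snd m \<and> \<not> tp_eq M (snd m) (fst m) (fst p)"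

definition GI_pos ::
  "'a list \<Rightarrow> 'a set \<Rightarrow> (('a list \<times> 'a set) list \<Rightarrow> 'a set) \<Rightarrow> ('a list \<times> 'a set) list \<Rightarrow> nat
    \<Rightarrow> 'a list \<times> 'a set" where
  "GI_pos a A \<sigma> h i = (if i = 0 then (a, A) else (fst (h ! (i - 1)), \<sigma> (take i h)))"

definition GI_play ::
  "('f, 'r, 'a) aec_monster \<Rightarrow> 'a list \<Rightarrow> 'a set \<Rightarrow> 'a set
    \<Rightarrow> (('a list \<times> 'a set) list \<Rightarrow> 'a set) \<Rightarrow> ('a list \<times> 'a set) list \<Rightarrow> bool" where
  "GI_play M a A X \<sigma> h \<longleftrightarrow> (\<forall>i<length h. GI_legal M X (GI_pos a A \<sigma> h i) (h ! i))"

text \<open>\<open>\<sigma>\<close> always responds legally, and player I never makes more than \<open>n\<close> moves against it.\<close>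

definition GI_winning ::
  "('f, 'r, 'a) aec_monster \<Rightarrow> 'a list \<Rightarrow> 'a set \<Rightarrow> 'a set \<Rightarrow> nat
    \<Rightarrow> (('a list \<times> 'a set) list \<Rightarrow> 'a set) \<Rightarrow> bool" where
  "GI_winning M a A X n \<sigma> \<longleftrightarrow> (\<forall>h. GI_play M a A X \<sigma> h \<longrightarrow> length h \<le> n \<and>
     (h \<noteq> [] \<longrightarrow> finite (\<sigma> h) \<and> snd (last h) \<subseteq> \<sigma> h \<and> \<sigma> h \<subseteq> X))"

definition AI :: "('f, 'r, 'a) aec_monster \<Rightarrow> bool" where
  "AI M \<longleftrightarrow> (\<forall>X. is_model M X \<and> countable X \<longrightarrow> s_saturated M X)"

definition AII :: "('f, 'r, 'a) aec_monster \<Rightarrow> bool" where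
  "AII M \<longleftrightarrow> (\<forall>a X. set a \<subseteq> carr M \<and> is_model M X \<and> countable X \<longrightarrow> (\<exists>Y. s_primary M X a Y))"

definition AIII :: "('f, 'r, 'a) aec_monster \<Rightarrow> bool" where
  "AIII M \<longleftrightarrow> (\<forall>A B C. is_model M A \<and> is_model M B \<and> is_model M C \<and>
     ns_indep_set M A B C \<and> B = A \<inter> C \<longrightarrow>
     (\<exists>!D. s_prime M {A, C} D) \<and>
     (\<forall>D C'. s_prime M {A, C} D \<and> is_model M C' \<and> C \<subseteq> C' \<and> ns_indep_set M A B C' \<longrightarrow>
        ns_indep_set M D C C'))"

definition AIV :: "('f, 'r, 'a) aec_monster \<Rightarrow> bool" where
  "AIV M \<longleftrightarrow> (\<forall>a. set a \<subseteq> carr M \<longrightarrow> (\<exists>n. \<forall>X A. is_model M X \<and> countable X \<and>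
     finite A \<and> A \<subseteq> X \<longrightarrow> (\<exists>\<sigma>. GI_winning M a A X n \<sigma>)))"

definition AV :: "('f, 'r, 'a) aec_monster \<Rightarrow> bool" where
  "AV M \<longleftrightarrow> (\<forall>A B a. is_model M A \<and> is_model M B \<and> countable A \<and> countable B \<and> A \<subseteq> B \<and>
     set a \<subseteq> carr M \<and> ns_indep_set M B A (set a) \<longrightarrow> ns_indep M a A B)"

definition AVI :: "('f, 'r, 'a) aec_monster \<Rightarrow> bool" where
  "AVI M \<longleftrightarrow> (\<forall>A B D. is_model M A \<and> is_model M B \<and> is_model M D \<and> A \<subseteq> B \<inter> D \<longrightarrow>
     (\<exists>C. is_model M C \<and> set_tp_eq M A C B \<and> ns_indep_set M C A D))"

definition FUR_class :: "('f, 'r, 'a) aec_monster \<Rightarrow> bool" where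
  "FUR_class M \<longleftrightarrow> is_aec M natLeq \<and> amalgamation M \<and> joint_embedding M \<and>
     (\<forall>X :: 'a set. \<exists>N\<in>members M. |X| \<le>o |univ N| ) \<and>
     (\<forall>N\<in>members M. infinite (univ N)) \<and>
     AI M \<and> AII M \<and> AIII M \<and> AIV M \<and> AV M \<and> AVI M"


section \<open>Lascar types and independence\<close>

text \<open>The members of \<open>E(A)\<close> that live on the \<open>n\<close>-th power of the monster.\<close>

definition bdd_equivs ::
  "('f, 'r, 'a) aec_monster \<Rightarrow> 'a set \<Rightarrow> nat \<Rightarrow> ('a list) rel set" where
  "bdd_equivs M A n = {E. equiv (tuples n (carr M)) E \<and>
     (\<forall>f\<in>Aut M A. \<forall>x\<in>tuples n (carr M). \<forall>y\<in>tuples n (carr M).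
        (x, y) \<in> E \<longleftrightarrow> (map f x, map f y) \<in> E) \<and>
     bounded_set M (tuples n (carr M) // E)}"

definition Lt_eq :: "('f, 'r, 'a) aec_monster \<Rightarrow> 'a set \<Rightarrow> 'a list \<Rightarrow> 'a list \<Rightarrow> bool" where
  "Lt_eq M B a b \<longleftrightarrow> length a = length b \<and>
     (\<forall>A. finite A \<and> A \<subseteq> B \<longrightarrow> (\<forall>E\<in>bdd_equivs M A (length a). (a, b) \<in> E))"

definition Lascar_splits :: "('f, 'r, 'a) aec_monster \<Rightarrow> 'a list \<Rightarrow> 'a set \<Rightarrow> 'a set \<Rightarrow> bool" where
  "Lascar_splits M a B A \<longleftrightarrow> (\<exists>b c. set b \<subseteq> B \<and> set c \<subseteq> B \<and>
     Lt_eq M A b c \<and> \<not> tp_eq M A (a @ b) (a @ c))"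

definition indep :: "('f, 'r, 'a) aec_monster \<Rightarrow> 'a list \<Rightarrow> 'a set \<Rightarrow> 'a set \<Rightarrow> bool" where
  "indep M a B C \<longleftrightarrow> (\<exists>A. finite A \<and> A \<subseteq> B \<and>
     (\<forall>D. B \<union> C \<subseteq> D \<and> D \<subseteq> carr M \<and> bounded_set M D \<longrightarrow>
        (\<exists>b. set b \<subseteq> carr M \<and> tp_eq M (B \<union> C) b a \<and> \<not> Lascar_splits M b D A)))"


section \<open>U-rank and bounded closure\<close>

primrec U_ge :: "('f, 'r, 'a) aec_monster \<Rightarrow> 'a list \<Rightarrow> nat \<Rightarrow> 'a set \<Rightarrow> bool" where
  "U_ge M a 0 X \<longleftrightarrow> True"
| "U_ge M a (Suc n) X \<longleftrightarrow>
     (\<exists>Y. is_model M Y \<and> X \<subseteq> Y \<and> \<not> ns_indep M a X Y \<and> U_ge M a n Y)"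

definition U_model :: "('f, 'r, 'a) aec_monster \<Rightarrow> 'a list \<Rightarrow> 'a set \<Rightarrow> enat" where
  "U_model M a X = Sup {enat n |n. U_ge M a n X}"

text \<open>A supremum in \<open>enat\<close> that is finite is attained, so this is the maximum once the rank is
  finite.\<close>

definition U_fin :: "('f, 'r, 'a) aec_monster \<Rightarrow> 'a list \<Rightarrow> 'a set \<Rightarrow> enat" where
  "U_fin M a A = Sup {U_model M a X |X. is_model M X \<and> A \<subseteq> X}"

definition U_rank :: "('f, 'r, 'a) aec_monster \<Rightarrow> 'a list \<Rightarrow> 'a set \<Rightarrow> enat" where
  "U_rank M a A =
     (if is_model M A then U_model M a A
      else if finite A then U_fin M a A
      else Inf {U_fin M a B |B. finite B \<and> B \<subseteq> A})"

definition bcl :: "('f, 'r, 'a) aec_monster \<Rightarrow> 'a set \<Rightarrow> 'a set" where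
  "bcl M A = {x \<in> carr M. bounded_set M {y \<in> carr M. tp_eq M A [y] [x]}}"

end

theory Submission
  imports Defs "HOL-Library.Countable_Set"
begin

text \<open>Over models, non-splitting is a stable independence notion: the game of AIV gives local character,
AVI extension, saturation of models uniqueness and transitivity, and AV symmetry. Weak types over
models are Galois types, by back and forth along s-primary models in the countable case and by an
s-prime model in general. AIV also bounds the U-rank over models, and there independence means
equality of ranks.

For a finite set \<open>A\<close> call \<open>a\<close> generic over a model \<open>X \<supseteq> A\<close> if \<open>U(a/X)\<close> attains \<open>U(a/A)\<close>.
"Not distinguished by generic elements" is an equivalence relation in \<open>E(A)\<close>, so generic types do
not Lascar split over \<open>A\<close>. Conversely, Harrington's symmetry argument shows that a type not Lascar
splitting over \<open>A\<close> in any extension is determined by its Lascar type over \<open>A\<close>, hence is generic.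
So \<open>indep M a B C\<close> holds iff \<open>U(a/B \<union> C) = U(a/B)\<close>, where \<open>U(a/B)\<close> is the minimum over finite subsets
of \<open>B\<close>; everything else is calculation with ranks, symmetry being a consequence of additivity.\<close>

text \<open>The axioms AI, AII, AIV and AV speak of countable models only. They pass to arbitrary
  models because splitting over a given finite base has a finite witness, so dependence over a model
  survives in a countable submodel closed under chosen witnesses. Types are weak, that is, each
  finite parameter set has its own automorphism, whereas the rank is defined by chains of actual
  models and is invariant only under one automorphism fixing a whole model; hence the passage to
  Galois types. The obstacle to treating arbitrary sets is that saturation, and with it uniqueness
  of non-splitting extensions, is available over models alone. Over a finite set, Lascar types take
  the place of types over a model, and generic elements that of free extensions. That a type without
  Lascar splitting is generic uses the finite bound \<open>N\<close> on the rank: among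
  \<open>N + 1\<close> successive extensions of models one is free, and there the type is compared
  with a generic one. Non-splitting over a model is a special case of this, which is why the rank
  over a model agrees with the minimum over its finite subsets.\<close>

section \<open>Back and forth, and finite values in \<open>enat\<close>\<close>

text \<open>The pairs of lists in \<open>R\<close> are finite partial maps, and \<open>fn\<close>
  makes the union of a growing sequence of them the graph of an injection. The last conclusion
  returns lists in \<open>R\<close> because \<open>R\<close> is not assumed to pass to sublists; it
  may demand, say, that all lists begin with fixed tuples.\<close>

lemma back_and_forth:
  fixes R :: "'a list \<Rightarrow> 'b list \<Rightarrow> bool"
  assumes cX: "countable X" and cY: "countable Y" and R0: "R a0 b0"
    and sub: "\<And>a b. R a b \<Longrightarrow> set a \<subseteq> X \<and> set b \<subseteq> Y \<and> length a = length b"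
    and fn: "\<And>a b i j. R a b \<Longrightarrow> i < length a \<Longrightarrow> j < length a \<Longrightarrow> a ! i = a ! j \<longleftrightarrow> b ! i = b ! j"
    and forth: "\<And>a b x. R a b \<Longrightarrow> x \<in> X \<Longrightarrow> \<exists>y. R (a @ [x]) (b @ [y])"
    and backw: "\<And>a b y. R a b \<Longrightarrow> y \<in> Y \<Longrightarrow> \<exists>x. R (a @ [x]) (b @ [y])"
  shows "\<exists>h. bij_betw h X Y \<and> map h a0 = b0 \<and>
    (\<forall>c. set c \<subseteq> X \<longrightarrow> (\<exists>a. R a (map h a) \<and> set c \<subseteq> set a))"
proof -
  let ?inv = "\<lambda>p. R (fst p) (snd p)"
  \<comment> \<open>Step \<open>n\<close> treats the elements of \<open>X\<close> and
    \<open>Y\<close> with code \<open>n\<close>; it asks for no new element if there is none, so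
    finite sets need no separate treatment.\<close>
  let ?step = "\<lambda>n p q. (\<exists>u. fst q = fst p @ u) \<and> (\<exists>v. snd q = snd p @ v) \<and>
    (\<forall>x\<in>X. to_nat_on X x = n \<longrightarrow> x \<in> set (fst q)) \<and>
    (\<forall>y\<in>Y. to_nat_on Y y = n \<longrightarrow> y \<in> set (snd q))"
  have step: "\<exists>q. ?inv q \<and> ?step n p q" if R: "?inv p" for p n
  proof -
    obtain a b where p: "p = (a, b)" by (cases p)
    have "\<exists>u v. R (a @ u) (b @ v) \<and> (\<forall>x\<in>X. to_nat_on X x = n \<longrightarrow> x \<in> set (a @ u))"
    proof (cases "\<exists>x\<in>X. to_nat_on X x = n")
      case True
      then obtain x where x: "x \<in> X" "to_nat_on X x = n" by blast
      obtain y where "R (a @ [x]) (b @ [y])" using forth[OF _ x(1)] R p by fastforce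
      moreover have "\<forall>x'\<in>X. to_nat_on X x' = n \<longrightarrow> x' = x"
        using x inj_on_to_nat_on[OF cX] by (auto dest: inj_onD)
      ultimately show ?thesis by (intro exI[of _ "[x]"] exI[of _ "[y]"]) auto
    next
      case False
      then show ?thesis using R p by (intro exI[of _ "[]"]) auto
    qed
    then obtain u v where uv: "R (a @ u) (b @ v)"
      "\<forall>x\<in>X. to_nat_on X x = n \<longrightarrow> x \<in> set (a @ u)" by blast
    have "\<exists>u' v'. R (a @ u @ u') (b @ v @ v') \<and>
      (\<forall>y\<in>Y. to_nat_on Y y = n \<longrightarrow> y \<in> set (b @ v @ v'))"
    proof (cases "\<exists>y\<in>Y. to_nat_on Y y = n")
      case True
      then obtain y where y: "y \<in> Y" "to_nat_on Y y = n" by blast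
      obtain x where "R ((a @ u) @ [x]) ((b @ v) @ [y])" using backw[OF uv(1) y(1)] by blast
      moreover have "\<forall>y'\<in>Y. to_nat_on Y y' = n \<longrightarrow> y' = y"
        using y inj_on_to_nat_on[OF cY] by (auto dest: inj_onD)
      ultimately show ?thesis by (intro exI[of _ "[x]"] exI[of _ "[y]"]) auto
    next
      case False
      then show ?thesis using uv by (intro exI[of _ "[]"]) auto
    qed
    then obtain u' v' where "R (a @ u @ u') (b @ v @ v')"
      "\<forall>y\<in>Y. to_nat_on Y y = n \<longrightarrow> y \<in> set (b @ v @ v')" by blast
    then show ?thesis using uv(2) p by (intro exI[of _ "(a @ u @ u', b @ v @ v')"]) auto
  qed
  have "\<exists>p. \<forall>n. (?inv (p n) \<and> (n = 0 \<longrightarrow> p n = (a0, b0))) \<and> ?step n (p n) (p (Suc n))"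
  proof (rule dependent_nat_choice)
    show "\<exists>q. ?inv q \<and> ((0::nat) = 0 \<longrightarrow> q = (a0, b0))" using R0 by simp
  qed (use step in blast)
  then obtain p where p: "\<And>n. ?inv (p n)" "\<And>n. ?step n (p n) (p (Suc n))" and p0: "p 0 = (a0, b0)"
    by blast
  have pre: "n \<le> m \<Longrightarrow> (\<exists>u. fst (p m) = fst (p n) @ u) \<and> (\<exists>v. snd (p m) = snd (p n) @ v)" for n m
  proof (induction m rule: dec_induct)
    case base then show ?case by simp
  next
    case (step k)
    then show ?case using p(2)[of k] by (metis append.assoc)
  qed
  have len: "length (fst (p n)) = length (snd (p n))" for n using sub[OF p(1)] by blast
  \<comment> \<open>The union of the graphs. Two pairs found at stages \<open>n\<close> and
    \<open>m\<close> both occur at stage \<open>max n m\<close>, at unchanged positions.\<close>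
  define G where "G = (\<lambda>x y. \<exists>n i. i < length (fst (p n)) \<and> fst (p n) ! i = x \<and> snd (p n) ! i = y)"
  have lift: "i < length (fst (p n)) \<Longrightarrow> n \<le> m \<Longrightarrow>
      i < length (fst (p m)) \<and> fst (p m) ! i = fst (p n) ! i \<and> snd (p m) ! i = snd (p n) ! i" for i n m
    using pre[of n m] len[of n] by (auto simp: nth_append)
  have G_iff: "x = x' \<longleftrightarrow> y = y'" if g: "G x y" "G x' y'" for x y x' y'
  proof -
    obtain n i where 1: "i < length (fst (p n))" "fst (p n) ! i = x" "snd (p n) ! i = y"
      using g unfolding G_def by blast
    obtain m j where 2: "j < length (fst (p m))" "fst (p m) ! j = x'" "snd (p m) ! j = y'"
      using g unfolding G_def by blast
    show ?thesis
      using lift[OF 1(1), of "max n m"] lift[OF 2(1), of "max n m"] 1 2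
        fn[OF p(1)[of "max n m"], of i j] by simp
  qed
  have GX: "\<exists>y. G x y" if "x \<in> X" for x
    using p(2)[of "to_nat_on X x"] that unfolding G_def by (metis in_set_conv_nth)
  have GY: "\<exists>x. G x y" if "y \<in> Y" for y
    using p(2)[of "to_nat_on Y y"] that len unfolding G_def by (metis in_set_conv_nth)
  have GXY: "G x y \<Longrightarrow> x \<in> X \<and> y \<in> Y" for x y
    unfolding G_def using sub[OF p(1)] len by (metis nth_mem subsetD)
  define h where "h = (\<lambda>x. SOME y. G x y)"
  have hG: "G x y \<Longrightarrow> h x = y" for x y
    unfolding h_def using G_iff by (metis someI)
  have hp: "map h (fst (p n)) = snd (p n)" for n
  proof (rule nth_equalityI)
    fix i assume "i < length (map h (fst (p n)))"
    then have i: "i < length (fst (p n))" by simp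
    then have "G (fst (p n) ! i) (snd (p n) ! i)" unfolding G_def by blast
    then show "map h (fst (p n)) ! i = snd (p n) ! i" using hG i by simp
  qed (simp add: len)
  have "bij_betw h X Y"
    unfolding bij_betw_def
  proof
    show "inj_on h X"
      using GX hG G_iff unfolding inj_on_def by metis
    show "h ` X = Y"
    proof
      show "h ` X \<subseteq> Y" using GX hG GXY by (metis image_subsetI)
      show "Y \<subseteq> h ` X" using GY hG GXY by (metis imageI subsetI)
    qed
  qed
  moreover have "map h a0 = b0" using hp[of 0] p0 by simp
  moreover have "\<exists>a. R a (map h a) \<and> set c \<subseteq> set a" if "set c \<subseteq> X" for c
  proof -
    have "\<exists>n. set c \<subseteq> set (fst (p n))"
      using that
    proof (induction c)
      case Nil then show ?case by simp
    next
      case (Cons x c)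
      then obtain n where n: "set c \<subseteq> set (fst (p n))" by auto
      let ?m = "max n (Suc (to_nat_on X x))"
      have "x \<in> set (fst (p (Suc (to_nat_on X x))))" using p(2)[of "to_nat_on X x"] Cons by auto
      then have "x \<in> set (fst (p ?m))" using pre[of "Suc (to_nat_on X x)" ?m] by auto
      moreover have "set c \<subseteq> set (fst (p ?m))" using n pre[of n ?m] by auto
      ultimately show ?case by (intro exI[of _ ?m]) simp
    qed
    then show ?thesis using p(1) hp by metis
  qed
  ultimately show ?thesis by blast
qed

text \<open>Finite values are compact: members less than \<open>enat (Suc m)\<close> are at most
  \<open>enat m\<close>, and so is their supremum.\<close>

lemma enat_le_Sup_iff:
  assumes "S \<noteq> {}"
  shows "enat n \<le> Sup S \<longleftrightarrow> (\<exists>s\<in>S. enat n \<le> s)"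
proof
  assume L: "enat n \<le> Sup S"
  show "\<exists>s\<in>S. enat n \<le> s"
  proof (rule ccontr)
    assume neg: "\<not> ?thesis"
    show False
    proof (cases n)
      case 0
      then show ?thesis using neg assms by (auto simp: zero_enat_def[symmetric])
    next
      case (Suc m)
      have "s \<le> enat m" if "s \<in> S" for s
        using neg that Suc by (cases s) (auto simp: not_le less_Suc_eq_le)
      then have "Sup S \<le> enat m" by (rule Sup_least)
      then have "enat n \<le> enat m" using L order_trans by blast
      then show ?thesis using Suc by simp
    qed
  qed
next
  assume "\<exists>s\<in>S. enat n \<le> s"
  then show "enat n \<le> Sup S" by (meson Sup_upper order_trans)
qed

lemma enat_leI: "(\<And>n. enat n \<le> x \<Longrightarrow> enat n \<le> y) \<Longrightarrow> x \<le> y"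
  by (cases x; cases y) (auto, metis Suc_n_not_le_n enat_ord_simps(1))

section \<open>Bounded sets, and models as subsets of the monster\<close>

locale fur =
  fixes M :: "('f, 'r, 'a) aec_monster"
  assumes fur: "FUR_class M" and monster: "monster_model M"
begin

abbreviation "model \<equiv> is_model M"
abbreviation "Sub X \<equiv> restr (voc M) (monster M) X"

lemma delta_facts: "Card_order (delta M)" "natLeq <o delta M" "regularCard (delta M)"
  "|X :: 'a set| <o delta M \<Longrightarrow> |Pow X| <o delta M"
  using monster unfolding monster_model_def strongly_inaccessible_def by auto

lemma delta_Cinfinite: "Cinfinite (delta M)"
  using cinfinite_mono[OF ordLess_imp_ordLeq[OF delta_facts(2)] natLeq_cinfinite] delta_facts(1)
  by blast

lemma bd_subset: "X \<subseteq> Y \<Longrightarrow> bounded_set M Y \<Longrightarrow> bounded_set M X"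
  unfolding bounded_set_def using card_of_mono1 ordLeq_ordLess_trans by blast

lemma bd_surj: "X \<subseteq> f ` Y \<Longrightarrow> bounded_set M Y \<Longrightarrow> bounded_set M X"
  unfolding bounded_set_def using surj_imp_ordLeq ordLeq_ordLess_trans by blast

lemma bd_countable: "countable X \<Longrightarrow> bounded_set M X"
  unfolding bounded_set_def
  by (metis card_of_nat card_of_ordLeqI countableE delta_facts(2) ordIso_ordLess_trans
      ordLeq_ordLess_trans UNIV_I)

lemma bd_finite: "finite X \<Longrightarrow> bounded_set M X"
  by (simp add: bd_countable countable_finite)

lemma bd_UN: "bounded_set M I \<Longrightarrow> (\<And>i. i \<in> I \<Longrightarrow> bounded_set M (F i)) \<Longrightarrow> bounded_set M (\<Union>i\<in>I. F i)"
  unfolding bounded_set_def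
  using card_of_UNION_ordLess_infinite_Field_regularCard[OF delta_facts(3) delta_Cinfinite] by blast

lemma bd_Un: "bounded_set M X \<Longrightarrow> bounded_set M Y \<Longrightarrow> bounded_set M (X \<union> Y)"
  unfolding bounded_set_def
  using card_of_Un_ordLess_infinite_Field delta_Cinfinite cinfinite_def by blast

lemma aec: "is_aec M natLeq"
  using fur unfolding FUR_class_def by blast

lemma aec_struct: "\<forall>N\<in>members M. is_struct (voc M) N"
  and aec_strong: "\<forall>N N'. strong M N N' \<longrightarrow> N \<in> members M \<and> N' \<in> members M \<and> substruct (voc M) N N'"
  and aec_iso: "\<forall>N0 N N0' N' h. strong M N0 N \<and> N' \<in> members M \<and> struct_iso (voc M) N N' h \<and>
        is_struct (voc M) N0' \<and> substruct (voc M) N0' N' \<and> univ N0' = h ` univ N0 \<longrightarrow>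
        strong M N0' N'"
  and aec_trans: "\<forall>N N' N''. strong M N N' \<and> strong M N' N'' \<longrightarrow> strong M N N''"
  and aec_chain: "\<forall>\<C>. strong_chain M \<C> \<longrightarrow>
        union_struct (voc M) \<C> \<in> members M \<and>
        (\<forall>N\<in>\<C>. strong M N (union_struct (voc M) \<C>)) \<and>
        (\<forall>N. (\<forall>N'\<in>\<C>. strong M N' N) \<longrightarrow> strong M (union_struct (voc M) \<C>) N)"
  and aec_coherence:
     "\<forall>N0 N1 N. strong M N0 N \<and> strong M N1 N \<and> univ N0 \<subseteq> univ N1 \<longrightarrow> strong M N0 N1"
  and aec_LS: "LS_number M natLeq"
  using aec unfolding is_aec_def by - (elim conjE, assumption)+

lemma monster_mem: "monster M \<in> members M"
  using monster unfolding monster_model_def by (elim conjE)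

lemma univ_Sub [simp]: "univ (Sub X) = X"
  by (simp add: restr_def)

text \<open>This singles out, among the records \<open>Sub X\<close>, those that are
  structures.\<close>

definition closed_in :: "'a set \<Rightarrow> bool" where
  "closed_in X \<longleftrightarrow> X \<subseteq> carr M \<and>
     (\<forall>f\<in>fun_syms (voc M). \<forall>xs\<in>tuples (fun_ar (voc M) f) X. fun_int (monster M) f xs \<in> X)"

lemma tuples_mono: "X \<subseteq> Y \<Longrightarrow> xs \<in> tuples n X \<Longrightarrow> xs \<in> tuples n Y"
  by (auto simp: tuples_def)

lemma Sub_closed:
  assumes "closed_in X"
  shows "is_struct (voc M) (Sub X)" "substruct (voc M) (Sub X) (monster M)"
  using assms by (auto simp: closed_in_def is_struct_def substruct_def restr_def)

lemma closed_Sub: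
  assumes "is_struct (voc M) (Sub X)" "X \<subseteq> carr M"
  shows "closed_in X"
  using assms by (fastforce simp: closed_in_def is_struct_def restr_def)

text \<open>Interpretations are normalised outside the universe, so a substructure of the monster is
  determined by its universe. Strong submodels can thereby be handled as plain sets.\<close>

lemma substruct_Sub:
  assumes s: "is_struct (voc M) N" "substruct (voc M) N (monster M)"
  shows "N = Sub (univ N)"
proof -
  have "fun_int N f xs = fun_int (Sub (univ N)) f xs" for f xs
  proof (cases "f \<in> fun_syms (voc M) \<and> xs \<in> tuples (fun_ar (voc M) f) (univ N)")
    case True then show ?thesis using s(2) by (simp add: substruct_def restr_def)
  next
    case False then show ?thesis using s(1) by (auto simp: is_struct_def restr_def)
  qed
  moreover have "rel_int N R = rel_int (Sub (univ N)) R" for R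
  proof (cases "R \<in> rel_syms (voc M)")
    case True
    then have "rel_int N R \<subseteq> tuples (rel_ar (voc M) R) (univ N)"
      "\<forall>xs\<in>tuples (rel_ar (voc M) R) (univ N). xs \<in> rel_int N R \<longleftrightarrow> xs \<in> rel_int (monster M) R"
      using s unfolding is_struct_def substruct_def by blast+
    then show ?thesis using True by (auto simp: restr_def)
  next
    case False then show ?thesis using s(1) by (simp add: is_struct_def restr_def)
  qed
  ultimately show ?thesis
    by (cases N) (simp add: restr_def fun_eq_iff)
qed

lemma strong_trans: "strong M N N' \<Longrightarrow> strong M N' N'' \<Longrightarrow> strong M N N''"
  using aec_trans by blast

lemma strongD:
  assumes "strong M N N'" shows "N \<in> members M" "N' \<in> members M" "substruct (voc M) N N'"
  "is_struct (voc M) N" "is_struct (voc M) N'" "univ N \<subseteq> univ N'"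
proof -
  show "N \<in> members M" "N' \<in> members M" "substruct (voc M) N N'" using aec_strong assms by blast+
  then show "is_struct (voc M) N" "is_struct (voc M) N'" "univ N \<subseteq> univ N'"
    using aec_struct by (auto simp: substruct_def)
qed

lemma strong_monster_model:
  assumes s: "strong M N (monster M)" and b: "bounded_set M (univ N)"
  shows "model (univ N)" "N = Sub (univ N)"
proof -
  show N: "N = Sub (univ N)"
    using strongD[OF s] substruct_Sub by blast
  show "model (univ N)"
    using s b strongD[OF s] unfolding is_model_def N[symmetric] by blast
qed

lemma model_strong: "model X \<Longrightarrow> strong M (Sub X) (monster M)"
  and model_carr: "model X \<Longrightarrow> X \<subseteq> carr M"
  and model_bd: "model X \<Longrightarrow> bounded_set M X"
  by (auto simp: is_model_def)

lemma coherence: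
  assumes "model X" "model Y" "X \<subseteq> Y" shows "strong M (Sub X) (Sub Y)"
  using assms model_strong aec_coherence by (metis univ_Sub)

lemma model_infinite: "model X \<Longrightarrow> infinite X"
proof -
  have "\<forall>N\<in>members M. infinite (univ N)"
    using fur unfolding FUR_class_def by (elim conjE)
  then show "model X \<Longrightarrow> infinite X" using univ_Sub unfolding is_model_def by metis
qed

lemma natLeq_card: "natLeq =o |UNIV :: nat set|"
  using card_of_nat ordIso_symmetric by blast

lemma bd_csum:
  assumes "bounded_set M X" "|Z| \<le>o |X| +c natLeq" shows "bounded_set M Z"
proof -
  have "|X| +c natLeq \<le>o |X| +c |UNIV :: nat set|"
    using csum_mono2[OF ordIso_imp_ordLeq[OF natLeq_card]] .
  moreover have "|X| +c |UNIV :: nat set| \<le>o |X <+> (UNIV :: nat set)|"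
    using Plus_csum ordIso_symmetric ordIso_imp_ordLeq by blast
  moreover have "|X <+> (UNIV :: nat set)| <o delta M"
    using assms(1) bd_countable[of "UNIV :: nat set"] card_of_Plus_ordLess_infinite_Field
      delta_Cinfinite unfolding bounded_set_def cinfinite_def by blast
  ultimately show ?thesis
    unfolding bounded_set_def using assms(2) ordLeq_transitive ordLeq_ordLess_trans by meson
qed

lemma countable_csum:
  assumes "countable X" "|Z| \<le>o |X| +c natLeq" shows "countable Z"
proof -
  have "|X| \<le>o natLeq"
    using assms(1) by (metis card_of_nat card_of_ordLeqI countableE ordLeq_ordIso_trans UNIV_I)
  then have "|X| +c natLeq \<le>o natLeq"
    by (simp add: csum_absorb2 natLeq_Cinfinite ordIso_imp_ordLeq)
  then have "|Z| \<le>o |UNIV :: nat set|"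
    using assms(2) natLeq_card ordLeq_transitive ordLeq_ordIso_trans by blast
  then show ?thesis
    by (metis card_of_ordLeq countableI)
qed

lemma LS:
  assumes "N \<in> members M" "X \<subseteq> univ N"
  obtains N0 where "strong M N0 N" "X \<subseteq> univ N0" "|univ N0| \<le>o |X| +c natLeq"
proof -
  have "\<forall>N\<in>members M. \<forall>X. X \<subseteq> univ N \<longrightarrow>
        (\<exists>N0. strong M N0 N \<and> X \<subseteq> univ N0 \<and> |univ N0| \<le>o |X| +c natLeq)"
    using aec_LS unfolding LS_number_def LS_property_def by (elim conjE)
  then show ?thesis using that assms by blast
qed

lemma ex_model:
  assumes "X \<subseteq> carr M" "bounded_set M X"
  obtains Z where "model Z" "X \<subseteq> Z"
proof -
  obtain N0 where N0: "strong M N0 (monster M)" "X \<subseteq> univ N0" "|univ N0| \<le>o |X| +c natLeq"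
    using LS[OF monster_mem assms(1)] by blast
  have "model (univ N0)"
    using strong_monster_model(1)[OF N0(1) bd_csum[OF assms(2) N0(3)]] .
  then show ?thesis using that N0(2) by blast
qed

lemma ex_cmodel:
  assumes "X \<subseteq> carr M" "countable X"
  obtains Z where "model Z" "X \<subseteq> Z" "countable Z"
proof -
  obtain N0 where N0: "strong M N0 (monster M)" "X \<subseteq> univ N0" "|univ N0| \<le>o |X| +c natLeq"
    using LS[OF monster_mem assms(1)] by blast
  have c: "countable (univ N0)" using countable_csum[OF assms(2) N0(3)] .
  show ?thesis using that[OF strong_monster_model(1)[OF N0(1) bd_countable[OF c]] N0(2) c] .
qed

lemma ex_cmodel_in:
  assumes "X \<subseteq> Y" "countable X" "model Y"
  obtains Z where "model Z" "X \<subseteq> Z" "Z \<subseteq> Y" "countable Z"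
proof -
  have "Sub Y \<in> members M" using assms(3) by (auto simp: is_model_def)
  then obtain N0 where N0: "strong M N0 (Sub Y)" "X \<subseteq> univ N0" "|univ N0| \<le>o |X| +c natLeq"
    using LS[of "Sub Y" X] assms(1) by auto
  have s: "strong M N0 (monster M)" using N0(1) model_strong[OF assms(3)] strong_trans by blast
  have c: "countable (univ N0)" using countable_csum[OF assms(2) N0(3)] .
  have "univ N0 \<subseteq> Y" using strongD(6)[OF N0(1)] by simp
  then show ?thesis using that[OF strong_monster_model(1)[OF s bd_countable[OF c]] N0(2) _ c] by blast
qed

lemma model_UN_chain:
  fixes X :: "nat \<Rightarrow> 'a set"
  assumes m: "\<And>n. model (X n)" and inc: "\<And>n. X n \<subseteq> X (Suc n)"
  shows "model (\<Union>n. X n)"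
proof -
  have mono: "i \<le> j \<Longrightarrow> X i \<subseteq> X j" for i j
    by (rule lift_Suc_mono_le[of X]) (use inc in auto)
  let ?C = "range (\<lambda>n. Sub (X n))"
  \<comment> \<open>\<open>strong_chain\<close> wants a least element in every nonempty set of
    values; the value with the least index serves.\<close>
  have "\<exists>N\<in>S. \<forall>N'\<in>S. strong M N N'" if S: "S \<subseteq> ?C" "S \<noteq> {}" for S
  proof -
    let ?P = "\<lambda>n. Sub (X n) \<in> S"
    obtain n where "?P n" using S by blast
    then have L: "?P (LEAST n. ?P n)" by (rule LeastI)
    have "strong M (Sub (X (LEAST n. ?P n))) N'" if N': "N' \<in> S" for N'
    proof -
      obtain k where k: "N' = Sub (X k)" using N' S by blast
      then have "(LEAST n. ?P n) \<le> k" using N' by (intro Least_le) simp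
      then show ?thesis unfolding k using coherence m mono by blast
    qed
    then show ?thesis using L by blast
  qed
  moreover have "?C \<subseteq> members M" using m by (auto simp: is_model_def)
  ultimately have chain: "strong_chain M ?C" unfolding strong_chain_def by blast
  have "\<forall>N\<in>?C. strong M N (monster M)" using m model_strong by blast
  then have "strong M (union_struct (voc M) ?C) (monster M)"
    using aec_chain chain by meson
  moreover have "univ (union_struct (voc M) ?C) = (\<Union>n. X n)"
    by (simp add: union_struct_def)
  moreover have "bounded_set M (\<Union>n. X n)"
    using bd_UN[of UNIV X] bd_countable[of "UNIV::nat set"] m model_bd by auto
  ultimately show ?thesis using strong_monster_model by metis
qed

subsection \<open>Automorphisms and types\<close>

abbreviation "CC \<equiv> univ (monster M)"
abbreviation "gt \<equiv> gtp_eq M"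
abbreviation "wt \<equiv> tp_eq M"

lemma Aut_iff: "f \<in> Aut M A \<longleftrightarrow> bij_betw f CC CC \<and> (\<forall>x\<in>A. f x = x) \<and>
     (\<forall>F\<in>fun_syms (voc M). \<forall>xs\<in>tuples (fun_ar (voc M) F) CC.
        f (fun_int (monster M) F xs) = fun_int (monster M) F (map f xs)) \<and>
     (\<forall>R\<in>rel_syms (voc M). \<forall>xs\<in>tuples (rel_ar (voc M) R) CC.
        xs \<in> rel_int (monster M) R \<longleftrightarrow> map f xs \<in> rel_int (monster M) R)"
  unfolding Aut_def struct_iso_def by blast

lemma Aut_fix: "f \<in> Aut M A \<Longrightarrow> x \<in> A \<Longrightarrow> f x = x"
  and Aut_bij: "f \<in> Aut M A \<Longrightarrow> bij_betw f CC CC"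
  by (simp_all add: Aut_iff)

lemma Aut_carr: "f \<in> Aut M A \<Longrightarrow> x \<in> CC \<Longrightarrow> f x \<in> CC"
  using Aut_bij bij_betwE by blast

lemma image_carr: "f \<in> Aut M A \<Longrightarrow> X \<subseteq> CC \<Longrightarrow> f ` X \<subseteq> CC"
  using Aut_carr by (meson image_subsetI subsetD)

lemma map_carr: "f \<in> Aut M A \<Longrightarrow> set a \<subseteq> CC \<Longrightarrow> set (map f a) \<subseteq> CC"
  using image_carr by (metis set_map)

lemma Aut_inj: "f \<in> Aut M A \<Longrightarrow> x \<in> CC \<Longrightarrow> y \<in> CC \<Longrightarrow> f x = f y \<longleftrightarrow> x = y"
  using Aut_bij bij_betw_imp_inj_on inj_on_eq_iff by metis

lemma Aut_mono: "f \<in> Aut M B \<Longrightarrow> A \<subseteq> B \<Longrightarrow> f \<in> Aut M A"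
  by (auto simp: Aut_iff)

lemma Aut_empty: "f \<in> Aut M B \<Longrightarrow> f \<in> Aut M {}"
  using Aut_mono by blast

lemma Aut_fixI: "f \<in> Aut M B \<Longrightarrow> (\<And>x. x \<in> A \<Longrightarrow> f x = x) \<Longrightarrow> f \<in> Aut M A"
  by (auto simp: Aut_iff)

lemma Aut_id: "id \<in> Aut M A"
  by (simp add: Aut_iff)

lemma map_tuples: "f \<in> Aut M A \<Longrightarrow> xs \<in> tuples n CC \<Longrightarrow> map f xs \<in> tuples n CC"
  using Aut_carr by (auto simp: tuples_def)

lemma Aut_fun: "f \<in> Aut M A \<Longrightarrow> F \<in> fun_syms (voc M) \<Longrightarrow> xs \<in> tuples (fun_ar (voc M) F) CC \<Longrightarrow>
    f (fun_int (monster M) F xs) = fun_int (monster M) F (map f xs)"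
  and Aut_rel: "f \<in> Aut M A \<Longrightarrow> R \<in> rel_syms (voc M) \<Longrightarrow> xs \<in> tuples (rel_ar (voc M) R) CC \<Longrightarrow>
    xs \<in> rel_int (monster M) R \<longleftrightarrow> map f xs \<in> rel_int (monster M) R"
  unfolding Aut_iff by blast+

lemma Aut_comp:
  assumes f: "f \<in> Aut M A" and k: "k \<in> Aut M A"
  shows "k \<circ> f \<in> Aut M A"
  unfolding Aut_iff
proof (intro conjI ballI)
  show "bij_betw (k \<circ> f) CC CC" using bij_betw_trans[OF Aut_bij[OF f] Aut_bij[OF k]] .
  show "(k \<circ> f) x = x" if "x \<in> A" for x using Aut_fix[OF f that] Aut_fix[OF k that] by simp
  show "(k \<circ> f) (fun_int (monster M) F xs) = fun_int (monster M) F (map (k \<circ> f) xs)"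
    if F: "F \<in> fun_syms (voc M)" "xs \<in> tuples (fun_ar (voc M) F) CC" for F xs
    using Aut_fun[OF f F] Aut_fun[OF k F(1) map_tuples[OF f F(2)]] by simp
  show "xs \<in> rel_int (monster M) R \<longleftrightarrow> map (k \<circ> f) xs \<in> rel_int (monster M) R"
    if R: "R \<in> rel_syms (voc M)" "xs \<in> tuples (rel_ar (voc M) R) CC" for R xs
    using Aut_rel[OF f R] Aut_rel[OF k R(1) map_tuples[OF f R(2)]] by simp
qed

lemma Aut_inv:
  assumes f: "f \<in> Aut M A"
  shows "\<exists>k\<in>Aut M A. (\<forall>x\<in>CC. k (f x) = x) \<and> (\<forall>x\<in>CC. f (k x) = x)"
proof -
  \<comment> \<open>The identity outside the monster matters: \<open>A\<close> is not assumed to be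
    a subset of \<open>CC\<close>, and \<open>k\<close> has to fix all of it.\<close>
  define k where "k = (\<lambda>x. if x \<in> CC then inv_into CC f x else x)"
  note b = Aut_bij[OF f]
  have kf: "k (f x) = x" if "x \<in> CC" for x
    using that b Aut_carr[OF f that] by (simp add: k_def bij_betw_inv_into_left)
  have fk: "f (k x) = x" if "x \<in> CC" for x
    using that b by (simp add: k_def bij_betw_inv_into_right)
  have kC: "k x \<in> CC" if "x \<in> CC" for x
    using that b by (simp add: k_def bij_betw_def inv_into_into)
  have mk: "map k xs \<in> tuples n CC" "map f (map k xs) = xs" if "xs \<in> tuples n CC" for xs n
    using that kC fk by (auto simp: tuples_def subset_iff intro!: map_idI)
  have "bij_betw k CC CC"
    by (rule bij_betw_byWitness[of _ f]) (use kf fk kC Aut_carr[OF f] in auto)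
  moreover have "k x = x" if "x \<in> A" for x
    using kf[of x] Aut_fix[OF f that] by (auto simp: k_def)
  moreover have "k (fun_int (monster M) F xs) = fun_int (monster M) F (map k xs)"
    if F: "F \<in> fun_syms (voc M)" "xs \<in> tuples (fun_ar (voc M) F) CC" for F xs
  proof -
    have "f (fun_int (monster M) F (map k xs)) = fun_int (monster M) F xs"
      using Aut_fun[OF f F(1) mk(1)[OF F(2)]] mk(2)[OF F(2)] by simp
    moreover have "fun_int (monster M) F (map k xs) \<in> CC"
      using aec_struct monster_mem mk(1)[OF F(2)] F(1) by (auto simp: is_struct_def)
    ultimately show ?thesis using kf by metis
  qed
  moreover have "xs \<in> rel_int (monster M) R \<longleftrightarrow> map k xs \<in> rel_int (monster M) R"
    if R: "R \<in> rel_syms (voc M)" "xs \<in> tuples (rel_ar (voc M) R) CC" for R xs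
    using Aut_rel[OF f R(1) mk(1)[OF R(2)]] mk(2)[OF R(2)] by simp
  ultimately have "k \<in> Aut M A" by (simp add: Aut_iff)
  then show ?thesis using kf fk by blast
qed

lemma model_closed: "model X \<Longrightarrow> closed_in X"
  using closed_Sub model_carr strongD(4) model_strong by blast

lemma model_image:
  assumes f: "f \<in> Aut M A" and X: "model X"
  shows "model (f ` X)"
proof -
  have XC: "X \<subseteq> CC" using model_carr[OF X] .
  have tup: "\<exists>ys. ys \<in> tuples n X \<and> xs = map f ys" if "xs \<in> tuples n (f ` X)" for xs n
  proof -
    have "\<forall>x\<in>set xs. \<exists>y\<in>X. f y = x" using that by (auto simp: tuples_def)
    then obtain k where k: "\<forall>x\<in>set xs. k x \<in> X \<and> f (k x) = x" by metis
    then show ?thesis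
      using that by (intro exI[of _ "map k xs"]) (auto simp: tuples_def map_idI)
  qed
  have "closed_in (f ` X)"
    unfolding closed_in_def
  proof (intro conjI ballI)
    show "f ` X \<subseteq> CC" using XC Aut_carr[OF f] by blast
  next
    fix F xs assume F: "F \<in> fun_syms (voc M)" "xs \<in> tuples (fun_ar (voc M) F) (f ` X)"
    obtain ys where ys: "ys \<in> tuples (fun_ar (voc M) F) X" "xs = map f ys" using tup[OF F(2)] by blast
    have "ys \<in> tuples (fun_ar (voc M) F) CC" using ys(1) XC tuples_mono by blast
    then have "fun_int (monster M) F xs = f (fun_int (monster M) F ys)"
      using Aut_fun[OF f F(1)] ys(2) by simp
    then show "fun_int (monster M) F xs \<in> f ` X"
      using model_closed[OF X] F(1) ys(1) unfolding closed_in_def by blast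
  qed
  moreover have "struct_iso (voc M) (monster M) (monster M) f" using f by (simp add: Aut_def)
  ultimately have "strong M (Sub (f ` X)) (monster M)"
    using aec_iso model_strong[OF X] monster_mem Sub_closed by (metis univ_Sub)
  then show ?thesis
    using strong_monster_model(1)[of "Sub (f ` X)"] bd_surj[of "f ` X" f X] model_bd[OF X] by simp
qed

text \<open>Functions and relations have finitely many arguments, so a bijection that agrees with
  some automorphism on each finite tuple is an isomorphism of models, and model homogeneity extends
  it.\<close>

lemma homogeneous:
  assumes X: "model X" and Y: "model Y" and h: "bij_betw h X Y"
    and t: "\<And>a. set a \<subseteq> X \<Longrightarrow> gt {} a (map h a)"
  obtains f where "f \<in> Aut M {}" "\<And>x. x \<in> X \<Longrightarrow> f x = h x"
proof -
  have YC: "Y \<subseteq> CC" and XC: "X \<subseteq> CC" using model_carr X Y by auto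
  have hY: "map h xs \<in> tuples n Y" if "xs \<in> tuples n X" for xs n
    using that h by (auto simp: tuples_def dest: bij_betwE)
  have f: "\<exists>f\<in>Aut M {}. \<forall>x\<in>set a. f x = h x" if "set a \<subseteq> X" for a
    using t[OF that] unfolding gtp_eq_def by auto
  have "struct_iso (voc M) (Sub X) (Sub Y) h"
    unfolding struct_iso_def
  proof (intro conjI ballI)
    show "bij_betw h (univ (Sub X)) (univ (Sub Y))" using h by simp
  next
    fix F xs assume F: "F \<in> fun_syms (voc M)" "xs \<in> tuples (fun_ar (voc M) F) (univ (Sub X))"
    then have x: "xs \<in> tuples (fun_ar (voc M) F) X" by simp
    have y: "fun_int (monster M) F xs \<in> X"
      using model_closed[OF X] F(1) x unfolding closed_in_def by blast
    \<comment> \<open>The value is listed with its arguments, so that a single automorphism acts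
      like \<open>h\<close> on both.\<close>
    have sx: "set (fun_int (monster M) F xs # xs) \<subseteq> X" using x y by (auto simp: tuples_def)
    obtain f where f: "f \<in> Aut M {}" "\<forall>x\<in>set (fun_int (monster M) F xs # xs). f x = h x"
      using f[OF sx] by blast
    have "h (fun_int (monster M) F xs) = f (fun_int (monster M) F xs)" using f(2) by simp
    also have "\<dots> = fun_int (monster M) F (map f xs)"
      using Aut_fun[OF f(1) F(1) tuples_mono[OF XC x]] .
    also have "map f xs = map h xs" using f(2) by simp
    finally show "h (fun_int (Sub X) F xs) = fun_int (Sub Y) F (map h xs)"
      using F(1) x hY[OF x] by (simp add: restr_def)
  next
    fix R xs assume R: "R \<in> rel_syms (voc M)" "xs \<in> tuples (rel_ar (voc M) R) (univ (Sub X))"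
    then have x: "xs \<in> tuples (rel_ar (voc M) R) X" by simp
    then have sx: "set xs \<subseteq> X" by (auto simp: tuples_def)
    obtain f where f: "f \<in> Aut M {}" "\<forall>x\<in>set xs. f x = h x"
      using f[OF sx] by blast
    have "xs \<in> rel_int (monster M) R \<longleftrightarrow> map f xs \<in> rel_int (monster M) R"
      using Aut_rel[OF f(1) R(1) tuples_mono[OF XC x]] .
    also have "map f xs = map h xs" using f(2) by simp
    finally show "xs \<in> rel_int (Sub X) R \<longleftrightarrow> map h xs \<in> rel_int (Sub Y) R"
      using R(1) x hY[OF x] by (simp add: restr_def)
  qed
  then obtain f where "struct_iso (voc M) (monster M) (monster M) f" "\<forall>x\<in>X. f x = h x"
    using monster X Y unfolding monster_model_def model_homogeneous_def by blast
  then show ?thesis using that[of f] by (simp add: Aut_def)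
qed

lemma gtI: "f \<in> Aut M A \<Longrightarrow> map f a = b \<Longrightarrow> gt A a b"
  unfolding gtp_eq_def by blast

lemma gtE: assumes "gt A a b" obtains f where "f \<in> Aut M A" "map f a = b"
  using assms unfolding gtp_eq_def by blast

lemma gt_refl: "gt A a a"
  by (rule gtI[OF Aut_id]) simp

lemma gt_length: "gt A a b \<Longrightarrow> length a = length b"
  by (auto elim!: gtE)

lemma gt_carr:
  assumes "gt A a b" "set a \<subseteq> CC" shows "set b \<subseteq> CC"
proof -
  obtain f where f: "f \<in> Aut M A" "map f a = b" using assms(1) by (rule gtE)
  show ?thesis using map_carr[OF f(1) assms(2)] f(2) by simp
qed

lemma gt_sym: "gt A a b \<Longrightarrow> set a \<subseteq> CC \<Longrightarrow> gt A b a"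
proof (erule gtE)
  fix f assume f: "f \<in> Aut M A" "map f a = b" and a: "set a \<subseteq> CC"
  obtain k where k: "k \<in> Aut M A" "\<forall>x\<in>CC. k (f x) = x" using Aut_inv[OF f(1)] by blast
  have "map k b = a" using a k(2) by (auto simp: subset_iff f(2)[symmetric] intro!: map_idI)
  then show ?thesis using gtI[OF k(1)] by blast
qed

lemma gt_trans:
  assumes "gt A a b" "gt A b c" shows "gt A a c"
proof -
  obtain f k where "f \<in> Aut M A" "map f a = b" "k \<in> Aut M A" "map k b = c"
    using assms by (elim gtE)
  then show ?thesis by (intro gtI[OF Aut_comp[of f A k]]) auto
qed

lemma gt_mono: "gt B a b \<Longrightarrow> A \<subseteq> B \<Longrightarrow> gt A a b"
  using Aut_mono unfolding gtp_eq_def by blast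

lemma gt_Un: "gt (A \<union> set c) a b \<longleftrightarrow> gt A (a @ c) (b @ c)"
proof
  assume "gt (A \<union> set c) a b"
  then obtain f where f: "f \<in> Aut M (A \<union> set c)" "map f a = b" by (rule gtE)
  have "map f c = c" using Aut_fix[OF f(1)] by (auto intro: map_idI)
  then show "gt A (a @ c) (b @ c)" using f Aut_mono[OF f(1)] by (intro gtI[of f]) auto
next
  assume "gt A (a @ c) (b @ c)"
  then obtain f where f: "f \<in> Aut M A" "map f (a @ c) = b @ c" by (rule gtE)
  then have l: "length a = length b" using f(2) by auto
  then have m: "map f a = b" "map f c = c" using f(2) by auto
  have "f x = x" if "x \<in> set c" for x using m(2) that by (metis map_eq_conv map_ident)
  then have "f \<in> Aut M (A \<union> set c)" using f(1) by (auto simp: Aut_iff)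
  then show "gt (A \<union> set c) a b" using m(1) gtI by blast
qed

lemma gt_app: "gt A (a @ c) (b @ d) \<Longrightarrow> length a = length b \<Longrightarrow>
   \<exists>f\<in>Aut M A. map f a = b \<and> map f c = d"
  by (auto elim!: gtE)

lemma gt_app1: "gt A (a @ c) (b @ d) \<Longrightarrow> length a = length b \<Longrightarrow> gt A a b"
  and gt_app2: "gt A (a @ c) (b @ d) \<Longrightarrow> length a = length b \<Longrightarrow> gt A c d"
  and gt_swap: "gt A (a @ c) (b @ d) \<Longrightarrow> length a = length b \<Longrightarrow> gt A (c @ a) (d @ b)"
  by (drule (1) gt_app, auto intro: gtI)+

lemma wtI: "(\<And>B. finite B \<Longrightarrow> B \<subseteq> A \<Longrightarrow> gt B a b) \<Longrightarrow> wt A a b"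
  unfolding tp_eq_def by blast

lemma wtD: "wt A a b \<Longrightarrow> finite B \<Longrightarrow> B \<subseteq> A \<Longrightarrow> gt B a b"
  unfolding tp_eq_def by blast

lemma wt_gt: "gt A a b \<Longrightarrow> wt A a b"
  using gt_mono by (auto intro: wtI)

lemma wt_fin: "finite A \<Longrightarrow> wt A a b \<longleftrightarrow> gt A a b"
  using wtD wt_gt by blast

lemma wt_refl: "wt A a a"
  by (simp add: wtI gt_refl)

lemma wt_length: "wt A a b \<Longrightarrow> length a = length b"
  using wtD[of A a b "{}"] gt_length by blast

lemma wt_carr: "wt A a b \<Longrightarrow> set a \<subseteq> CC \<Longrightarrow> set b \<subseteq> CC"
  using wtD[of A a b "{}"] gt_carr by blast

lemma wt_sym: "wt A a b \<Longrightarrow> set a \<subseteq> CC \<Longrightarrow> wt A b a"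
  by (rule wtI) (auto intro: gt_sym dest: wtD)

lemma wt_trans: "wt A a b \<Longrightarrow> wt A b c \<Longrightarrow> wt A a c"
  by (rule wtI) (meson gt_trans wtD)

lemma wt_mono: "wt B a b \<Longrightarrow> A \<subseteq> B \<Longrightarrow> wt A a b"
  by (rule wtI) (meson order_trans wtD)

text \<open>A finite subset of \<open>A \<union> set c\<close> is enlarged to the union of
  \<open>set c\<close> with a finite subset of \<open>A\<close>, and \<open>gt_Un\<close> absorbs
  \<open>c\<close> into the tuples.\<close>

lemma wt_Un: "wt (A \<union> set c) a b \<longleftrightarrow> wt A (a @ c) (b @ c)"
proof
  assume L: "wt (A \<union> set c) a b"
  show "wt A (a @ c) (b @ c)"
  proof (rule wtI)
    fix B assume "finite B" "B \<subseteq> A"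
    then have "gt (B \<union> set c) a b" by (intro wtD[OF L]) auto
    then show "gt B (a @ c) (b @ c)" by (simp add: gt_Un)
  qed
next
  assume R: "wt A (a @ c) (b @ c)"
  show "wt (A \<union> set c) a b"
  proof (rule wtI)
    fix B assume B: "finite B" "B \<subseteq> A \<union> set c"
    have "gt ((B \<inter> A) \<union> set c) a b" using wtD[OF R, of "B \<inter> A"] B(1) by (simp add: gt_Un)
    then show "gt B a b" using B(2) by (auto elim: gt_mono)
  qed
qed

lemma wt_append_par: "wt X a b \<Longrightarrow> set c \<subseteq> X \<Longrightarrow> wt X (a @ c) (b @ c)"
  by (metis sup.absorb_iff1 wt_Un)

lemma wtD_gt: "wt X a b \<Longrightarrow> finite A \<Longrightarrow> A \<subseteq> X \<Longrightarrow> set c \<subseteq> X \<Longrightarrow> gt A (a @ c) (b @ c)"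
  using wt_append_par wtD by blast

lemma wtI_gt: "(\<And>c. set c \<subseteq> X \<Longrightarrow> gt {} (a @ c) (b @ c)) \<Longrightarrow> wt X a b"
  by (rule wtI) (metis finite_list gt_Un sup_bot_left)

lemma wt_app1: "wt A (a @ c) (b @ d) \<Longrightarrow> length a = length b \<Longrightarrow> wt A a b"
  and wt_app2: "wt A (a @ c) (b @ d) \<Longrightarrow> length a = length b \<Longrightarrow> wt A c d"
  and wt_swap: "wt A (a @ c) (b @ d) \<Longrightarrow> length a = length b \<Longrightarrow> wt A (c @ a) (d @ b)"
  by (rule wtI, rule gt_app1 gt_app2 gt_swap, rule wtD, assumption+)+

lemma gt_image:
  assumes f: "f \<in> Aut M {}" and g: "gt A a b" and A: "A \<subseteq> CC" and a: "set a \<subseteq> CC"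
  shows "gt (f ` A) (map f a) (map f b)"
proof -
  obtain k where k: "k \<in> Aut M {}" "\<forall>x\<in>CC. k (f x) = x" using Aut_inv[OF f] by blast
  obtain h where h: "h \<in> Aut M A" "map h a = b" using g by (rule gtE)
  \<comment> \<open>The conjugate of \<open>h\<close> by \<open>f\<close>; it fixes the image of
    \<open>A\<close> pointwise.\<close>
  define q where "q = f \<circ> (h \<circ> k)"
  have q: "q (f x) = f (h x)" if "x \<in> CC" for x using k(2) that by (simp add: q_def)
  have "q \<in> Aut M {}" unfolding q_def by (intro Aut_comp k f Aut_empty[OF h(1)])
  moreover have "q x = x" if x: "x \<in> f ` A" for x
  proof -
    obtain y where y: "y \<in> A" "x = f y" using x by blast
    then show ?thesis using q[of y] Aut_fix[OF h(1) y(1)] A by auto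
  qed
  ultimately have "q \<in> Aut M (f ` A)" using Aut_fixI by blast
  moreover have "map q (map f a) = map f b"
    using a q by (simp add: subset_iff flip: h(2))
  ultimately show ?thesis using gtI by blast
qed

lemma wt_image:
  assumes f: "f \<in> Aut M {}" and g: "wt A a b" and A: "A \<subseteq> CC" and a: "set a \<subseteq> CC"
  shows "wt (f ` A) (map f a) (map f b)"
proof (rule wtI)
  fix B assume B: "finite B" "B \<subseteq> f ` A"
  then obtain B' where B': "B' \<subseteq> A" "finite B'" "B = f ` B'" using finite_subset_image[OF B] by blast
  show "gt B (map f a) (map f b)"
    unfolding B'(3) by (rule gt_image[OF f wtD[OF g B'(2,1)]]) (use B' A a in auto)
qed

text \<open>AI concerns countable models, but a countable submodel around the finite set
  \<open>A\<close> already realises the type.\<close>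

lemma saturated:
  assumes X: "model X" and A: "finite A" "A \<subseteq> X" and b: "set b \<subseteq> CC"
  obtains a where "set a \<subseteq> X" "gt A a b"
proof -
  obtain Z where Z: "model Z" "A \<subseteq> Z" "Z \<subseteq> X" "countable Z"
    using ex_cmodel_in[OF A(2) countable_finite[OF A(1)] X] by blast
  have "AI M" using fur unfolding FUR_class_def by (elim conjE)
  then have "s_saturated M Z" using Z unfolding AI_def by blast
  then obtain a where "set a \<subseteq> Z" "wt A a b"
    using Z(2) A(1) b unfolding s_saturated_def by blast
  then show ?thesis using that wt_fin[OF A(1)] Z(3) by blast
qed

lemma gt_nth_eq:
  assumes "gt A a b" "set a \<subseteq> CC" "i < length a" "j < length a"
  shows "a ! i = a ! j \<longleftrightarrow> b ! i = b ! j"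
proof -
  obtain f where f: "f \<in> Aut M A" "map f a = b" using assms(1) by (rule gtE)
  have "a ! i \<in> CC" "a ! j \<in> CC" using assms by auto
  then show ?thesis using Aut_inj[OF f(1)] assms f(2) by auto
qed

text \<open>The image of \<open>x\<close> under an automorphism carrying \<open>a\<close> to
  \<open>b\<close> need not lie in \<open>X\<close>; saturation replaces it by an element of
  \<open>X\<close> with the same type over \<open>E\<close> and \<open>b\<close>.\<close>

lemma gt_forth:
  assumes X: "model X" and E: "finite E" "E \<subseteq> X" and a: "set b \<subseteq> X" and x: "x \<in> CC"
    and g: "gt E a b"
  obtains y where "y \<in> X" "gt E (a @ [x]) (b @ [y])"
proof -
  obtain f where f: "f \<in> Aut M E" "map f a = b" using g by (rule gtE)
  obtain y' where y': "set y' \<subseteq> X" "gt (E \<union> set b) y' [f x]"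
    using saturated[OF X, of "E \<union> set b" "[f x]"] E a x Aut_carr[OF f(1)] by auto
  obtain y where y: "y' = [y]" using gt_length[OF y'(2)] by (cases y') auto
  have "gt (E \<union> set b) [f x] [y]"
    using gt_sym[OF y'(2)] y'(1) y model_carr[OF X] by auto
  then have "gt E ([f x] @ b) ([y] @ b)" by (simp add: gt_Un)
  then have "gt E (b @ [f x]) (b @ [y])" by (rule gt_swap) simp
  moreover have "gt E (a @ [x]) (b @ [f x])" using f by (auto intro: gtI)
  ultimately show ?thesis using that y y'(1) gt_trans by auto
qed

text \<open>Saturation drives a back-and-forth inside the countable model, and model homogeneity
  turns the resulting bijection into an automorphism of the monster that preserves \<open>X\<close>
  as a set. Such automorphisms will provide moves of player I and absorb the answers of player
  II.\<close>

lemma cmodel_auto: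
  assumes X: "model X" and cX: "countable X" and E: "finite E" "E \<subseteq> X"
    and b: "set b \<subseteq> X" "set c \<subseteq> X" "gt E b c"
  obtains f where "f \<in> Aut M E" "f ` X = X" "map f b = c"
proof -
  note XC = model_carr[OF X]
  let ?R = "\<lambda>a a'. set a \<subseteq> X \<and> set a' \<subseteq> X \<and> gt E a a'"
  have "\<exists>h. bij_betw h X X \<and> map h b = c \<and>
    (\<forall>c. set c \<subseteq> X \<longrightarrow> (\<exists>a. ?R a (map h a) \<and> set c \<subseteq> set a))"
  proof (rule back_and_forth)
    fix a b x assume R: "?R a b" and x: "x \<in> X"
    then obtain y where "y \<in> X" "gt E (a @ [x]) (b @ [y])" using gt_forth[OF X E, of b x a] XC by auto
    then show "\<exists>y. ?R (a @ [x]) (b @ [y])" using R x by auto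
  next
    fix a b y assume R: "?R a b" and y: "y \<in> X"
    have "gt E b a" using gt_sym[of E a b] R XC by blast
    then obtain x where x: "x \<in> X" "gt E (b @ [y]) (a @ [x])" using gt_forth[OF X E, of a y b] XC R y by auto
    then have "gt E (a @ [x]) (b @ [y])" using gt_sym[OF x(2)] XC R y by auto
    then show "\<exists>x. ?R (a @ [x]) (b @ [y])" using R x y by auto
  next
    fix a b i j assume "?R a b" "i < length a" "j < length a"
    then show "a ! i = a ! j \<longleftrightarrow> b ! i = b ! j" using gt_nth_eq[of E a b i j] XC by blast
  next
    show "?R a b \<Longrightarrow> set a \<subseteq> X \<and> set b \<subseteq> X \<and> length a = length b" for a b
      using gt_length[of E a b] by blast
    show "?R b c" using b by blast
  qed (rule cX)+
  then obtain h where h: "bij_betw h X X" "map h b = c"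
    "\<forall>c. set c \<subseteq> X \<longrightarrow> (\<exists>a. ?R a (map h a) \<and> set c \<subseteq> set a)" by blast
  have gth: "gt E c (map h c)" if "set c \<subseteq> X" for c
  proof -
    obtain a where a: "gt E a (map h a)" "set c \<subseteq> set a" using h(3) \<open>set c \<subseteq> X\<close> by blast
    obtain f where f: "f \<in> Aut M E" "map f a = map h a" using a(1) by (rule gtE)
    then have "map f c = map h c" using a(2) by auto
    then show ?thesis using f(1) gtI by blast
  qed
  obtain f where f: "f \<in> Aut M {}" "\<And>x. x \<in> X \<Longrightarrow> f x = h x"
    using homogeneous[OF X X h(1)] gth gt_mono by (metis empty_subsetI)
  have "f x = x" if "x \<in> E" for x
  proof -
    have "gt E [x] [h x]" using gth[of "[x]"] that E(2) by auto
    then obtain k where "k \<in> Aut M E" "map k [x] = [h x]" by (rule gtE)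
    then have "h x = x" using Aut_fix[of k E x] that by simp
    then show ?thesis using f(2) that E(2) by auto
  qed
  then have "f \<in> Aut M E" using f(1) Aut_fixI by blast
  moreover have "f ` X = X" using f(2) h(1) by (simp add: bij_betw_def)
  moreover have "map f b = c" using f(2) h(2) b(1) by (metis map_eq_conv subsetD)
  ultimately show ?thesis by (rule that)
qed

subsection \<open>Independence over models\<close>

abbreviation "I \<equiv> ns_indep M"

lemma not_splitsD:
  assumes "\<not> splits M a B E" "finite E" "set b \<subseteq> B" "set c \<subseteq> B" "gt E b c"
  shows "gt E (a @ b) (a @ c)"
proof -
  have "wt E b c" using assms(5) by (rule wt_gt)
  then have "wt E (a @ b) (a @ c)" using assms(1,3,4) unfolding splits_def by blast
  then show ?thesis using wt_fin[OF assms(2)] by blast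
qed

lemma not_splitsI:
  assumes "finite E"
    and "\<And>b c. set b \<subseteq> B \<Longrightarrow> set c \<subseteq> B \<Longrightarrow> gt E b c \<Longrightarrow> gt E (a @ b) (a @ c)"
  shows "\<not> splits M a B E"
  using assms(2) unfolding splits_def wt_fin[OF assms(1)] by blast

lemma splits_mono: "splits M a B E \<Longrightarrow> B \<subseteq> B' \<Longrightarrow> splits M a B' E"
  unfolding splits_def by blast

text \<open>The new base is listed as \<open>e\<close> and appended to both tuples; if these have
  equal types over \<open>E'\<close>, the enlarged tuples have equal types over
  \<open>E\<close>.\<close>

lemma not_splits_base:
  assumes "\<not> splits M a B E" "finite E'" "E \<subseteq> E'" "E' \<subseteq> B"
  shows "\<not> splits M a B E'"
proof (rule not_splitsI[OF assms(2)])
  fix b c assume b: "set b \<subseteq> B" "set c \<subseteq> B" "gt E' b c"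
  obtain e where e: "set e = E'" using finite_list[OF assms(2)] by blast
  have E': "E' = E \<union> set e" using e assms(3) by blast
  have "gt E (b @ e) (c @ e)" using b(3) gt_Un unfolding E' by blast
  moreover have "finite E" using assms(2,3) finite_subset by blast
  ultimately have "gt E (a @ b @ e) (a @ c @ e)"
    using not_splitsD[OF assms(1), of "b @ e" "c @ e"] b e assms(4) by auto
  then show "gt E' (a @ b) (a @ c)" unfolding E' gt_Un by simp
qed

lemma gt_subset:
  assumes "gt E (a @ b) (a @ c)" "set a' \<subseteq> set a \<union> E"
  shows "gt E (a' @ b) (a' @ c)"
proof -
  obtain f where f: "f \<in> Aut M E" "map f a = a" "map f b = c"
    using gt_app[OF assms(1)] by blast
  have "f x = x" if "x \<in> set a" for x using f(2) that by (metis map_eq_conv map_ident)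
  then have "map f a' = a'" using assms(2) Aut_fix[OF f(1)] by (intro map_idI) blast
  then show ?thesis using f by (intro gtI[of f]) auto
qed

lemma not_splits_subset:
  assumes "\<not> splits M a B E" "finite E" "set a' \<subseteq> set a \<union> E"
  shows "\<not> splits M a' B E"
  using not_splitsI[OF assms(2)] not_splitsD[OF assms(1,2)] gt_subset[OF _ assms(3)] by meson

lemma not_splits_cong:
  assumes "\<not> splits M a B E" "finite E" "E \<subseteq> B" "B \<subseteq> CC" "wt B a b" "set a \<subseteq> CC"
  shows "\<not> splits M b B E"
proof (rule not_splitsI[OF assms(2)])
  fix x y assume x: "set x \<subseteq> B" "set y \<subseteq> B" "gt E x y"
  have "gt E (b @ x) (a @ x)"
    using wtD_gt[OF assms(5,2,3) x(1)] gt_sym assms(4,6) x(1) by auto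
  moreover have "gt E (a @ x) (a @ y)" using not_splitsD[OF assms(1,2) x] .
  moreover have "gt E (a @ y) (b @ y)" using wtD_gt[OF assms(5,2,3) x(2)] .
  ultimately show "gt E (b @ x) (b @ y)" using gt_trans by blast
qed

lemma not_splits_image:
  assumes f: "f \<in> Aut M {}" and s: "\<not> splits M a B E" and E: "finite E" "E \<subseteq> CC"
    and B: "B \<subseteq> CC" and a: "set a \<subseteq> CC"
  shows "\<not> splits M (map f a) (f ` B) (f ` E)"
proof (rule not_splitsI)
  show "finite (f ` E)" using E(1) by simp
  obtain k where k: "k \<in> Aut M {}" "\<forall>x\<in>CC. k (f x) = x" "\<forall>x\<in>CC. f (k x) = x"
    using Aut_inv[OF f] by blast
  have kimg: "k ` f ` S = S" if "S \<subseteq> CC" for S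
    using k(2) that by force
  have fmap: "map f (map k x) = x" if "set x \<subseteq> f ` B" for x
  proof -
    have "set x \<subseteq> CC" using that image_carr[OF f B] by blast
    then show ?thesis using k(3) by (simp add: subset_iff map_idI)
  qed
  fix x y assume x: "set x \<subseteq> f ` B" "set y \<subseteq> f ` B" "gt (f ` E) x y"
  have "gt (k ` f ` E) (map k x) (map k y)"
    using gt_image[OF k(1) x(3) image_carr[OF f E(2)]] x(1) image_carr[OF f B] by blast
  then have "gt E (map k x) (map k y)" unfolding kimg[OF E(2)] .
  moreover have "set (map k x) \<subseteq> B" "set (map k y) \<subseteq> B"
    using x(1,2) kimg[OF B] by (metis image_mono set_map)+
  ultimately have "gt E (a @ map k x) (a @ map k y)" using not_splitsD[OF s E(1)] by blast
  then have "gt (f ` E) (map f (a @ map k x)) (map f (a @ map k y))"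
    by (rule gt_image[OF f _ E(2)])
      (use a \<open>set (map k x) \<subseteq> B\<close> B in auto)
  then show "gt (f ` E) (map f a @ x) (map f a @ y)"
    using fmap[OF x(1)] fmap[OF x(2)] unfolding map_append by simp
qed

lemma I_iff: "I a X B \<longleftrightarrow> (\<exists>E. finite E \<and> E \<subseteq> X \<and> \<not> splits M a (X \<union> B) E)"
  by (simp add: ns_indep_def)

lemma I_mono:
  assumes "I a X B" "X \<subseteq> Y" "Y \<union> B' \<subseteq> X \<union> B"
  shows "I a Y B'"
  using assms splits_mono unfolding I_iff by (meson order_trans)

text \<open>Coordinates of \<open>a'\<close> taken from \<open>X\<close> are put into the finite
  base.\<close>

lemma I_subset:
  assumes "I a X B" "set a' \<subseteq> set a \<union> X" shows "I a' X B"
proof -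
  obtain E where E: "finite E" "E \<subseteq> X" "\<not> splits M a (X \<union> B) E" using assms(1) unfolding I_iff by blast
  let ?E = "E \<union> (set a' \<inter> X)"
  have "\<not> splits M a (X \<union> B) ?E" by (rule not_splits_base[OF E(3)]) (use E in auto)
  then have "\<not> splits M a' (X \<union> B) ?E" by (rule not_splits_subset) (use E assms(2) in auto)
  then show ?thesis unfolding I_iff using E by (intro exI[of _ ?E]) auto
qed

lemma I_cong:
  assumes "I a X B" "wt (X \<union> B) a b" "X \<union> B \<subseteq> CC" "set a \<subseteq> CC"
  shows "I b X B"
proof -
  obtain E where E: "finite E" "E \<subseteq> X" "\<not> splits M a (X \<union> B) E" using assms(1) unfolding I_iff by blast
  then show ?thesis using not_splits_cong[OF E(3,1) _ assms(3,2,4)] unfolding I_iff by blast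
qed

lemma I_image:
  assumes f: "f \<in> Aut M {}" and s: "I a X B" and B: "X \<subseteq> CC" "B \<subseteq> CC" and a: "set a \<subseteq> CC"
  shows "I (map f a) (f ` X) (f ` B)"
proof -
  obtain E where E: "finite E" "E \<subseteq> X" "\<not> splits M a (X \<union> B) E" using s unfolding I_iff by blast
  have "\<not> splits M (map f a) (f ` (X \<union> B)) (f ` E)"
    by (rule not_splits_image[OF f E(3,1)]) (use E B a in auto)
  then show ?thesis unfolding I_iff using E by (metis finite_imageI image_Un image_mono)
qed

text \<open>\<open>P k c A\<close> says that player I can survive \<open>k\<close> more moves from the position \<open>(c, A)\<close>.\<close>

lemma GI_survive:
  fixes P :: "nat \<Rightarrow> 'a list \<Rightarrow> 'a set \<Rightarrow> bool"
  assumes step: "\<And>k c A. P (Suc k) c A \<Longrightarrow> finite A \<Longrightarrow> A \<subseteq> X \<Longrightarrow>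
      \<exists>c' A'. GI_legal M X (c, A) (c', A') \<and>
        (\<forall>A''. finite A'' \<and> A' \<subseteq> A'' \<and> A'' \<subseteq> X \<longrightarrow> P k c' A'')"
    and W: "GI_winning M a A X n \<sigma>" and A: "finite A" "A \<subseteq> X" and P: "P k a A"
  shows "k \<le> n"
proof -
  \<comment> \<open>A play of \<open>j\<close> moves against \<sigma>, with the counter of
    \<open>P\<close> down to \<open>k - j\<close>. The replies of \<sigma> are known to be legal
    only after such plays, which is why \<open>GI_play\<close> belongs to the invariant.\<close>
  let ?good = "\<lambda>j h. length h = j \<and> GI_play M a A X \<sigma> h \<and>
      finite (snd (GI_pos a A \<sigma> h j)) \<and> snd (GI_pos a A \<sigma> h j) \<subseteq> X \<and>
      P (k - j) (fst (GI_pos a A \<sigma> h j)) (snd (GI_pos a A \<sigma> h j))"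
  have "\<exists>h. ?good j h" if "j \<le> k" for j
    using that
  proof (induction j)
    case 0
    then show ?case using A P by (intro exI[of _ "[]"]) (simp add: GI_play_def GI_pos_def)
  next
    case (Suc j)
    then obtain h where h: "?good j h" by auto
    let ?p = "GI_pos a A \<sigma> h j"
    have "P (Suc (k - Suc j)) (fst ?p) (snd ?p)" using h Suc.prems by (simp add: Suc_diff_Suc)
    then obtain c' A' where m: "GI_legal M X ?p (c', A')"
      "\<forall>A''. finite A'' \<and> A' \<subseteq> A'' \<and> A'' \<subseteq> X \<longrightarrow> P (k - Suc j) c' A''"
      using step[of "k - Suc j" "fst ?p" "snd ?p"] h by auto
    let ?h = "h @ [(c', A')]"
    have pos: "GI_pos a A \<sigma> ?h i = GI_pos a A \<sigma> h i" if "i \<le> j" for i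
      using that h by (auto simp: GI_pos_def nth_append)
    have play: "GI_play M a A X \<sigma> ?h"
      unfolding GI_play_def
    proof (intro allI impI)
      fix i assume "i < length ?h"
      then have "i < j \<or> i = j" using h by auto
      then show "GI_legal M X (GI_pos a A \<sigma> ?h i) (?h ! i)"
      proof
        assume i: "i < j"
        then have "GI_legal M X (GI_pos a A \<sigma> h i) (h ! i)" using h unfolding GI_play_def by simp
        then show ?thesis using pos[of i] i h by (simp add: nth_append)
      next
        assume i: "i = j"
        then show ?thesis using pos[of j] m(1) h by (simp add: nth_append)
      qed
    qed
    then have s: "finite (\<sigma> ?h)" "A' \<subseteq> \<sigma> ?h" "\<sigma> ?h \<subseteq> X"
      using W unfolding GI_winning_def by (metis append_is_Nil_conv last_snoc list.discI snd_conv)+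
    have "GI_pos a A \<sigma> ?h (Suc j) = (c', \<sigma> ?h)" using h by (simp add: GI_pos_def nth_append)
    then show ?case using play s m(2) h by (intro exI[of _ ?h]) simp
  qed
  then obtain h where "length h = k" "GI_play M a A X \<sigma> h" by blast
  then show ?thesis using W unfolding GI_winning_def by blast
qed

section \<open>Local character, uniqueness, extension and symmetry over models\<close>

lemma AIV_obtain:
  assumes "set a \<subseteq> CC"
  shows "\<exists>n. \<forall>X A. model X \<and> countable X \<and> finite A \<and> A \<subseteq> X \<longrightarrow> (\<exists>\<sigma>. GI_winning M a A X n \<sigma>)"
proof -
  have "AIV M" using fur unfolding FUR_class_def by (elim conjE)
  then show ?thesis using assms unfolding AIV_def by blast
qed

text \<open>Suppose \<open>c\<close> splits over every finite subset of \<open>X\<close>. If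
  \<open>b\<close>, \<open>d\<close> witness this over the current \<open>A\<close>, an automorphism
  that fixes \<open>A\<close>, preserves \<open>X\<close> and takes \<open>d\<close> to
  \<open>b\<close> moves \<open>c\<close> to a tuple with the same type over \<open>A\<close> but a
  different one over \<open>A\<close> and \<open>b\<close>: a legal move. It preserves the
  assumption on \<open>c\<close>, so player I is never stuck, contradicting the bound
  \<open>n\<close>.\<close>

lemma cmodel_local:
  assumes X: "model X" "countable X" and a: "set a \<subseteq> CC"
  shows "\<exists>E. finite E \<and> E \<subseteq> X \<and> \<not> splits M a X E"
proof (rule ccontr)
  assume neg: "\<not> ?thesis"
  note XC = model_carr[OF X(1)]
  define Q where "Q = (\<lambda>c. set c \<subseteq> CC \<and> (\<forall>E. finite E \<and> E \<subseteq> X \<longrightarrow> splits M c X E))"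
  obtain n where "\<forall>X A. model X \<and> countable X \<and> finite A \<and> A \<subseteq> X \<longrightarrow> (\<exists>\<sigma>. GI_winning M a A X n \<sigma>)"
    using AIV_obtain[OF a] by blast
  then obtain \<sigma> where W: "GI_winning M a {} X n \<sigma>" using X by blast
  have "Suc n \<le> n"
  proof (rule GI_survive[where P = "\<lambda>_ c _. Q c", OF _ W])
    show "Q a" using neg a unfolding Q_def by blast
    fix c A assume Q: "Q c" and A: "finite A" "A \<subseteq> X"
    have cC: "set c \<subseteq> CC" using Q Q_def by blast
    obtain b d where b: "set b \<subseteq> X" "set d \<subseteq> X" "gt A b d" "\<not> gt A (c @ b) (c @ d)"
    proof -
      have "splits M c X A" using Q A unfolding Q_def by blast
      then show ?thesis using that unfolding splits_def wt_fin[OF A(1)] by blast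
    qed
    have "gt A d b" using gt_sym[OF b(3)] b(1) XC by blast
    then obtain f where f: "f \<in> Aut M A" "f ` X = X" "map f d = b"
      using cmodel_auto[OF X A b(2,1)] by blast
    let ?c = "map f c"
    have cC': "set ?c \<subseteq> CC" using map_carr[OF f(1) cC] .
    have cc: "gt A c ?c" using gtI[OF f(1)] by blast
    have "gt A (c @ d) (?c @ b)" using f by (intro gtI[of f]) auto
    then have n: "\<not> gt A (?c @ b) (c @ b)"
      using b(4) gt_trans gt_sym[of A "c @ d" "c @ b"] cC b(2) XC by (metis Un_subset_iff order_trans set_append)
    have "GI_legal M X (c, A) (?c, A \<union> set b)"
      unfolding GI_legal_def using cC' A b(1) gt_sym[OF cc cC] n
      by (simp add: wt_fin gt_Un)
    moreover have "Q ?c"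
      unfolding Q_def
    proof (intro conjI allI impI cC')
      fix E assume E: "finite E \<and> E \<subseteq> X"
      obtain k where k: "k \<in> Aut M {}" "\<forall>x\<in>CC. k (f x) = x"
        using Aut_inv[OF Aut_empty[OF f(1)]] by blast
      have kX: "k ` X = X"
      proof -
        have "k ` X = k ` (f ` X)" using f(2) by simp
        also have "\<dots> = X" using k(2) XC by force
        finally show ?thesis .
      qed
      have kc: "map k ?c = c" using k(2) cC by (simp add: subset_iff map_idI)
      show "splits M ?c X E"
      proof (rule ccontr)
        assume "\<not> splits M ?c X E"
        then have "\<not> splits M (map k ?c) (k ` X) (k ` E)"
          by (rule not_splits_image[OF k(1)]) (use E XC cC' in auto)
        moreover have "k ` E \<subseteq> X" using E kX by blast
        ultimately show False using Q E unfolding Q_def kc kX by blast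
      qed
    qed
    ultimately show "\<exists>c' A'. GI_legal M X (c, A) (c', A') \<and>
        (\<forall>A''. finite A'' \<and> A' \<subseteq> A'' \<and> A'' \<subseteq> X \<longrightarrow> Q c')" by blast
  qed auto
  then show False by simp
qed

text \<open>\<open>w\<close> will choose, for each finite base, parameters witnessing that splitting
  occurs over it; in the countable model \<open>Y\<close> it then still occurs over every finite
  base.\<close>

lemma close_off:
  assumes X: "model X" and Y0: "countable Y0" "Y0 \<subseteq> X"
    and w: "\<And>E. finite E \<Longrightarrow> E \<subseteq> X \<Longrightarrow> countable (w E) \<and> w E \<subseteq> X"
  shows "\<exists>Y. model Y \<and> countable Y \<and> Y0 \<subseteq> Y \<and> Y \<subseteq> X \<and> (\<forall>E. finite E \<and> E \<subseteq> Y \<longrightarrow> w E \<subseteq> Y)"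
proof -
  let ?P = "\<lambda>Y. model Y \<and> countable Y \<and> Y0 \<subseteq> Y \<and> Y \<subseteq> X"
  have "\<exists>Y. \<forall>n::nat. ?P (Y n) \<and> (Y n \<subseteq> Y (Suc n) \<and> (\<forall>E. finite E \<and> E \<subseteq> Y n \<longrightarrow> w E \<subseteq> Y (Suc n)))"
  proof (rule dependent_nat_choice)
    obtain Z where "model Z" "Y0 \<subseteq> Z" "Z \<subseteq> X" "countable Z"
      using ex_cmodel_in[OF Y0(2,1) X] .
    then show "\<exists>Y. ?P Y" by blast
  next
    fix Y :: "'a set" and n :: nat assume P: "?P Y"
    let ?S = "Y \<union> (\<Union>E\<in>{E. finite E \<and> E \<subseteq> Y}. w E)"
    have "countable {E. finite E \<and> E \<subseteq> Y}" using P countable_Collect_finite_subset by blast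
    then have "countable ?S" using P w by auto
    moreover have "?S \<subseteq> X" using P w by blast
    ultimately obtain Z where Z: "model Z" "?S \<subseteq> Z" "Z \<subseteq> X" "countable Z"
      using ex_cmodel_in[of ?S X] X by blast
    then have "w E \<subseteq> Z" if "finite E \<and> E \<subseteq> Y" for E using that by blast
    then show "\<exists>Z. ?P Z \<and> (Y \<subseteq> Z \<and> (\<forall>E. finite E \<and> E \<subseteq> Y \<longrightarrow> w E \<subseteq> Z))"
      using Z P by (intro exI[of _ Z]) blast
  qed
  then obtain Y where Y: "\<And>n::nat. ?P (Y n)" "\<And>n. Y n \<subseteq> Y (Suc n)"
    "\<And>n E. finite E \<and> E \<subseteq> Y n \<longrightarrow> w E \<subseteq> Y (Suc n)" by metis
  have mono: "i \<le> j \<Longrightarrow> Y i \<subseteq> Y j" for i j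
    by (rule lift_Suc_mono_le[of Y]) (use Y(2) in auto)
  have fin: "\<exists>n. E \<subseteq> Y n" if "finite E" "E \<subseteq> (\<Union>n. Y n)" for E
    using that
  proof (induction E)
    case empty then show ?case by blast
  next
    case (insert x E)
    then obtain n m where "E \<subseteq> Y n" "x \<in> Y m" by auto
    then have "insert x E \<subseteq> Y (max n m)" using mono[of n "max n m"] mono[of m "max n m"] by auto
    then show ?case by blast
  qed
  have "model (\<Union>n. Y n)" by (rule model_UN_chain) (use Y in auto)
  moreover have "countable (\<Union>n. Y n)" using Y(1) by auto
  moreover have "w E \<subseteq> (\<Union>n. Y n)" if E: "finite E \<and> E \<subseteq> (\<Union>n. Y n)" for E
  proof -
    obtain n where "E \<subseteq> Y n" using fin E by blast
    then have "w E \<subseteq> Y (Suc n)" using Y(3) E by blast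
    then show ?thesis by blast
  qed
  moreover have "Y0 \<subseteq> (\<Union>n. Y n)" "(\<Union>n. Y n) \<subseteq> X" using Y(1) by blast+
  ultimately show ?thesis by blast
qed

lemma model_local:
  assumes X: "model X" and a: "set a \<subseteq> CC"
  shows "\<exists>E. finite E \<and> E \<subseteq> X \<and> \<not> splits M a X E"
proof (rule ccontr)
  assume neg: "\<not> ?thesis"
  have "\<exists>w. finite w \<and> w \<subseteq> X \<and> splits M a w E" if E: "finite E" "E \<subseteq> X" for E
  proof -
    have "splits M a X E" using neg E by blast
    then obtain b c where "set b \<subseteq> X" "set c \<subseteq> X" "wt E b c" "\<not> wt E (a @ b) (a @ c)"
      unfolding splits_def by blast
    then have "splits M a (set b \<union> set c) E" unfolding splits_def by blast
    then show ?thesis using \<open>set b \<subseteq> X\<close> \<open>set c \<subseteq> X\<close> by (intro exI[of _ "set b \<union> set c"]) simp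
  qed
  then obtain w where w: "\<And>E. finite E \<Longrightarrow> E \<subseteq> X \<Longrightarrow> finite (w E) \<and> w E \<subseteq> X \<and> splits M a (w E) E"
    by metis
  have "\<exists>Y. model Y \<and> countable Y \<and> {} \<subseteq> Y \<and> Y \<subseteq> X \<and> (\<forall>E. finite E \<and> E \<subseteq> Y \<longrightarrow> w E \<subseteq> Y)"
    by (rule close_off[OF X]) (use w in \<open>simp_all add: countable_finite\<close>)
  then obtain Y where Y: "model Y" "countable Y" "Y \<subseteq> X" "\<forall>E. finite E \<and> E \<subseteq> Y \<longrightarrow> w E \<subseteq> Y"
    by blast
  obtain E where E: "finite E" "E \<subseteq> Y" "\<not> splits M a Y E" using cmodel_local[OF Y(1,2) a] by blast
  have "splits M a (w E) E" using w E Y(3) by blast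
  then show False using splits_mono Y(4) E by blast
qed

lemma I_local: "model X \<Longrightarrow> set a \<subseteq> CC \<Longrightarrow> I a X X"
  using model_local[of X a] unfolding I_iff by simp

text \<open>A tuple \<open>d\<close> of \<open>B\<close> has a copy in \<open>X\<close> of the same
  type over \<open>E\<close>. Exchanging the two changes neither the type with \<open>a\<close> nor
  that with \<open>b\<close>, and over \<open>X\<close> these agree.\<close>

lemma not_splits_unique:
  assumes X: "model X" "X \<subseteq> B" "B \<subseteq> CC" and E: "finite E" "E \<subseteq> X"
    and a: "\<not> splits M a B E" "set a \<subseteq> CC" and b: "\<not> splits M b B E" and t: "wt X a b"
  shows "wt B a b"
proof (rule wtI_gt)
  fix d assume d: "set d \<subseteq> B"
  obtain d' where d': "set d' \<subseteq> X" "gt E d' d"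
    using saturated[OF X(1) E, of d] d X(3) by blast
  have d'B: "set d' \<subseteq> B" using d'(1) X(2) by blast
  have dd: "gt E d d'" using gt_sym[OF d'(2)] d'B X(3) by blast
  have "gt E (a @ d) (a @ d')" using not_splitsD[OF a(1) E(1) d d'B dd] .
  moreover have "gt E (a @ d') (b @ d')" using wtD_gt[OF t E d'(1)] .
  moreover have "gt E (b @ d') (b @ d)" using not_splitsD[OF b(1) E(1) d'B d d'(2)] .
  ultimately have "gt E (a @ d) (b @ d)" using gt_trans by blast
  then show "gt {} (a @ d) (b @ d)" using gt_mono by blast
qed

lemma I_unique:
  assumes X: "model X" "B \<subseteq> CC" and a: "I a X B" "set a \<subseteq> CC" and b: "I b X B" and t: "wt X a b"
  shows "wt (X \<union> B) a b"
proof -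
  obtain E where E: "finite E" "E \<subseteq> X" "\<not> splits M a (X \<union> B) E" using a(1) unfolding I_iff by blast
  obtain F where F: "finite F" "F \<subseteq> X" "\<not> splits M b (X \<union> B) F" using b unfolding I_iff by blast
  have "\<not> splits M a (X \<union> B) (E \<union> F)" by (rule not_splits_base[OF E(3)]) (use E F in auto)
  moreover have "\<not> splits M b (X \<union> B) (E \<union> F)" by (rule not_splits_base[OF F(3)]) (use E F in auto)
  ultimately show ?thesis
    using not_splits_unique[OF X(1), of "X \<union> B" "E \<union> F" a b] X model_carr[OF X(1)] E F a(2) t by blast
qed

text \<open>Over \<open>E \<union> F\<close> two tuples of \<open>B\<close> may be replaced by
  copies in \<open>Y\<close>, where \<open>E\<close> is a base. So one base of the type over
  \<open>Y\<close> serves every \<open>B\<close> from which \<open>a\<close> is independent over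
  \<open>Y\<close>.\<close>

lemma not_splits_trans:
  assumes Y: "model Y" "Y \<subseteq> B" "B \<subseteq> CC" and E: "finite E" "E \<subseteq> Y" "\<not> splits M a Y E"
    and F: "finite F" "F \<subseteq> Y" "\<not> splits M a B F" and a: "set a \<subseteq> CC"
  shows "\<not> splits M a B E"
proof (rule not_splitsI[OF E(1)])
  fix b c assume b: "set b \<subseteq> B" "set c \<subseteq> B" "gt E b c"
  let ?G = "E \<union> F"
  have G: "finite ?G" "?G \<subseteq> Y" using E F by auto
  have nG: "\<not> splits M a B ?G" by (rule not_splits_base[OF F(3) G(1)]) (use G Y in auto)
  obtain w where w: "set w \<subseteq> Y" "gt ?G w (b @ c)"
    by (rule saturated[OF Y(1) G, of "b @ c"]) (use b Y(3) in auto)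
  define b' c' where "b' = take (length b) w" and "c' = drop (length b) w"
  have lw: "length w = length b + length c" using gt_length[OF w(2)] by simp
  have w': "w = b' @ c'" "length b' = length b" by (simp_all add: b'_def c'_def lw)
  have sub: "set b' \<subseteq> Y" "set c' \<subseteq> Y" using w(1) w' by auto
  have subB: "set b' \<subseteq> B" "set c' \<subseteq> B" using sub Y(2) by auto
  have gb: "gt ?G b' b" and gc: "gt ?G c' c" using gt_app1 gt_app2 w(2) w' by blast+
  have gb': "gt ?G b b'" using gt_sym[OF gb] sub Y model_carr by blast
  have "gt ?G (a @ b) (a @ b')" using not_splitsD[OF nG G(1) b(1) subB(1) gb'] .
  then have 1: "gt E (a @ b) (a @ b')" using gt_mono by blast
  have "gt ?G (a @ c') (a @ c)" using not_splitsD[OF nG G(1) subB(2) b(2) gc] .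
  then have 3: "gt E (a @ c') (a @ c)" using gt_mono by blast
  have "gt E b' b" "gt E c' c" using gb gc gt_mono by blast+
  moreover have "gt E c c'" using gt_sym[OF \<open>gt E c' c\<close>] sub Y model_carr by blast
  ultimately have "gt E b' c'" using b(3) gt_trans by blast
  then have "gt E (a @ b') (a @ c')" using not_splitsD[OF E(3,1) sub] by blast
  then show "gt E (a @ b) (a @ c)" using 1 3 gt_trans by blast
qed

lemma I_trans:
  assumes Y: "model Y" "X \<subseteq> Y" "B \<subseteq> CC" and a: "set a \<subseteq> CC" and I: "I a X Y" "I a Y B"
  shows "I a X B"
proof -
  obtain E where E: "finite E" "E \<subseteq> X" "\<not> splits M a Y E"
    using I(1) Y(2) unfolding I_iff by (metis sup.absorb2)
  obtain F where F: "finite F" "F \<subseteq> Y" "\<not> splits M a (Y \<union> B) F" using I(2) unfolding I_iff by blast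
  have "\<not> splits M a (Y \<union> B) E"
    by (rule not_splits_trans[OF Y(1) _ _ E(1) _ E(3) F a]) (use E Y model_carr in auto)
  then have "\<not> splits M a (X \<union> B) E" using splits_mono Y(2) by (meson Un_mono order_refl)
  then show ?thesis using E unfolding I_iff by blast
qed

text \<open>By \<open>not_splits_trans\<close> the base of the type over \<open>X\<close> works for
  all \<open>b\<close> at once, and a splitting pair involves only finitely many elements of
  \<open>B\<close>.\<close>

lemma I_finite_char:
  assumes X: "model X" "B \<subseteq> CC" and a: "set a \<subseteq> CC" and I: "\<And>b. set b \<subseteq> B \<Longrightarrow> I a X (set b)"
  shows "I a X B"
proof -
  obtain E where E: "finite E" "E \<subseteq> X" "\<not> splits M a X E" using model_local[OF X(1) a] by blast
  have "\<not> splits M a (X \<union> B) E"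
  proof (rule not_splitsI[OF E(1)])
    fix c d assume c: "set c \<subseteq> X \<union> B" "set d \<subseteq> X \<union> B" "gt E c d"
    obtain l where l: "set l = (set c \<union> set d) \<inter> B" using finite_list[of "(set c \<union> set d) \<inter> B"] by auto
    then have lB: "set l \<subseteq> B" by blast
    obtain F where F: "finite F" "F \<subseteq> X" "\<not> splits M a (X \<union> set l) F" using I[OF lB] unfolding I_iff by blast
    have "\<not> splits M a (X \<union> set l) E"
      by (rule not_splits_trans[OF X(1) _ _ E F a]) (use lB X model_carr in auto)
    then show "gt E (a @ c) (a @ d)" by (rule not_splitsD[OF _ E(1) _ _ c(3)]) (use c l in auto)
  qed
  then show ?thesis using E unfolding I_iff by blast
qed

text \<open>AVI gives a map that agrees on the new model, for each finite subset of
  \<open>X\<close>, with some automorphism fixing that subset. Comparing with those fixing one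
  \<open>x\<close> shows that the map is the identity on \<open>X\<close>; hence the inverse of any
  one of these automorphisms fixes \<open>X\<close> pointwise.\<close>

lemma free_copy:
  assumes X: "model X" "model W" "X \<subseteq> W" "model D" "X \<subseteq> D"
  shows "\<exists>f\<in>Aut M X. \<forall>c. set c \<subseteq> f ` W \<longrightarrow> I c X D"
proof -
  have "AVI M" using fur unfolding FUR_class_def by (elim conjE)
  then obtain C where C: "model C" "set_tp_eq M X C W" "ns_indep_set M C X D"
    using X unfolding AVI_def by (metis Int_subset_iff)
  obtain h where h: "h ` C = W" "\<forall>B. finite B \<and> B \<subseteq> X \<longrightarrow> (\<exists>f\<in>Aut M B. \<forall>x\<in>C. f x = h x)"
    using C(2) unfolding set_tp_eq_def by blast
  note cC = model_carr[OF C(1)]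
  obtain g where g: "g \<in> Aut M {}" "\<forall>x\<in>C. g x = h x" using h(2) by blast
  obtain f where f: "f \<in> Aut M {}" "\<forall>x\<in>CC. f (g x) = x" using Aut_inv[OF g(1)] by blast
  have fh: "f (h x) = x" if "x \<in> C" for x using f(2) g(2) that cC by (metis subsetD)
  have "f ` W = (\<lambda>x. f (h x)) ` C" using h(1) by auto
  then have fW: "f ` W = C" using fh by simp
  have "f x = x" if x: "x \<in> X" for x
  proof -
    obtain y where y: "y \<in> C" "h y = x" using x X(3) h(1) by blast
    obtain q where q: "q \<in> Aut M {x}" "\<forall>y\<in>C. q y = h y" using h(2) x by blast
    have "q y = q x" using q y Aut_fix[OF q(1), of x] by simp
    then have "y = x" using Aut_inj[OF q(1), of y x] y(1) cC x model_carr[OF X(1)] by blast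
    then show ?thesis using fh[OF y(1)] y(2) by simp
  qed
  then have "f \<in> Aut M X" using Aut_fixI[OF f(1)] by blast
  then show ?thesis using C(3) fW unfolding ns_indep_set_def by metis
qed

lemma I_ext:
  assumes X: "model X" "D \<subseteq> CC" "bounded_set M D" and a: "set a \<subseteq> CC"
  shows "\<exists>b. wt X b a \<and> I b X D \<and> set b \<subseteq> CC"
proof -
  note bX = model_bd[OF X(1)] and cX = model_carr[OF X(1)]
  obtain W where W: "model W" "X \<union> set a \<subseteq> W"
    using ex_model[of "X \<union> set a"] bd_Un[OF bX bd_finite] cX a by auto
  obtain D' where D': "model D'" "X \<union> D \<subseteq> D'"
    using ex_model[of "X \<union> D"] bd_Un[OF bX X(3)] cX X(2) by auto
  obtain f where f: "f \<in> Aut M X" "\<forall>c. set c \<subseteq> f ` W \<longrightarrow> I c X D'"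
    using free_copy[OF X(1) W(1) _ D'(1)] W(2) D'(2) by blast
  have 1: "wt X (map f a) a" using gt_sym[OF gtI[OF f(1) refl] a] by (rule wt_gt)
  have "set (map f a) \<subseteq> f ` W" using W(2) by auto
  then have "I (map f a) X D'" using f(2) by blast
  then have "I (map f a) X D" by (rule I_mono) (use D'(2) in auto)
  then show ?thesis using 1 map_carr[OF f(1) a] by blast
qed

text \<open>A candidate splitting pair uses finitely many elements of \<open>X\<close>; an
  automorphism fixing these and the base, and carrying \<open>a\<close>, \<open>b\<close> to
  \<open>a'\<close>, \<open>b'\<close>, pulls it back.\<close>

lemma I_transfer:
  assumes I: "I a X (set b)" and t: "wt X (a @ b) (a' @ b')" and l: "length a = length a'"
    and X: "X \<subseteq> CC" and a: "set a \<subseteq> CC" "set b \<subseteq> CC"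
  shows "I a' X (set b')"
proof -
  obtain E where E: "finite E" "E \<subseteq> X" "\<not> splits M a (X \<union> set b) E" using I unfolding I_iff by blast
  have ab': "set a' \<subseteq> CC" "set b' \<subseteq> CC" using wt_carr[OF t] a by auto
  have "\<not> splits M a' (X \<union> set b') E"
  proof (rule not_splitsI[OF E(1)])
    fix x y assume x: "set x \<subseteq> X \<union> set b'" "set y \<subseteq> X \<union> set b'" "gt E x y"
    let ?F = "E \<union> ((set x \<union> set y) \<inter> X)"
    have "gt ?F (a @ b) (a' @ b')" by (rule wtD[OF t]) (use E in auto)
    then obtain f where f: "f \<in> Aut M ?F" "map f a = a'" "map f b = b'" using gt_app l by blast
    have fE: "f \<in> Aut M E" using Aut_mono[OF f(1)] by blast
    have lift: "\<exists>z0. set z0 \<subseteq> X \<union> set b \<and> map f z0 = z"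
      if z: "set z \<subseteq> X \<union> set b'" "set z \<subseteq> set x \<union> set y" for z
    proof -
      have "\<exists>u. u \<in> X \<union> set b \<and> f u = v" if v: "v \<in> set z" for v
      proof (cases "v \<in> X")
        case True
        then have "f v = v" using Aut_fix[OF f(1)] v z(2) by blast
        then show ?thesis using True by blast
      next
        case False
        then have "v \<in> f ` set b" using v z(1) f(3) by auto
        then show ?thesis by blast
      qed
      then obtain u where u: "\<And>v. v \<in> set z \<Longrightarrow> u v \<in> X \<union> set b \<and> f (u v) = v" by metis
      then have "map f (map u z) = z" "set (map u z) \<subseteq> X \<union> set b" by (auto intro: map_idI)
      then show ?thesis by blast
    qed
    obtain x0 where x0: "set x0 \<subseteq> X \<union> set b" "map f x0 = x" using lift[OF x(1)] by blast
    obtain y0 where y0: "set y0 \<subseteq> X \<union> set b" "map f y0 = y" using lift[OF x(2)] by blast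
    have y0C: "set y0 \<subseteq> CC" "set x0 \<subseteq> CC" using y0 x0 X a by blast+
    have "gt E x0 x" using gtI[OF fE x0(2)] .
    moreover have "gt E y y0" using gt_sym[OF gtI[OF fE y0(2)] y0C(1)] .
    ultimately have "gt E x0 y0" using x(3) gt_trans by blast
    then have m: "gt E (a @ x0) (a @ y0)" using not_splitsD[OF E(3,1) x0(1) y0(1)] by blast
    have "gt E (a @ x0) (a' @ x)" using fE f(2) x0(2) by (intro gtI[of f]) auto
    then have "gt E (a' @ x) (a @ x0)" using gt_sym a y0C by auto
    moreover have "gt E (a @ y0) (a' @ y)" using fE f(2) y0(2) by (intro gtI[of f]) auto
    ultimately show "gt E (a' @ x) (a' @ y)" using m gt_trans by blast
  qed
  then show ?thesis using E unfolding I_iff by blast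
qed

text \<open>AV wants a whole model independent from \<open>a\<close>, so a model around
  \<open>b\<close> is replaced by a free copy. By uniqueness the copy of \<open>b\<close> has the
  type of \<open>b\<close> over \<open>X\<close> and \<open>a\<close>, and the conclusion
  transfers.\<close>

lemma I_sym_countable:
  assumes X: "model X" "countable X" and a: "set a \<subseteq> CC" "set b \<subseteq> CC" and I: "I b X (set a)"
  shows "I a X (set b)"
proof -
  note cX = model_carr[OF X(1)]
  obtain W where W: "model W" "X \<union> set b \<subseteq> W" "countable W"
    by (rule ex_cmodel[of "X \<union> set b"]) (use X(2) cX a in \<open>auto intro: countable_finite\<close>)
  obtain D where D: "model D" "X \<union> set a \<subseteq> D"
    by (rule ex_cmodel[of "X \<union> set a"]) (use X(2) cX a in \<open>auto intro: countable_finite\<close>)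
  obtain f where f: "f \<in> Aut M X" "\<forall>c. set c \<subseteq> f ` W \<longrightarrow> I c X D"
    using free_copy[OF X(1) W(1) _ D(1)] W(2) D(2) by blast
  let ?b = "map f b" and ?C = "f ` W"
  have bb: "wt X b ?b" using gtI[OF f(1) refl] by (rule wt_gt)
  have bC: "set ?b \<subseteq> ?C" using W(2) by auto
  have "I c X (set a)" if "set c \<subseteq> ?C" for c
    by (rule I_mono[of c X D]) (use f(2) that D(2) in auto)
  moreover have "X \<subseteq> ?C"
  proof
    fix x assume "x \<in> X"
    then have "f x = x" "x \<in> W" using Aut_fix[OF f(1)] W(2) by auto
    then show "x \<in> ?C" by (metis imageI)
  qed
  moreover have "countable ?C" using W(3) by auto
  moreover have "AV M" using fur unfolding FUR_class_def by (elim conjE)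
  moreover have "model ?C" using model_image[OF f(1) W(1)] .
  ultimately have "I a X ?C"
    using X a(1) unfolding AV_def ns_indep_set_def by blast
  then have Iab: "I a X (set ?b)" by (rule I_mono) (use bC in auto)
  have "I ?b X (set a)" using f(2) bC D(2) I_mono[of ?b X D X "set a"] by blast
  then have "wt (X \<union> set a) b ?b" using I_unique[OF X(1) a(1) I a(2) _ bb] by blast
  then have "wt X (b @ a) (?b @ a)" by (simp add: wt_Un)
  then have "wt X (a @ b) (a @ ?b)" by (rule wt_swap) simp
  then have "wt X (a @ ?b) (a @ b)" by (rule wt_sym) (use a in auto)
  then show ?thesis
    by (rule I_transfer[OF Iab]) (use cX a wt_carr[OF bb] in auto)
qed

text \<open>A failure over \<open>X\<close> has parameters witnessing splitting over each finite
  subset. It persists over a countable model closed under these parameters and containing a base for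
  \<open>b\<close>.\<close>

lemma I_sym:
  assumes X: "model X" and a: "set a \<subseteq> CC" "set b \<subseteq> CC" and I: "I b X (set a)"
  shows "I a X (set b)"
proof (rule ccontr)
  assume neg: "\<not> I a X (set b)"
  obtain E where E: "finite E" "E \<subseteq> X" "\<not> splits M b (X \<union> set a) E" using I unfolding I_iff by blast
  have "\<exists>w. finite w \<and> w \<subseteq> X \<and> splits M a (w \<union> set b) F" if F: "finite F" "F \<subseteq> X" for F
  proof -
    have "splits M a (X \<union> set b) F" using neg F unfolding I_iff by blast
    then obtain x y where x: "set x \<subseteq> X \<union> set b" "set y \<subseteq> X \<union> set b" "wt F x y" "\<not> wt F (a @ x) (a @ y)"
      unfolding splits_def by blast
    let ?w = "(set x \<union> set y) \<inter> X"
    have "set x \<subseteq> ?w \<union> set b" "set y \<subseteq> ?w \<union> set b" using x(1,2) by auto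
    then have "splits M a (?w \<union> set b) F" using x(3,4) unfolding splits_def by blast
    then show ?thesis by (intro exI[of _ ?w]) auto
  qed
  then obtain w where w: "\<And>F. finite F \<Longrightarrow> F \<subseteq> X \<Longrightarrow> finite (w F) \<and> w F \<subseteq> X \<and> splits M a (w F \<union> set b) F"
    by metis
  have "\<exists>Y. model Y \<and> countable Y \<and> E \<subseteq> Y \<and> Y \<subseteq> X \<and> (\<forall>F. finite F \<and> F \<subseteq> Y \<longrightarrow> w F \<subseteq> Y)"
    by (rule close_off[OF X]) (use w E in \<open>simp_all add: countable_finite\<close>)
  then obtain Y where Y: "model Y" "countable Y" "E \<subseteq> Y" "Y \<subseteq> X" "\<forall>F. finite F \<and> F \<subseteq> Y \<longrightarrow> w F \<subseteq> Y"
    by blast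
  have "\<not> splits M b (Y \<union> set a) E" using E(3) splits_mono Y(4) by (meson Un_mono order_refl)
  then have "I b Y (set a)" using E(1) Y(3) unfolding I_iff by blast
  then have "I a Y (set b)" using I_sym_countable[OF Y(1,2) a] by blast
  then obtain F where F: "finite F" "F \<subseteq> Y" "\<not> splits M a (Y \<union> set b) F" unfolding I_iff by blast
  have "splits M a (w F \<union> set b) F" using w F Y(4) by blast
  moreover have "w F \<union> set b \<subseteq> Y \<union> set b" using Y(5) F by blast
  ultimately show False using F(3) splits_mono by blast
qed

text \<open>Let \<open>y'\<close> in \<open>X\<close> have the type of \<open>x\<close> over the
  base. Non-splitting, tested on \<open>y'\<close> and \<open>x\<close> itself, gives the pair
  \<open>x\<close>, \<open>y'\<close> the type of the pair \<open>x\<close>,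
  \<open>x\<close>.\<close>

lemma I_self:
  assumes X: "model X" and a: "set a \<subseteq> CC" and I: "I a X (set a)"
  shows "set a \<subseteq> X"
proof
  fix x assume x: "x \<in> set a"
  have "I [x] X (set a)" by (rule I_subset[OF I]) (use x in auto)
  then obtain E where E: "finite E" "E \<subseteq> X" "\<not> splits M [x] (X \<union> set a) E" unfolding I_iff by blast
  obtain y where y: "set y \<subseteq> X" "gt E y [x]" using saturated[OF X E(1,2), of "[x]"] x a by auto
  obtain y' where y': "y = [y']" using gt_length[OF y(2)] by (cases y) auto
  have "gt E ([x] @ y) ([x] @ [x])" by (rule not_splitsD[OF E(3,1) _ _ y(2)]) (use y x in auto)
  then obtain f where f: "f \<in> Aut M E" "map f ([x] @ y) = [x] @ [x]" by (rule gtE)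
  then have "f x = f y'" using y' by simp
  moreover have "y' \<in> X" using y(1) y' by simp
  ultimately show "x \<in> X" using Aut_inj[OF f(1), of x y'] x a model_carr[OF X] by auto
qed

subsection \<open>Galois types over models\<close>

lemma s_primaryD:
  assumes "s_primary M X a Y"
  shows "model Y" "X \<subseteq> Y" "set a \<subseteq> Y"
  using assms unfolding s_primary_def by auto

lemma s_primary_countable:
  assumes "s_primary M X a Y" "countable X"
  shows "countable Y"
proof -
  obtain s :: "nat \<Rightarrow> 'a" where "Y = X \<union> set a \<union> range s"
    using assms(1) unfolding s_primary_def by blast
  then show ?thesis using assms(2) by (simp add: countable_finite)
qed

text \<open>The definition isolates initial segments of the enumeration. A finite \<open>c\<close>
  is covered by such a segment \<open>S\<close>, the tuple \<open>a\<close> and finitely many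
  elements of \<open>X\<close>, which join the base.\<close>

lemma s_primary_isolated:
  assumes Y: "s_primary M X a Y" and c: "set c \<subseteq> Y"
  shows "\<exists>E S. finite E \<and> E \<subseteq> X \<and> set S \<subseteq> Y \<and> set c \<subseteq> E \<union> set a \<union> set S \<and>
    (\<forall>a' S'. set a' \<subseteq> CC \<and> set S' \<subseteq> CC \<and> length S' = length S \<and> wt X a' a \<and> gt E (a' @ S') (a @ S) \<longrightarrow>
      wt X (a' @ S') (a @ S))"
proof -
  obtain s :: "nat \<Rightarrow> 'a" where s: "Y = X \<union> set a \<union> range s"
    "\<And>n. \<exists>A. finite A \<and> A \<subseteq> X \<and>
        (\<forall>a' s'. set a' \<subseteq> carr M \<and> set s' \<subseteq> carr M \<and> length s' = Suc n \<and>
           wt X a' a \<and> wt A (a' @ s') (a @ map s [0..<Suc n]) \<longrightarrow>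
           wt X (a' @ s') (a @ map s [0..<Suc n]))"
    using Y unfolding s_primary_def by metis
  have "\<exists>n. set c \<subseteq> X \<union> set a \<union> s ` {0..<Suc n}"
    using c
  proof (induction c)
    case Nil then show ?case by simp
  next
    case (Cons x c)
    then obtain n where n: "set c \<subseteq> X \<union> set a \<union> s ` {0..<Suc n}" by auto
    have "x \<in> X \<union> set a \<union> range s" using Cons.prems s(1) by simp
    then obtain m where "x \<in> X \<union> set a \<union> s ` {0..<Suc m}" by fastforce
    then have "x \<in> X \<union> set a \<union> s ` {0..<Suc (max n m)}" by fastforce
    moreover have "s ` {0..<Suc n} \<subseteq> s ` {0..<Suc (max n m)}" by (intro image_mono) auto
    ultimately have "set (x # c) \<subseteq> X \<union> set a \<union> s ` {0..<Suc (max n m)}" using n by auto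
    then show ?case by blast
  qed
  then obtain n where n: "set c \<subseteq> X \<union> set a \<union> s ` {0..<Suc n}" by blast
  let ?S = "map s [0..<Suc n]"
  have S: "set ?S = s ` {0..<Suc n}" "length ?S = Suc n" by (simp_all only: set_map set_upt length_map length_upt diff_zero)
  obtain A where A: "finite A" "A \<subseteq> X" "\<forall>a' s'. set a' \<subseteq> carr M \<and> set s' \<subseteq> carr M \<and> length s' = Suc n \<and>
           wt X a' a \<and> wt A (a' @ s') (a @ ?S) \<longrightarrow> wt X (a' @ s') (a @ ?S)" using s(2)[of n] by blast
  let ?E = "A \<union> (set c \<inter> X)"
  have "set c \<subseteq> ?E \<union> set a \<union> set ?S" using n unfolding S(1) by blast
  moreover have "set ?S \<subseteq> Y" unfolding S(1) s(1) by blast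
  moreover have "wt X (a' @ S') (a @ ?S)"
    if "set a' \<subseteq> CC \<and> set S' \<subseteq> CC \<and> length S' = length ?S \<and> wt X a' a \<and> gt ?E (a' @ S') (a @ ?S)" for a' S'
  proof -
    have "gt A (a' @ S') (a @ ?S)" using that gt_mono by blast
    then have "wt A (a' @ S') (a @ ?S)" by (rule wt_gt)
    then show ?thesis using A(3) that S(2) by metis
  qed
  ultimately show ?thesis using A(1,2) by (intro exI[of _ ?E] exI[of _ ?S]) auto
qed

text \<open>Saturation copies \<open>S\<close> into \<open>Y'\<close> over \<open>E\<close> and
  \<open>c'\<close>, with the right type over \<open>E\<close> only; isolation raises this to the
  type over all of \<open>X\<close>. It is relative to the type of \<open>a\<close>, so the partial
  map must extend the one taking \<open>a\<close> to \<open>b\<close>.\<close>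

lemma s_primary_forth:
  assumes Y: "s_primary M X a Y" and Y': "model Y'" "X \<subseteq> Y'"
    and c: "set c \<subseteq> Y" "set c' \<subseteq> Y'" "wt X c c'" "c = a @ u" "c' = b @ v" "length a = length b"
    and z: "z \<in> Y"
  shows "\<exists>y\<in>Y'. wt X (c @ [z]) (c' @ [y])"
proof -
  have YC: "Y \<subseteq> CC" "Y' \<subseteq> CC" using model_carr s_primaryD(1)[OF Y] Y'(1) by auto
  have aC: "set a \<subseteq> CC" "set b \<subseteq> CC" using c YC by auto
  obtain E S where E: "finite E" "E \<subseteq> X" "set S \<subseteq> Y" "set (c @ [z]) \<subseteq> E \<union> set a \<union> set S"
    and iso: "\<forall>a' S'. set a' \<subseteq> CC \<and> set S' \<subseteq> CC \<and> length S' = length S \<and> wt X a' a \<and> gt E (a' @ S') (a @ S) \<longrightarrow>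
      wt X (a' @ S') (a @ S)"
    using s_primary_isolated[OF Y, of "c @ [z]"] c(1) z by auto
  obtain f where f: "f \<in> Aut M E" "map f c = c'" using wtD[OF c(3) E(1,2)] by (rule gtE)
  have fS: "set (map f S) \<subseteq> CC" by (rule map_carr[OF f(1)]) (use E(3) YC in blast)
  obtain e where e: "set e \<subseteq> Y'" "gt (E \<union> set c') e (map f S)"
    by (rule saturated[OF Y'(1), of "E \<union> set c'" "map f S"]) (use E Y'(2) c(2) fS in auto)
  have eC: "set e \<subseteq> CC" using e(1) YC(2) by blast
  obtain k where k: "k \<in> Aut M (E \<union> set c')" "map k (map f S) = e"
    using gt_sym[OF e(2) eC] by (rule gtE)
  define q where "q = k \<circ> f"
  have q: "q \<in> Aut M E" unfolding q_def by (intro Aut_comp f(1) Aut_mono[OF k(1)]) blast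
  have "map k c' = c'" using Aut_fix[OF k(1)] by (intro map_idI) blast
  then have qc: "map q c = c'" using f(2) unfolding q_def by (metis map_map)
  have qS: "map q S = e" using k(2) by (simp add: q_def)
  have qa: "map q a = b" using qc c(4,5,6) by simp
  have "gt E (a @ S) (b @ e)" using q qa qS by (intro gtI[of q]) auto
  then have g: "gt E (b @ e) (a @ S)" by (rule gt_sym) (use aC E(3) YC in auto)
  have "wt X a b" using c(3-6) wt_app1 by blast
  then have ba: "wt X b a" using wt_sym aC(1) by blast
  have "length e = length S" using qS by auto
  then have "wt X (b @ e) (a @ S)" using iso aC(2) eC ba g by blast
  then have t: "wt X (a @ S) (b @ e)" by (rule wt_sym) (use aC eC in auto)
  have qz: "q z \<in> Y'"
  proof -
    have "z \<in> E \<or> z \<in> set a \<or> z \<in> set S" using E(4) by auto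
    moreover have "q z = z \<and> z \<in> Y'" if "z \<in> E" using Aut_fix[OF q that] that E(2) Y'(2) by blast
    moreover have "q z \<in> set c'" if "z \<in> set a" using qa c(5) that by auto
    moreover have "q z \<in> set e" if "z \<in> set S" using qS that by auto
    ultimately show ?thesis using c(2) e(1) by auto
  qed
  \<comment> \<open>\<open>q\<close> fixes only \<open>E\<close>. For further parameters
    \<open>B\<close> an automorphism \<open>r\<close> fixing them too is taken; it acts like
    \<open>q\<close> on \<open>c\<close> and \<open>z\<close>, whose entries come from
    \<open>E\<close>, \<open>a\<close> and \<open>S\<close>.\<close>
  have "wt X (c @ [z]) (c' @ [q z])"
  proof (rule wtI)
    fix B assume B: "finite B" "B \<subseteq> X"
    have "gt (B \<union> E) (a @ S) (b @ e)" by (rule wtD[OF t]) (use B E in auto)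
    then obtain r where r: "r \<in> Aut M (B \<union> E)" "map r (a @ S) = b @ e" by (rule gtE)
    have rq: "map r (a @ S) = map q (a @ S)" using r(2) qa qS by simp
    have "r x = q x" if x: "x \<in> set (c @ [z])" for x
    proof (cases "x \<in> E")
      case True
      then show ?thesis using Aut_fix[OF r(1), of x] Aut_fix[OF q, of x] by simp
    next
      case False
      then have "x \<in> set (a @ S)" using x E(4) by auto
      then show ?thesis using rq by (meson map_eq_conv)
    qed
    then have "map r (c @ [z]) = map q (c @ [z])" by (meson map_eq_conv)
    then have "map r (c @ [z]) = c' @ [q z]" using qc by simp
    moreover have "r \<in> Aut M B" using Aut_mono[OF r(1)] by blast
    ultimately show "gt B (c @ [z]) (c' @ [q z])" using gtI by blast
  qed
  then show ?thesis using qz by blast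
qed

lemma s_primary_unique:
  assumes X: "countable X" and Y: "s_primary M X a Y" "s_primary M X b Y'" and t: "wt X a b"
  shows "\<exists>f\<in>Aut M X. map f a = b \<and> f ` Y = Y'"
proof -
  note D = s_primaryD[OF Y(1)] and D' = s_primaryD[OF Y(2)]
  note cY = model_carr[OF D(1)] and cY' = model_carr[OF D'(1)]
  let ?R = "\<lambda>c c'. (\<exists>u. c = a @ u) \<and> (\<exists>v. c' = b @ v) \<and> set c \<subseteq> Y \<and> set c' \<subseteq> Y' \<and> wt X c c'"
  have l: "length a = length b" using wt_length[OF t] .
  have "\<exists>h. bij_betw h Y Y' \<and> map h a = b \<and>
    (\<forall>c. set c \<subseteq> Y \<longrightarrow> (\<exists>a. ?R a (map h a) \<and> set c \<subseteq> set a))"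
  proof (rule back_and_forth)
    show "countable Y" "countable Y'" using s_primary_countable X Y by auto
    show "?R a b" using t D(3) D'(3) by simp
    show "?R c c' \<Longrightarrow> set c \<subseteq> Y \<and> set c' \<subseteq> Y' \<and> length c = length c'" for c c'
      using wt_length by blast
  next
    fix c c' i j assume R: "?R c c'" "i < length c" "j < length c"
    then have "gt {} c c'" using wtD[of X c c' "{}"] by blast
    then show "c ! i = c ! j \<longleftrightarrow> c' ! i = c' ! j" by (rule gt_nth_eq) (use R cY in auto)
  next
    fix c c' x assume R: "?R c c'" and x: "x \<in> Y"
    obtain u v where uv: "c = a @ u" "c' = b @ v" using R by blast
    obtain y where "y \<in> Y'" "wt X (c @ [x]) (c' @ [y])"
      using s_primary_forth[OF Y(1) D'(1,2) _ _ _ uv l x] R by blast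
    then show "\<exists>y. ?R (c @ [x]) (c' @ [y])" using R x by auto
  next
    fix c c' y assume R: "?R c c'" and y: "y \<in> Y'"
    obtain u v where uv: "c = a @ u" "c' = b @ v" using R by blast
    have "wt X c' c" using wt_sym[of X c c'] R cY by blast
    then obtain x where x: "x \<in> Y" "wt X (c' @ [y]) (c @ [x])"
      using s_primary_forth[OF Y(2) D(1,2) _ _ _ uv(2,1) l[symmetric] y] R by blast
    have "wt X (c @ [x]) (c' @ [y])" by (rule wt_sym[OF x(2)]) (use R y cY' in auto)
    then show "\<exists>x. ?R (c @ [x]) (c' @ [y])" using R x y by auto
  qed
  then obtain h where h: "bij_betw h Y Y'" "map h a = b"
    "\<forall>c. set c \<subseteq> Y \<longrightarrow> (\<exists>a. ?R a (map h a) \<and> set c \<subseteq> set a)" by blast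
  have th: "wt X c (map h c)" if "set c \<subseteq> Y" for c
  proof (rule wtI)
    fix B assume B: "finite B" "B \<subseteq> X"
    obtain d where d: "wt X d (map h d)" "set c \<subseteq> set d" using h(3) \<open>set c \<subseteq> Y\<close> by blast
    obtain f where f: "f \<in> Aut M B" "map f d = map h d" using wtD[OF d(1) B] by (rule gtE)
    have "map f c = map h c" using f(2) d(2) by auto
    then show "gt B c (map h c)" using gtI[OF f(1)] by blast
  qed
  have "\<And>c. set c \<subseteq> Y \<Longrightarrow> gt {} c (map h c)" using wtD[OF th] by blast
  then obtain f where f: "f \<in> Aut M {}" "\<And>x. x \<in> Y \<Longrightarrow> f x = h x"
    using homogeneous[OF D(1) D'(1) h(1)] by metis
  have fx: "f x = x" if x: "x \<in> X" for x
  proof -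
    have xY: "x \<in> Y" using x D(2) by blast
    have "gt {x} [x] (map h [x])" by (rule wtD[OF th]) (use x xY in auto)
    then obtain k where "k \<in> Aut M {x}" "map k [x] = map h [x]" by (rule gtE)
    then have "h x = x" using Aut_fix[of k "{x}" x] by simp
    then show ?thesis using f(2)[OF xY] by simp
  qed
  have "f \<in> Aut M X" using Aut_fixI[OF f(1)] fx by blast
  moreover have "f ` Y = Y'" using f(2) h(1) by (simp add: bij_betw_def)
  moreover have "map f a = b"
  proof -
    have "map f a = map h a" using f(2) D(3) by auto
    then show ?thesis using h(2) by simp
  qed
  ultimately show ?thesis by blast
qed

lemma ex_s_primary: "model X \<Longrightarrow> countable X \<Longrightarrow> set a \<subseteq> CC \<Longrightarrow> \<exists>Y. s_primary M X a Y"
proof -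
  have "AII M" using fur unfolding FUR_class_def by (elim conjE)
  then show "model X \<Longrightarrow> countable X \<Longrightarrow> set a \<subseteq> CC \<Longrightarrow> \<exists>Y. s_primary M X a Y"
    unfolding AII_def by blast
qed

text \<open>The s-primary model is dominated by its generator. In this form AII supplies the
  independence hypothesis of AIII.\<close>

lemma s_primary_dominated:
  assumes X: "model X" and Y: "s_primary M X a Y" and I: "I a X C" and C: "C \<subseteq> CC" and c: "set c \<subseteq> Y"
  shows "I c X C"
proof -
  note D = s_primaryD[OF Y]
  have YC: "Y \<subseteq> CC" using model_carr[OF D(1)] .
  have XC: "X \<union> C \<subseteq> CC" using C model_carr[OF X] by blast
  obtain E S where E: "finite E" "E \<subseteq> X" "set S \<subseteq> Y" "set c \<subseteq> E \<union> set a \<union> set S"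
    and iso: "\<forall>a' S'. set a' \<subseteq> CC \<and> set S' \<subseteq> CC \<and> length S' = length S \<and> wt X a' a \<and> gt E (a' @ S') (a @ S) \<longrightarrow>
      wt X (a' @ S') (a @ S)"
    using s_primary_isolated[OF Y c] by blast
  obtain F where F: "finite F" "F \<subseteq> X" "\<not> splits M a (X \<union> C) F" using I unfolding I_iff by blast
  let ?G = "E \<union> F"
  have G: "finite ?G" "?G \<subseteq> X" using E F by auto
  have nG: "\<not> splits M a (X \<union> C) ?G" by (rule not_splits_base[OF F(3) G(1)]) (use G in auto)
  have aC: "set a \<subseteq> CC" "set S \<subseteq> CC" using D(3) E(3) YC by auto
  \<comment> \<open>Isolation speaks of types over \<open>X\<close>, so one tuple of the pair has to
    lie in \<open>X\<close>: the automorphism \<open>g\<close> fixing \<open>a\<close> moves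
    \<open>S\<close> to a tuple of the same type over \<open>X\<close>, and \<open>e\<close> comes
    from \<open>X\<close>. Arbitrary pairs are compared through a common copy in
    \<open>X\<close>.\<close>
  have key: "gt ?G ((a @ S) @ d) ((a @ S) @ e)"
    if d: "set d \<subseteq> X \<union> C" "set e \<subseteq> X" "gt ?G d e" for d e
  proof -
    have "gt ?G (a @ d) (a @ e)" using not_splitsD[OF nG G(1) d(1) _ d(3)] d(2) by blast
    then obtain g where g: "g \<in> Aut M ?G" "map g a = a" "map g d = e" using gt_app by blast
    let ?T = "map g S"
    have TC: "set ?T \<subseteq> CC" using map_carr[OF g(1) aC(2)] .
    have "gt E (a @ S) (a @ ?T)" by (rule gt_mono[OF gtI[OF g(1)]]) (use g(2) in auto)
    then have "gt E (a @ ?T) (a @ S)" by (rule gt_sym) (use aC in auto)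
    then have "wt X (a @ ?T) (a @ S)" using iso aC(1) TC wt_refl[of X a] by auto
    then have "gt ?G ((a @ ?T) @ e) ((a @ S) @ e)" by (rule wtD_gt[OF _ G d(2)])
    moreover have "gt ?G ((a @ S) @ d) ((a @ ?T) @ e)" by (rule gtI[OF g(1)]) (use g in auto)
    ultimately show ?thesis using gt_trans by blast
  qed
  have "\<not> splits M (a @ S) (X \<union> C) ?G"
  proof (rule not_splitsI[OF G(1)])
    fix x y assume x: "set x \<subseteq> X \<union> C" "set y \<subseteq> X \<union> C" "gt ?G x y"
    obtain d where d: "set d \<subseteq> X" "gt ?G d x"
      by (rule saturated[OF X G, of x]) (use x XC in auto)
    have dC: "set d \<subseteq> CC" "set y \<subseteq> CC" using d(1) x(2) XC by auto
    have xd: "gt ?G x d" using gt_sym[OF d(2) dC(1)] .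
    have yd: "gt ?G y d" using gt_sym[OF gt_trans[OF d(2) x(3)] dC(1)] .
    have "gt ?G ((a @ S) @ y) ((a @ S) @ d)" using key[OF x(2) d(1) yd] .
    then have "gt ?G ((a @ S) @ d) ((a @ S) @ y)" by (rule gt_sym) (use aC dC in auto)
    then show "gt ?G ((a @ S) @ x) ((a @ S) @ y)" using key[OF x(1) d(1) xd] gt_trans by blast
  qed
  then have "I (a @ S) X C" using G unfolding I_iff by blast
  then show ?thesis by (rule I_subset) (use E in auto)
qed

text \<open>Over an uncountable model the isomorphism is found by extending, along an s-prime model, the
  map that is the identity on the model and an isomorphism of s-primary models elsewhere.\<close>

lemma model_gt:
  assumes X: "model X" and t: "wt X a b" and a: "set a \<subseteq> CC"
  shows "\<exists>f\<in>Aut M X. map f a = b"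
proof -
  have b: "set b \<subseteq> CC" using wt_carr[OF t a] .
  note XC = model_carr[OF X]
  obtain E where E: "finite E" "E \<subseteq> X" "\<not> splits M a X E" using model_local[OF X a] by blast
  obtain F where F: "finite F" "F \<subseteq> X" "\<not> splits M b X F" using model_local[OF X b] by blast
  obtain Z where Z: "model Z" "E \<union> F \<subseteq> Z" "Z \<subseteq> X" "countable Z"
    by (rule ex_cmodel_in[of "E \<union> F" X]) (use E F X in \<open>auto intro: countable_finite\<close>)
  have ZX: "Z \<union> X = X" using Z(3) by blast
  have Ia: "I a Z X" "I b Z X" unfolding I_iff ZX using E F Z(2) by blast+
  obtain Y where Y: "s_primary M Z a Y" using ex_s_primary[OF Z(1,4) a] by blast
  obtain Y' where Y': "s_primary M Z b Y'" using ex_s_primary[OF Z(1,4) b] by blast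
  note D = s_primaryD[OF Y] and D' = s_primaryD[OF Y']
  obtain f where f: "f \<in> Aut M Z" "map f a = b" "f ` Y = Y'"
    using s_primary_unique[OF Z(4) Y Y'] wt_mono[OF t Z(3)] by blast
  have dom: "I c Z X" if "set c \<subseteq> Y" for c using s_primary_dominated[OF Z(1) Y Ia(1) XC that] .
  have dom': "I c Z X" if "set c \<subseteq> Y'" for c using s_primary_dominated[OF Z(1) Y' Ia(2) XC that] .
  \<comment> \<open>An element of \<open>Y\<close> and \<open>X\<close> is independent from itself
    over \<open>Z\<close>, hence lies in \<open>Z\<close>.\<close>
  have inter: "Z = Y \<inter> X"
  proof
    show "Z \<subseteq> Y \<inter> X" using D(2) Z(3) by blast
    show "Y \<inter> X \<subseteq> Z"
    proof
      fix x assume x: "x \<in> Y \<inter> X"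
      have "I [x] Z X" using dom x by simp
      then have "I [x] Z (set [x])" by (rule I_mono) (use x Z(3) in auto)
      then have "set [x] \<subseteq> Z" by (rule I_self[OF Z(1), rotated]) (use x XC in auto)
      then show "x \<in> Z" by simp
    qed
  qed
  have "AIII M" using fur unfolding FUR_class_def by (elim conjE)
  note A3 = this[unfolded AIII_def, THEN spec[of _ Y], THEN spec[of _ Z], THEN spec[of _ X], THEN mp]
  have "ns_indep_set M Y Z X" using dom unfolding ns_indep_set_def by blast
  then have "\<exists>!P. s_prime M {Y, X} P"
    by (intro conjunct1[OF A3]) (use D(1) Z(1) X inter in simp)
  then obtain P where P: "s_prime M {Y, X} P" by (elim ex1E)
  define h where "h = (\<lambda>x. if x \<in> X then x else f x)"
  have hY: "h x = f x" if "x \<in> Y" for x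
    using that inter Aut_fix[OF f(1), of x] by (auto simp: h_def)
  have hX: "h x = x" if "x \<in> X" for x using that by (simp add: h_def)
  have we: "weakly_elementary M {Y, X} h"
    unfolding weakly_elementary_def
  proof (intro conjI allI impI ballI)
    fix c assume c: "set c \<subseteq> \<Union>{Y, X}"
    \<comment> \<open>The entries in \<open>X\<close> serve as parameters. By uniqueness over
      \<open>Z\<close>, applying \<open>f\<close> to the entries in \<open>Y\<close> does not change
      their type over \<open>X\<close>.\<close>
    let ?y = "filter (\<lambda>x. x \<in> Y) c"
    let ?B = "set c \<inter> X"
    have y: "set ?y \<subseteq> Y" by auto
    have fy: "set (map f ?y) \<subseteq> Y'" using f(3) y by auto
    have "wt Z ?y (map f ?y)" using gtI[OF f(1)] wt_gt by blast
    then have "wt (Z \<union> X) ?y (map f ?y)"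
      using I_unique[OF Z(1) XC dom[OF y] _ dom'[OF fy]] y model_carr[OF D(1)] by blast
    then have "gt ?B ?y (map f ?y)" by (rule wtD) auto
    then obtain g where g: "g \<in> Aut M ?B" "map g ?y = map f ?y" by (rule gtE)
    have "g x = h x" if x: "x \<in> set c" for x
    proof (cases "x \<in> X")
      case True
      then show ?thesis using Aut_fix[OF g(1), of x] x hX by auto
    next
      case False
      then have "x \<in> set ?y" using x c by auto
      then have "g x = f x" using g(2) by (meson map_eq_conv)
      then show ?thesis using False by (simp add: h_def)
    qed
    then have "map g c = map h c" by auto
    then have "gt {} c (map h c)" using gtI[OF Aut_empty[OF g(1)]] by blast
    then show "wt {} c (map h c)" by (rule wt_gt)
  next
    fix W assume "W \<in> {Y, X}"
    moreover have "h ` Y = Y'" using hY f(3) by auto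
    moreover have "h ` X = X" using hX by auto
    ultimately show "model (h ` W)" using D'(1) X by auto
  qed
  obtain N where N: "model N" "Y' \<union> X \<subseteq> N"
    by (rule ex_model[of "Y' \<union> X"]) (use model_carr[OF D'(1)] XC bd_Un[OF model_bd[OF D'(1)] model_bd[OF X]] in auto)
  have "model N \<and> h ` \<Union>{Y, X} \<subseteq> N \<and> weakly_elementary M {Y, X} h"
    using hY hX f(3) N we by auto
  moreover have "\<forall>Z f. model Z \<and> f ` \<Union>{Y, X} \<subseteq> Z \<and> weakly_elementary M {Y, X} f \<longrightarrow>
        (\<exists>g. strong_emb M (Sub P) (Sub Z) g \<and> (\<forall>x\<in>\<Union>{Y, X}. g x = f x))"
    using P unfolding s_prime_def by (elim conjE)
  ultimately obtain g where g: "strong_emb M (Sub P) (Sub N) g" "\<forall>x\<in>\<Union>{Y, X}. g x = h x"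
    by metis
  have PP: "model P" "\<Union>{Y, X} \<subseteq> P" using P unfolding s_prime_def by blast+
  \<comment> \<open>The embedding of the s-prime model is an isomorphism onto a model, so
    homogeneity extends it to an automorphism of the monster.\<close>
  obtain N0 where N0: "strong M N0 (Sub N)" "struct_iso (voc M) (Sub P) N0 g"
    using g(1) unfolding strong_emb_def by blast
  have s: "strong M N0 (monster M)" using strong_trans[OF N0(1) model_strong[OF N(1)]] .
  have "univ N0 \<subseteq> N" using strongD(6)[OF N0(1)] by simp
  then have "bounded_set M (univ N0)" using bd_subset model_bd[OF N(1)] by blast
  note m = strong_monster_model[OF s this]
  have "struct_iso (voc M) (Sub P) (Sub (univ N0)) g" using N0(2) m(2) by metis
  moreover have "model_homogeneous M" using monster unfolding monster_model_def by blast
  ultimately obtain q where q: "struct_iso (voc M) (monster M) (monster M) q" "\<forall>x\<in>P. q x = g x"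
    using PP(1) m(1) unfolding model_homogeneous_def by blast
  have qh: "q x = h x" if "x \<in> Y \<union> X" for x using q(2) PP(2) g(2) that by auto
  have "q \<in> Aut M X" using q(1) qh hX unfolding Aut_def by simp
  moreover have "map q a = b"
  proof -
    have "map q a = map f a" using qh hY D(3) by auto
    then show ?thesis using f(2) by simp
  qed
  ultimately show ?thesis by blast
qed

subsection \<open>U-rank over models\<close>

lemma sym_set:
  assumes X: "model X" "C \<subseteq> CC" "B \<subseteq> CC" and I: "\<And>w. set w \<subseteq> C \<Longrightarrow> I w X B" and y: "set y \<subseteq> B"
  shows "I y X C"
proof (rule I_finite_char[OF X(1,2)])
  show yC: "set y \<subseteq> CC" using y X(3) by blast
  fix w assume w: "set w \<subseteq> C"
  have "I w X (set y)" by (rule I_mono[OF I[OF w]]) (use y in auto)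
  then show "I y X (set w)" using I_sym[OF X(1) yC] w X(2) by blast
qed

lemma Aut_image_inv:
  assumes f: "f \<in> Aut M {}"
  shows "\<exists>k\<in>Aut M {}. (\<forall>S. S \<subseteq> CC \<longrightarrow> k ` f ` S = S) \<and> (\<forall>x. set x \<subseteq> CC \<longrightarrow> map k (map f x) = x)
    \<and> (\<forall>S. S \<subseteq> CC \<longrightarrow> f ` k ` S = S)"
proof -
  obtain k where k: "k \<in> Aut M {}" "\<forall>x\<in>CC. k (f x) = x" "\<forall>x\<in>CC. f (k x) = x"
    using Aut_inv[OF f] by blast
  have "k ` f ` S = S" "f ` k ` S = S" if "S \<subseteq> CC" for S using k(2,3) that by force+
  moreover have "map k (map f x) = x" if "set x \<subseteq> CC" for x
    using k(2) that by (simp add: subset_iff map_idI)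
  ultimately show ?thesis using k(1) by blast
qed

lemma I_image_iff:
  assumes f: "f \<in> Aut M {}" and B: "X \<subseteq> CC" "B \<subseteq> CC" and a: "set a \<subseteq> CC"
  shows "I (map f a) (f ` X) (f ` B) \<longleftrightarrow> I a X B"
proof
  assume L: "I (map f a) (f ` X) (f ` B)"
  obtain k where k: "k \<in> Aut M {}" "\<forall>S. S \<subseteq> CC \<longrightarrow> k ` f ` S = S"
    "\<forall>x. set x \<subseteq> CC \<longrightarrow> map k (map f x) = x" using Aut_image_inv[OF f] by metis
  have "I (map k (map f a)) (k ` f ` X) (k ` f ` B)"
    by (rule I_image[OF k(1) L]) (use image_carr[OF f] B map_carr[OF f a] in auto)
  then show "I a X B" using k a B by metis
qed (use I_image[OF f _ B a] in blast)

lemma Aut_image_fix: "f \<in> Aut M X \<Longrightarrow> f ` X = X"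
  using Aut_fix by force

lemma U_ge_Suc: "U_ge M a (Suc n) X \<Longrightarrow> U_ge M a n X"
proof (induction n arbitrary: X)
  case (Suc n)
  then obtain Y where "model Y" "X \<subseteq> Y" "\<not> I a X Y" "U_ge M a (Suc n) Y"
    using U_ge.simps(2)[of M a "Suc n" X] by blast
  then show ?case using Suc.IH[of Y] U_ge.simps(2)[of M a n X] by blast
qed simp

lemma U_ge_le: "m \<le> n \<Longrightarrow> U_ge M a n X \<Longrightarrow> U_ge M a m X"
  by (induction n rule: dec_induct) (use U_ge_Suc in blast)+

lemma U_ge_mono: "X \<subseteq> Y \<Longrightarrow> U_ge M a n Y \<Longrightarrow> U_ge M a n X"
proof (cases n)
  case (Suc k)
  assume X: "X \<subseteq> Y" and U: "U_ge M a n Y"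
  obtain Z where Z: "model Z" "Y \<subseteq> Z" "\<not> I a Y Z" "U_ge M a k Z" using U Suc by auto
  have "\<not> I a X Z" using I_mono[of a X Z Y Z] X Z(2,3) by blast
  then show ?thesis using Z X Suc by auto
qed simp

lemma U_ge_subset: "set a' \<subseteq> set a \<union> X \<Longrightarrow> U_ge M a' n X \<Longrightarrow> U_ge M a n X"
proof (induction n arbitrary: X)
  case (Suc n)
  then obtain Y where Y: "model Y" "X \<subseteq> Y" "\<not> I a' X Y" "U_ge M a' n Y" by auto
  have "\<not> I a X Y" using I_subset[OF _ Suc.prems(1)] Y(3) by blast
  moreover have "U_ge M a n Y" by (rule Suc.IH[OF _ Y(4)]) (use Suc.prems(1) Y(2) in blast)
  ultimately show ?case using Y by auto
qed simp

lemma U_ge_image: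
  "f \<in> Aut M {} \<Longrightarrow> X \<subseteq> CC \<Longrightarrow> set a \<subseteq> CC \<Longrightarrow> U_ge M a n X \<Longrightarrow> U_ge M (map f a) n (f ` X)"
proof (induction n arbitrary: X)
  case (Suc n)
  then obtain Y where Y: "model Y" "X \<subseteq> Y" "\<not> I a X Y" "U_ge M a n Y" by auto
  note YC = model_carr[OF Y(1)]
  have "\<not> I (map f a) (f ` X) (f ` Y)" using I_image_iff[OF Suc.prems(1,2) YC Suc.prems(3)] Y(3) by blast
  moreover have "U_ge M (map f a) n (f ` Y)" using Suc.IH[OF Suc.prems(1) YC Suc.prems(3) Y(4)] .
  moreover have "model (f ` Y)" using model_image[OF Suc.prems(1) Y(1)] .
  moreover have "f ` X \<subseteq> f ` Y" using Y(2) by blast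
  ultimately show ?case unfolding U_ge.simps by blast
qed simp

lemma U_ge_cong:
  assumes X: "model X" and t: "wt X a b" and a: "set a \<subseteq> CC" and U: "U_ge M a n X"
  shows "U_ge M b n X"
proof -
  obtain f where f: "f \<in> Aut M X" "map f a = b" using model_gt[OF X t a] by blast
  show ?thesis using U_ge_image[OF Aut_empty[OF f(1)] model_carr[OF X] a U]
    Aut_image_fix[OF f(1)] f(2) by simp
qed

text \<open>The witness \<open>Z\<close> for rank \<open>n + 1\<close> over \<open>X\<close> is
  moved together with \<open>a\<close> to a position free from \<open>Y\<close> over
  \<open>X\<close>, which keeps the type of \<open>a\<close> over \<open>Y\<close>. Extending the
  type over the new \<open>Z'\<close> freely to a model \<open>V\<close> around \<open>Y\<close> and
  \<open>Z'\<close> makes \<open>V\<close> a witness for rank \<open>n + 1\<close> over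
  \<open>Y\<close>.\<close>

lemma U_ge_free:
  "model X \<Longrightarrow> model Y \<Longrightarrow> X \<subseteq> Y \<Longrightarrow> set a \<subseteq> CC \<Longrightarrow> I a X Y \<Longrightarrow> U_ge M a n X \<Longrightarrow> U_ge M a n Y"
proof (induction n arbitrary: X Y a)
  case (Suc n)
  note X = Suc.prems(1) and Y = Suc.prems(2,3) and a = Suc.prems(4) and I = Suc.prems(5)
  note XC = model_carr[OF X] and YC = model_carr[OF Y(1)]
  have XY: "X \<union> Y = Y" using Y(2) by blast
  obtain Z where Z: "model Z" "X \<subseteq> Z" "\<not> I a X Z" "U_ge M a n Z" using Suc.prems(6) by auto
  obtain W where W: "model W" "Z \<union> set a \<subseteq> W"
    by (rule ex_model[of "Z \<union> set a"])
      (use model_carr[OF Z(1)] a bd_Un[OF model_bd[OF Z(1)] bd_finite] in auto)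
  obtain f where f: "f \<in> Aut M X" "\<forall>c. set c \<subseteq> f ` W \<longrightarrow> I c X Y"
    using free_copy[OF X W(1) _ Y] W(2) Z(2) by blast
  note fe = Aut_empty[OF f(1)] and fX = Aut_image_fix[OF f(1)]
  define a' Z' where "a' = map f a" and "Z' = f ` Z"
  have a': "set a' \<subseteq> CC" unfolding a'_def by (rule map_carr[OF f(1) a])
  have Z': "model Z'" unfolding Z'_def by (rule model_image[OF f(1) Z(1)])
  note ZC' = model_carr[OF Z']
  have a'W: "set a' \<subseteq> f ` W" and Z'W: "Z' \<subseteq> f ` W" using W(2) by (auto simp: a'_def Z'_def)
  have XZ': "X \<subseteq> Z'" using Z(2) fX unfolding Z'_def by blast
  have tX: "wt X a a'" using gtI[OF f(1)] wt_gt unfolding a'_def by blast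
  have Ia': "I a' X Y" using f(2) a'W by blast
  have tY: "wt Y a a'" using I_unique[OF X YC I a Ia' tX] XY by simp
  have nI: "\<not> I a' X Z'"
    using I_image_iff[OF fe XC model_carr[OF Z(1)] a] Z(3) fX unfolding a'_def Z'_def by simp
  have U': "U_ge M a' n Z'"
    unfolding a'_def Z'_def by (rule U_ge_image[OF fe model_carr[OF Z(1)] a Z(4)])
  obtain V where V: "model V" "Y \<union> Z' \<subseteq> V"
    by (rule ex_model[of "Y \<union> Z'"])
      (use YC ZC' bd_Un[OF model_bd[OF Y(1)] model_bd[OF Z']] in auto)
  obtain a'' where a'': "wt Z' a'' a'" "I a'' Z' V" "set a'' \<subseteq> CC"
    using I_ext[OF Z' model_carr[OF V(1)] model_bd[OF V(1)] a'] by blast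
  have fWC: "f ` W \<subseteq> CC" using image_carr[OF f(1)] model_carr[OF W(1)] by blast
  \<comment> \<open>\<open>Y\<close> is free over \<open>X\<close> from the whole copied model,
    hence also over \<open>Z'\<close>; symmetry over \<open>Z'\<close> returns the independence of
    \<open>a'\<close>.\<close>
  have IZY: "I a' Z' Y"
  proof (rule sym_set[OF Z' YC])
    show "set a' \<subseteq> f ` W" by (rule a'W)
    fix y assume y: "set y \<subseteq> Y"
    have "I y X (f ` W)" by (rule sym_set[OF X fWC YC _ y]) (use f(2) in blast)
    then show "I y Z' (f ` W)" by (rule I_mono) (use XZ' Z'W in auto)
  qed (rule fWC)
  have "I a'' Z' Y" by (rule I_mono[OF a''(2)]) (use V(2) in auto)
  then have "wt (Z' \<union> Y) a' a''"
    using I_unique[OF Z' YC IZY a' _ wt_sym[OF a''(1,3)]] by blast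
  then have tY'': "wt Y a' a''" using wt_mono by blast
  have "U_ge M a'' n Z'" using U_ge_cong[OF Z' wt_sym[OF a''(1,3)] a' U'] .
  then have UV: "U_ge M a'' n V"
    using Suc.IH[OF Z' V(1) _ a''(3,2)] V(2) by blast
  \<comment> \<open>Otherwise transitivity through \<open>Y\<close> would make \<open>a''\<close>,
    and with it \<open>a'\<close>, free from \<open>Z'\<close> over \<open>X\<close>.\<close>
  have "\<not> I a'' Y V"
  proof
    assume "I a'' Y V"
    moreover have "I a'' X Y" by (rule I_cong[OF Ia']) (use tY'' XY YC a' in auto)
    ultimately have "I a'' X V" using I_trans[OF Y model_carr[OF V(1)] a''(3)] by blast
    then have "I a'' X Z'" by (rule I_mono) (use V(2) in auto)
    moreover have "X \<union> Z' = Z'" using XZ' by blast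
    ultimately have "I a' X Z'" using I_cong[of a'' X Z' a'] a''(1,3) ZC' by simp
    then show False using nI by blast
  qed
  then have "U_ge M a'' (Suc n) Y" using V UV by auto
  moreover have "wt Y a'' a" by (rule wt_sym[OF wt_trans[OF tY tY''] a])
  ultimately show ?case using U_ge_cong[OF Y(1) _ a''(3)] by blast
qed simp

text \<open>The witnesses are countable because the games of AIV are played in countable
  models.\<close>

primrec U_c :: "'a list \<Rightarrow> nat \<Rightarrow> 'a set \<Rightarrow> bool" where
  "U_c a 0 X \<longleftrightarrow> True"
| "U_c a (Suc n) X \<longleftrightarrow> (\<exists>Y. model Y \<and> countable Y \<and> X \<subseteq> Y \<and> \<not> I a X Y \<and> U_c a n Y)"

text \<open>Splitting over each of the countably many finite subsets of \<open>X0\<close> needs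
  finitely many parameters, so a countable part of \<open>Y\<close> is enough.\<close>

lemma U_ge_U_c:
  "U_ge M a n X \<Longrightarrow> countable X0 \<Longrightarrow> X0 \<subseteq> X \<Longrightarrow> U_c a n X0"
proof (induction n arbitrary: X X0)
  case (Suc n)
  then obtain Y where Y: "model Y" "X \<subseteq> Y" "\<not> I a X Y" "U_ge M a n Y" by auto
  have XY: "X \<union> Y = Y" using Y(2) by blast
  have "\<exists>w. finite w \<and> w \<subseteq> Y \<and> splits M a w F" if F: "finite F \<and> F \<subseteq> X0" for F
  proof -
    have "splits M a Y F" using Y(3) F Suc.prems(3) unfolding I_iff XY by blast
    then obtain b c where b: "set b \<subseteq> Y" "set c \<subseteq> Y" "wt F b c" "\<not> wt F (a @ b) (a @ c)"
      unfolding splits_def by blast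
    then have "splits M a (set b \<union> set c) F" unfolding splits_def by blast
    then show ?thesis using b(1,2) by (intro exI[of _ "set b \<union> set c"]) simp
  qed
  then obtain w where w: "\<And>F. finite F \<and> F \<subseteq> X0 \<Longrightarrow> finite (w F) \<and> w F \<subseteq> Y \<and> splits M a (w F) F"
    by metis
  let ?S = "X0 \<union> (\<Union>F\<in>{F. finite F \<and> F \<subseteq> X0}. w F)"
  have "countable ?S"
    using Suc.prems(2) w by (intro countable_Un countable_UN countable_Collect_finite_subset)
      (auto intro: countable_finite)
  moreover have "?S \<subseteq> Y" using w Suc.prems(3) Y(2) by blast
  ultimately obtain Y0 where Y0: "model Y0" "?S \<subseteq> Y0" "Y0 \<subseteq> Y" "countable Y0"
    using ex_cmodel_in[of ?S Y] Y(1) by blast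
  have "\<not> I a X0 Y0"
  proof
    assume "I a X0 Y0"
    then obtain F where F: "finite F" "F \<subseteq> X0" "\<not> splits M a (X0 \<union> Y0) F" unfolding I_iff by blast
    then have "splits M a (w F) F" "w F \<subseteq> X0 \<union> Y0" using w Y0(2) by blast+
    then show False using splits_mono F(3) by blast
  qed
  moreover have "U_c a n Y0" using Suc.IH[OF Y(4) Y0(4,3)] .
  moreover have "X0 \<subseteq> Y0" using Y0(2) by blast
  ultimately show ?case using Y0(1,4) unfolding U_c.simps by blast
qed simp

text \<open>In the position \<open>(c, A)\<close> of the game in \<open>Z\<close>, where \<open>c\<close> is free from \<open>Z\<close> over a model \<open>X\<close>
  containing \<open>A\<close>, the types of rank at least \<open>k\<close> provide \<open>k\<close> further moves.\<close>

primrec U_game :: "nat \<Rightarrow> 'a list \<Rightarrow> 'a set \<Rightarrow> 'a set \<Rightarrow> bool" where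
  "U_game 0 c X Z \<longleftrightarrow> True"
| "U_game (Suc k) c X Z \<longleftrightarrow> (\<exists>Y d. model Y \<and> X \<subseteq> Y \<and> Y \<subseteq> Z \<and> wt X d c \<and> set d \<subseteq> CC \<and>
     \<not> I d X Y \<and> I d Y Z \<and> U_game k d Y Z)"

lemma U_game_cong: "wt X c d \<Longrightarrow> U_game k c X Z \<Longrightarrow> U_game k d X Z"
  by (cases k) (auto dest: wt_trans, meson wt_trans)

lemma U_game_image:
  "f \<in> Aut M {} \<Longrightarrow> X \<subseteq> CC \<Longrightarrow> Z \<subseteq> CC \<Longrightarrow> U_game k c X Z \<Longrightarrow> U_game k (map f c) (f ` X) (f ` Z)"
proof (induction k arbitrary: c X)
  case (Suc k)
  note f = Suc.prems(1) and XC = Suc.prems(2) and ZC = Suc.prems(3)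
  obtain Y d where Y: "model Y" "X \<subseteq> Y" "Y \<subseteq> Z" "wt X d c" "set d \<subseteq> CC" "\<not> I d X Y" "I d Y Z"
    "U_game k d Y Z" using Suc.prems(4) by auto
  note YC = model_carr[OF Y(1)]
  have "model (f ` Y)" using model_image[OF f Y(1)] .
  moreover have "f ` X \<subseteq> f ` Y" "f ` Y \<subseteq> f ` Z" using Y(2,3) by auto
  moreover have "wt (f ` X) (map f d) (map f c)" using wt_image[OF f Y(4) XC Y(5)] .
  moreover have "set (map f d) \<subseteq> CC" using map_carr[OF f Y(5)] .
  moreover have "\<not> I (map f d) (f ` X) (f ` Y)" using I_image_iff[OF f XC YC Y(5)] Y(6) by blast
  moreover have "I (map f d) (f ` Y) (f ` Z)" using I_image_iff[OF f YC ZC Y(5)] Y(7) by blast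
  moreover have "U_game k (map f d) (f ` Y) (f ` Z)" using Suc.IH[OF f YC ZC Y(8)] .
  ultimately show ?case unfolding U_game.simps by blast
qed simp

text \<open>The arena \<open>Z\<close> is found at the end of the chain. Going back, each stage
  takes a free extension \<open>b\<close> to \<open>Z\<close>: over \<open>X\<close> it has the type
  of the next element \<open>d\<close>, but \<open>d\<close> depends on \<open>Y\<close>, so the two
  differ over \<open>Z\<close>.\<close>

lemma U_c_game:
  "model X \<Longrightarrow> countable X \<Longrightarrow> set a \<subseteq> CC \<Longrightarrow> U_c a k X \<Longrightarrow>
   \<exists>Z b. model Z \<and> countable Z \<and> X \<subseteq> Z \<and> wt X b a \<and> set b \<subseteq> CC \<and> I b X Z \<and> U_game k b X Z"
proof (induction k arbitrary: X)
  case 0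
  then show ?case using I_local wt_refl by (intro exI[of _ X] exI[of _ a]) simp
next
  case (Suc k)
  obtain Y where Y: "model Y" "countable Y" "X \<subseteq> Y" "\<not> I a X Y" "U_c a k Y" using Suc.prems(4) by auto
  obtain Z d where Z: "model Z" "countable Z" "Y \<subseteq> Z" "wt Y d a" "set d \<subseteq> CC" "I d Y Z" "U_game k d Y Z"
    using Suc.IH[OF Y(1,2) Suc.prems(3) Y(5)] by blast
  note ZC = model_carr[OF Z(1)]
  obtain b where b: "wt X b a" "I b X Z" "set b \<subseteq> CC"
    using I_ext[OF Suc.prems(1) ZC model_bd[OF Z(1)] Suc.prems(3)] by blast
  have XY: "X \<union> Y = Y" using Y(3) by blast
  have "\<not> I d X Y" using I_cong[of d X Y a] Z(4,5) Y(4) model_carr[OF Y(1)] unfolding XY by blast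
  moreover have "wt X d b"
    using wt_trans[OF wt_mono[OF Z(4) Y(3)] wt_sym[OF b(1,3)]] .
  ultimately have "U_game (Suc k) b X Z" using Y(1,3) Z by auto
  moreover have "X \<subseteq> Z" using Y(3) Z(3) by blast
  ultimately show ?case using Z(1,2) b by blast
qed

text \<open>A tuple \<open>d\<close> of \<open>Z\<close> and its preimage under \<open>f\<close>
  have the same type over \<open>E\<close>, so non-splitting makes them look alike from
  \<open>a\<close>.\<close>

lemma not_splits_wt_image:
  assumes s: "\<not> splits M a Z E" "finite E" and f: "f \<in> Aut M E" "f ` Z = Z" and Z: "Z \<subseteq> CC" "set a \<subseteq> CC"
  shows "wt Z a (map f a)"
proof (rule wtI_gt)
  fix d assume d: "set d \<subseteq> Z"
  have "\<forall>x\<in>set d. \<exists>y. y \<in> Z \<and> f y = x" using d f(2) by (metis imageE subsetD)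
  then obtain u where u: "\<forall>x\<in>set d. u x \<in> Z \<and> f (u x) = x" by metis
  define d0 where "d0 = map u d"
  have d0: "set d0 \<subseteq> Z" "map f d0 = d" using u unfolding d0_def by (auto intro: map_idI)
  have "gt E d d0" by (rule gt_sym[OF gtI[OF f(1) d0(2)]]) (use d0 Z in auto)
  then have "gt E (a @ d) (a @ d0)" using not_splitsD[OF s d d0(1)] by blast
  moreover have "gt E (a @ d0) (map f a @ d)" by (rule gtI[OF f(1)]) (use d0 in auto)
  ultimately have "gt E (a @ d) (map f a @ d)" using gt_trans by blast
  then show "gt {} (a @ d) (map f a @ d)" using gt_mono by blast
qed

text \<open>\<open>n\<close> is the number of moves from AIV, which depends on \<open>a\<close>
  alone; a rank of at least \<open>k\<close> lets player I survive \<open>k\<close> moves.\<close>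

lemma U_bound:
  assumes a: "set a \<subseteq> CC"
  shows "\<exists>n. \<forall>X k. model X \<and> U_ge M a k X \<longrightarrow> k \<le> n"
proof -
  obtain n where n: "\<forall>X A. model X \<and> countable X \<and> finite A \<and> A \<subseteq> X \<longrightarrow> (\<exists>\<sigma>. GI_winning M a A X n \<sigma>)"
    using AIV_obtain[OF a] by blast
  have "k \<le> n" if X: "model X" "U_ge M a k X" for X k
  proof -
    obtain X0 where X0: "model X0" "{} \<subseteq> X0" "X0 \<subseteq> X" "countable X0"
      by (rule ex_cmodel_in[of "{}" X]) (use X in auto)
    obtain Z0 b where Z0: "model Z0" "countable Z0" "X0 \<subseteq> Z0" "wt X0 b a" "set b \<subseteq> CC" "I b X0 Z0"
      "U_game k b X0 Z0"
      using U_c_game[OF X0(1,4) a U_ge_U_c[OF X(2) X0(4,3)]] by blast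
    \<comment> \<open>AIV bounds games that start at \<open>a\<close> itself, so the arena is
      transported to have \<open>a\<close> as its first element.\<close>
    obtain f where f: "f \<in> Aut M X0" "map f b = a" using model_gt[OF X0(1) Z0(4,5)] by blast
    note fe = Aut_empty[OF f(1)] and fX = Aut_image_fix[OF f(1)]
    define Z where "Z = f ` Z0"
    have "f ` X0 \<subseteq> f ` Z0" using Z0(3) by (rule image_mono)
    then have Z: "model Z" "countable Z" "X0 \<subseteq> Z"
      using model_image[OF f(1) Z0(1)] Z0(2) fX unfolding Z_def by auto
    note ZC = model_carr[OF Z(1)]
    have aZ: "I a X0 Z" using I_image[OF fe Z0(6) model_carr[OF X0(1)] model_carr[OF Z0(1)] Z0(5)]
      f(2) fX unfolding Z_def by simp
    have gZ: "U_game k a X0 Z" using U_game_image[OF fe model_carr[OF X0(1)] model_carr[OF Z0(1)] Z0(7)]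
      f(2) fX unfolding Z_def by simp
    obtain \<sigma> where W: "GI_winning M a {} Z n \<sigma>" using n Z by blast
    let ?P = "\<lambda>k c A. \<exists>X. model X \<and> A \<subseteq> X \<and> X \<subseteq> Z \<and> set c \<subseteq> CC \<and> I c X Z \<and> U_game k c X Z"
    show "k \<le> n"
    proof (rule GI_survive[where P = ?P, OF _ W])
      show "?P k a {}" using X0(1) Z(3) a aZ gZ by blast
      fix j c A assume P: "?P (Suc j) c A" and A: "finite A" "A \<subseteq> Z"
      then obtain X1 where X1: "model X1" "A \<subseteq> X1" "X1 \<subseteq> Z" "set c \<subseteq> CC" "I c X1 Z" "U_game (Suc j) c X1 Z"
        by blast
      obtain Y d where Y: "model Y" "X1 \<subseteq> Y" "Y \<subseteq> Z" "wt X1 d c" "set d \<subseteq> CC" "\<not> I d X1 Y" "I d Y Z"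
        "U_game j d Y Z" using X1(6) by auto
      have XZ: "X1 \<union> Z = Z" and YZ: "Y \<union> Z = Z" using X1(3) Y(3) by auto
      have "\<not> wt Z c d"
      proof
        assume "wt Z c d"
        then have "I d X1 Z" using I_cong[of c X1 Z d] X1(4,5) ZC XZ by simp
        then have "I d X1 Y" by (rule I_mono) (use Y(2,3) in auto)
        then show False using Y(6) by blast
      qed
      then obtain F where F: "finite F" "F \<subseteq> Z" "\<not> gt F c d" using wtI[of Z c d] by blast
      have "\<not> gt F d c" using gt_sym[of F d c] F(3) Y(5) by blast
      then have nAF: "\<not> gt (A \<union> F) d c" using gt_mono[of "A \<union> F" d c F] by blast
      have "gt A d c" using wtD[OF Y(4) A(1) X1(2)] .
      then have "GI_legal M Z (c, A) (d, A \<union> F)"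
        unfolding GI_legal_def using Y(5) A F nAF by (simp add: wt_fin)
      \<comment> \<open>Player II may answer with a set outside \<open>Y\<close>. It has a copy in
        \<open>Y\<close> over the base \<open>E\<close> of \<open>d\<close>; an automorphism over
        \<open>E\<close> preserving \<open>Z\<close> moves \<open>Y\<close> to a model containing
        the answer, and by non-splitting it keeps the type of \<open>d\<close> over
        \<open>Z\<close>.\<close>
      moreover have "?P j d A''" if A'': "finite A'' \<and> A \<union> F \<subseteq> A'' \<and> A'' \<subseteq> Z" for A''
      proof -
        obtain E where E: "finite E" "E \<subseteq> Y" "\<not> splits M d Z E" using Y(7) unfolding I_iff YZ by blast
        have EZ: "E \<subseteq> Z" using E(2) Y(3) by blast
        obtain l where l: "set l = A''" using finite_list[of A''] A'' by blast
        obtain l' where l': "set l' \<subseteq> Y" "gt E l' l"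
          by (rule saturated[OF Y(1) E(1,2), of l]) (use l A'' ZC in auto)
        have l'Z: "set l' \<subseteq> Z" using l'(1) Y(3) by blast
        have lZ: "set l \<subseteq> Z" using l A'' by blast
        obtain q where q: "q \<in> Aut M E" "q ` Z = Z" "map q l' = l"
          using cmodel_auto[OF Z(1,2) E(1) EZ l'Z lZ l'(2)] .
        note qe = Aut_empty[OF q(1)]
        have t: "wt Z d (map q d)" using not_splits_wt_image[OF E(3,1) q(1,2) ZC Y(5)] .
        have qd: "set (map q d) \<subseteq> CC" using map_carr[OF q(1) Y(5)] .
        have t': "wt Z (map q d) d" using wt_sym[OF t Y(5)] .
        have qY: "q ` Y \<subseteq> Z" using Y(3) q(2) by blast
        have "model (q ` Y)" using model_image[OF q(1) Y(1)] .
        moreover have "set (map q l') \<subseteq> q ` Y" using l'(1) by (simp add: image_mono)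
        then have "A'' \<subseteq> q ` Y" using q(3) l by simp
        moreover have "I d (q ` Y) Z"
        proof -
          have 1: "I (map q d) (q ` Y) Z"
            using I_image[OF qe Y(7) model_carr[OF Y(1)] ZC Y(5)] q(2) by simp
          have "q ` Y \<union> Z = Z" using qY by blast
          then show ?thesis using I_cong[OF 1, of d] t' qd ZC by simp
        qed
        moreover have "U_game j d (q ` Y) Z"
        proof (rule U_game_cong[OF wt_mono[OF t' qY]])
          show "U_game j (map q d) (q ` Y) Z"
            using U_game_image[OF qe model_carr[OF Y(1)] ZC Y(8)] q(2) by simp
        qed
        ultimately show ?thesis using qY Y(5) by blast
      qed
      ultimately show "\<exists>c' A'. GI_legal M Z (c, A) (c', A') \<and>
        (\<forall>A''. finite A'' \<and> A' \<subseteq> A'' \<and> A'' \<subseteq> Z \<longrightarrow> ?P j c' A'')" by blast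
    qed auto
  qed
  then show ?thesis by blast
qed

section \<open>Values of the rank over models, finite sets and arbitrary sets\<close>

abbreviation "U a X \<equiv> U_model M a X"

lemma U_iff: "enat n \<le> U a X \<longleftrightarrow> U_ge M a n X"
proof -
  have "{enat k |k. U_ge M a k X} \<noteq> {}" using U_ge.simps(1) by blast
  then have "enat n \<le> U a X \<longleftrightarrow> (\<exists>k. U_ge M a k X \<and> n \<le> k)"
    unfolding U_model_def by (subst enat_le_Sup_iff) auto
  then show ?thesis using U_ge_le by blast
qed

lemma U_leI: "(\<And>n. U_ge M a n X \<Longrightarrow> U_ge M b n Y) \<Longrightarrow> U a X \<le> U b Y"
  by (rule enat_leI) (simp add: U_iff)

lemma U_finite:
  assumes "set a \<subseteq> CC"
  shows "\<exists>n. \<forall>X. model X \<longrightarrow> U a X \<le> enat n"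
proof -
  obtain n where n: "\<forall>X k. model X \<and> U_ge M a k X \<longrightarrow> k \<le> n" using U_bound[OF assms] by blast
  have "U a X \<le> enat n" if "model X" for X
    by (rule enat_leI) (use n that U_iff in auto)
  then show ?thesis by blast
qed

lemma U_mono: "X \<subseteq> Y \<Longrightarrow> U a Y \<le> U a X"
  by (rule U_leI) (rule U_ge_mono)

lemma U_subset: "set a' \<subseteq> set a \<union> X \<Longrightarrow> U a' X \<le> U a X"
  by (rule U_leI) (rule U_ge_subset)

lemma U_cong: "model X \<Longrightarrow> wt X a b \<Longrightarrow> set a \<subseteq> CC \<Longrightarrow> U a X = U b X"
  using U_ge_cong wt_sym wt_carr by (intro antisym U_leI) metis+

lemma U_image_le:
  "f \<in> Aut M {} \<Longrightarrow> X \<subseteq> CC \<Longrightarrow> set a \<subseteq> CC \<Longrightarrow> U a X \<le> U (map f a) (f ` X)"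
  by (rule U_leI) (rule U_ge_image)

lemma U_free:
  assumes "model X" "model Y" "X \<subseteq> Y" "set a \<subseteq> CC" "I a X Y"
  shows "U a Y = U a X"
  by (rule antisym) (use assms U_mono in \<open>auto intro!: U_leI elim: U_ge_free\<close>)

text \<open>A dependent extension without loss of rank would push the rank over \<open>X\<close>
  above itself, impossible for a finite value.\<close>

lemma U_free_conv:
  assumes X: "model X" "model Y" "X \<subseteq> Y" and a: "set a \<subseteq> CC" and U: "U a X \<le> U a Y"
  shows "I a X Y"
proof (rule ccontr)
  assume "\<not> I a X Y"
  obtain n where "U a X \<le> enat n" using U_finite[OF a] X(1) by blast
  then obtain k where k: "U a X = enat k" by (cases "U a X") auto
  then have "U_ge M a k Y" using U U_iff by metis
  then have "U_ge M a (Suc k) X" using X \<open>\<not> I a X Y\<close> by auto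
  then have "enat (Suc k) \<le> enat k" using U_iff k by metis
  then show False by simp
qed

abbreviation "UF a A \<equiv> U_fin M a A"

lemma UF_upper: "model X \<Longrightarrow> A \<subseteq> X \<Longrightarrow> U a X \<le> UF a A"
  unfolding U_fin_def by (rule Sup_upper) blast

lemma UF_least: "(\<And>X. model X \<Longrightarrow> A \<subseteq> X \<Longrightarrow> U a X \<le> u) \<Longrightarrow> UF a A \<le> u"
  unfolding U_fin_def by (rule Sup_least) blast

lemma UF_mono: "A \<subseteq> B \<Longrightarrow> UF a B \<le> UF a A"
  by (rule UF_least) (use UF_upper in blast)

lemma UF_finite: "set a \<subseteq> CC \<Longrightarrow> \<exists>n. \<forall>A. UF a A \<le> enat n"
  using U_finite UF_least by metis

lemma UF_attained:
  assumes A: "finite A" "A \<subseteq> CC" and a: "set a \<subseteq> CC"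
  shows "\<exists>X. model X \<and> A \<subseteq> X \<and> U a X = UF a A"
proof -
  obtain n where "UF a A \<le> enat n" using UF_finite[OF a] by blast
  then obtain k where k: "UF a A = enat k" by (cases "UF a A") auto
  obtain X0 where X0: "model X0" "A \<subseteq> X0" using ex_model[OF A(2) bd_finite[OF A(1)]] by blast
  then have "{U a X |X. model X \<and> A \<subseteq> X} \<noteq> {}" by blast
  moreover have "enat k \<le> Sup {U a X |X. model X \<and> A \<subseteq> X}" using k unfolding U_fin_def by simp
  ultimately obtain X where X: "model X" "A \<subseteq> X" "enat k \<le> U a X"
    unfolding enat_le_Sup_iff[OF \<open>{U a X |X. model X \<and> A \<subseteq> X} \<noteq> {}\<close>] by blast
  then show ?thesis using UF_upper[OF X(1,2), of a] k by (intro exI[of _ X]) auto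
qed

lemma UF_cong:
  assumes t: "gt A a b" and A: "A \<subseteq> CC" and a: "set a \<subseteq> CC"
  shows "UF a A = UF b A"
proof -
  have le: "UF a A \<le> UF b A" if t: "gt A a b" and a: "set a \<subseteq> CC" for a b
  proof (rule UF_least)
    fix X assume X: "model X" "A \<subseteq> X"
    obtain f where f: "f \<in> Aut M A" "map f a = b" using t by (rule gtE)
    have "A \<subseteq> f ` X" using X(2) Aut_image_fix[OF f(1)] by blast
    then have "U b (f ` X) \<le> UF b A" using UF_upper model_image[OF f(1) X(1)] by blast
    then show "U a X \<le> UF b A"
      using U_image_le[OF Aut_empty[OF f(1)] model_carr[OF X(1)] a] f(2) order_trans by blast
  qed
  show ?thesis using le[OF t a] le[OF gt_sym[OF t a] gt_carr[OF t a]] by (rule antisym)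
qed

lemma UF_subset: "set a' \<subseteq> set a \<union> A \<Longrightarrow> UF a' A \<le> UF a A"
proof (rule UF_least)
  fix X assume a: "set a' \<subseteq> set a \<union> A" and X: "model X" "A \<subseteq> X"
  have "U a' X \<le> U a X" by (rule U_subset) (use a X(2) in blast)
  then show "U a' X \<le> UF a A" using UF_upper[OF X] order_trans by blast
qed

text \<open>The clause of \<open>U_rank\<close> for arbitrary sets, applied to all sets alike. Over
  finite sets it gives \<open>UF\<close> by monotonicity; over models the agreement is
  \<open>rk_model\<close>.\<close>

definition rk :: "'a list \<Rightarrow> 'a set \<Rightarrow> enat" where
  "rk a A = Inf {UF a B |B. finite B \<and> B \<subseteq> A}"

lemma rk_lower: "finite B \<Longrightarrow> B \<subseteq> A \<Longrightarrow> rk a A \<le> UF a B"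
  unfolding rk_def by (rule Inf_lower) blast

lemma rk_greatest: "(\<And>B. finite B \<Longrightarrow> B \<subseteq> A \<Longrightarrow> u \<le> UF a B) \<Longrightarrow> u \<le> rk a A"
  unfolding rk_def by (rule Inf_greatest) blast

lemma rk_attained: "\<exists>B. finite B \<and> B \<subseteq> A \<and> rk a A = UF a B"
proof -
  have "{UF a B |B. finite B \<and> B \<subseteq> A} \<noteq> {}" by blast
  then have "rk a A \<in> {UF a B |B. finite B \<and> B \<subseteq> A}"
    unfolding rk_def Inf_enat_def by (auto intro: LeastI)
  then show ?thesis by blast
qed

lemma rk_mono: "A \<subseteq> B \<Longrightarrow> rk a B \<le> rk a A"
  by (rule rk_greatest) (use rk_lower in blast)

lemma rk_fin: "finite A \<Longrightarrow> rk a A = UF a A"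
  by (rule antisym) (auto intro: rk_lower rk_greatest UF_mono)

lemma rk_cong:
  assumes t: "wt A a b" and A: "A \<subseteq> CC" and a: "set a \<subseteq> CC"
  shows "rk a A = rk b A"
proof -
  have "UF a B = UF b B" if "finite B \<and> B \<subseteq> A" for B
    by (rule UF_cong[OF wtD[OF t]]) (use that A a in auto)
  then have "{UF a B |B. finite B \<and> B \<subseteq> A} = {UF b B |B. finite B \<and> B \<subseteq> A}" by metis
  then show ?thesis unfolding rk_def by simp
qed

lemma rk_subset: "set a' \<subseteq> set a \<Longrightarrow> rk a' A \<le> rk a A"
proof (rule rk_greatest)
  fix B assume a: "set a' \<subseteq> set a" and B: "finite B" "B \<subseteq> A"
  have "UF a' B \<le> UF a B" by (rule UF_subset) (use a in blast)
  then show "rk a' A \<le> UF a B" by (rule order_trans[OF rk_lower[OF B]])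
qed

lemma U_le_rk: "model X \<Longrightarrow> A \<subseteq> X \<Longrightarrow> U a X \<le> rk a A"
  by (rule rk_greatest) (use UF_upper in blast)

lemma rk_finite: "set a \<subseteq> CC \<Longrightarrow> \<exists>n. rk a A = enat n"
proof -
  assume "set a \<subseteq> CC"
  then obtain n where "rk a A \<le> enat n" using UF_finite rk_attained by metis
  then show ?thesis by (cases "rk a A") auto
qed

subsection \<open>Lascar types and generic extensions\<close>

abbreviation "Lt \<equiv> Lt_eq M"

text \<open>A small invariant that determines the weak type over a model: \<open>Y\<close> realises
  all types over its finite subsets, so it suffices to record which tuples of \<open>Y\<close>
  realise the type of \<open>x\<close> over which parameters.\<close>

definition codes :: "'a set \<Rightarrow> 'a list \<Rightarrow> ('a list \<times> 'a list) set" where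
  "codes Y x = {(d, e). set d \<subseteq> Y \<and> set e \<subseteq> Y \<and> gt (set e) d x}"

lemma codes_eq:
  assumes Y: "model Y" and x: "set x \<subseteq> CC" and c: "codes Y x = codes Y y"
  shows "wt Y x y"
proof (rule wtI)
  fix B assume B: "finite B" "B \<subseteq> Y"
  obtain e where e: "set e = B" using finite_list[OF B(1)] by blast
  obtain d where d: "set d \<subseteq> Y" "gt B d x" using saturated[OF Y B x] .
  then have "(d, e) \<in> codes Y x" using e B(2) by (simp add: codes_def)
  then have "gt B d y" using e unfolding c by (simp add: codes_def)
  moreover have "gt B x d" by (rule gt_sym[OF d(2)]) (use d(1) model_carr[OF Y] in blast)
  ultimately show "gt B x y" using gt_trans by blast
qed

text \<open>Inaccessibility bounds power sets of sets of elements, whereas codes are sets of pairs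
  of lists. The countably many pairs are therefore injected into the infinite set
  \<open>Y\<close>.\<close>

lemma bounded_codes:
  assumes Y: "model Y" "countable Y"
  shows "bounded_set M (range (codes Y))"
proof -
  let ?P = "{d. set d \<subseteq> Y} \<times> {e. set e \<subseteq> Y}"
  have "{d. set d \<subseteq> Y} = lists Y" by (auto simp: lists_eq_set)
  then have cP: "countable ?P" using Y(2) by auto
  define i where "i = from_nat_into Y \<circ> to_nat_on ?P"
  have inj: "inj_on i ?P"
    unfolding i_def using inj_on_to_nat_on[OF cP] Y model_infinite[OF Y(1)]
    by (intro comp_inj_on) (auto intro: inj_onI simp: from_nat_into_inj_infinite)
  have iY: "i p \<in> Y" for p
    unfolding i_def using model_infinite[OF Y(1)] by (auto intro: from_nat_into)
  have "range (codes Y) \<subseteq> (\<lambda>S. {p \<in> ?P. i p \<in> S}) ` Pow Y"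
  proof
    fix c assume "c \<in> range (codes Y)"
    then have c: "c \<subseteq> ?P" by (auto simp: codes_def)
    have "c = {p \<in> ?P. i p \<in> i ` c}"
    proof
      show "{p \<in> ?P. i p \<in> i ` c} \<subseteq> c" using inj_on_image_mem_iff[OF inj _ c] by blast
    qed (use c in blast)
    moreover have "i ` c \<in> Pow Y" using iY by blast
    ultimately show "c \<in> (\<lambda>S. {p \<in> ?P. i p \<in> S}) ` Pow Y" by blast
  qed
  moreover have "bounded_set M (Pow Y)"
    using delta_facts(4)[of Y] model_bd[OF Y(1)] unfolding bounded_set_def by blast
  ultimately show ?thesis by (rule bd_surj)
qed

lemma bounded_classes:
  assumes Y: "model Y" "countable Y" and E: "equiv (tuples n CC) E"
    and t: "\<And>x y. x \<in> tuples n CC \<Longrightarrow> y \<in> tuples n CC \<Longrightarrow> wt Y x y \<Longrightarrow> (x, y) \<in> E"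
  shows "bounded_set M (tuples n CC // E)"
proof -
  define G where "G = (\<lambda>c. E `` {SOME x. x \<in> tuples n CC \<and> codes Y x = c})"
  have "tuples n CC // E \<subseteq> G ` range (codes Y)"
  proof
    fix C assume "C \<in> tuples n CC // E"
    then obtain x where x: "x \<in> tuples n CC" "C = E `` {x}" by (auto elim: quotientE)
    let ?y = "SOME y. y \<in> tuples n CC \<and> codes Y y = codes Y x"
    have y: "?y \<in> tuples n CC \<and> codes Y ?y = codes Y x" by (rule someI[of _ x]) (use x(1) in simp)
    then have "wt Y ?y x" using codes_eq[OF Y(1), of ?y x] by (simp add: tuples_def)
    then have "(?y, x) \<in> E" using t y x(1) by blast
    then have "E `` {?y} = C" unfolding x(2) by (rule equiv_class_eq[OF E])
    then have "C = G (codes Y x)" unfolding G_def by simp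
    then show "C \<in> G ` range (codes Y)" by blast
  qed
  then show ?thesis using bounded_codes[OF Y] by (rule bd_surj)
qed

text \<open>Condition \<open>Y\<close> yields boundedness: a relation coarser than equality of types
  over a countable model has no more classes than there are codes.\<close>

lemma bdd_equivsI:
  assumes A: "finite A" "A \<subseteq> CC" and E: "E \<subseteq> tuples n CC \<times> tuples n CC"
    and r: "\<And>x. x \<in> tuples n CC \<Longrightarrow> (x, x) \<in> E" and s: "\<And>x y. (x, y) \<in> E \<Longrightarrow> (y, x) \<in> E"
    and tr: "\<And>x y z. (x, y) \<in> E \<Longrightarrow> (y, z) \<in> E \<Longrightarrow> (x, z) \<in> E"
    and inv: "\<And>f x y. f \<in> Aut M A \<Longrightarrow> (x, y) \<in> E \<Longrightarrow> (map f x, map f y) \<in> E"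
    and Y: "\<And>Y x y. model Y \<Longrightarrow> countable Y \<Longrightarrow> A \<subseteq> Y \<Longrightarrow> x \<in> tuples n CC \<Longrightarrow> y \<in> tuples n CC \<Longrightarrow>
      wt Y x y \<Longrightarrow> (x, y) \<in> E"
  shows "E \<in> bdd_equivs M A n"
proof -
  have eq: "equiv (tuples n CC) E"
  proof (rule equivI[OF E])
    show "refl_on (tuples n CC) E" using r by (rule refl_onI)
    show "sym E" using s by (rule symI)
    show "trans E" using tr by (rule transI)
  qed
  obtain Y0 where Y0: "model Y0" "A \<subseteq> Y0" "countable Y0"
    using ex_cmodel[OF A(2) countable_finite[OF A(1)]] .
  have "bounded_set M (tuples n CC // E)"
    by (rule bounded_classes[OF Y0(1,3) eq]) (rule Y[OF Y0(1,3,2)])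
  moreover have "(x, y) \<in> E \<longleftrightarrow> (map f x, map f y) \<in> E"
    if f: "f \<in> Aut M A" and x: "x \<in> tuples n CC" "y \<in> tuples n CC" for f x y
  proof
    assume L: "(map f x, map f y) \<in> E"
    obtain k where k: "k \<in> Aut M A" "\<forall>x\<in>CC. k (f x) = x" using Aut_inv[OF f] by blast
    have "map k (map f z) = z" if "z \<in> tuples n CC" for z
      using that k(2) by (simp add: tuples_def subset_iff map_idI)
    then show "(x, y) \<in> E" using inv[OF k(1) L] x by metis
  qed (rule inv[OF f])
  ultimately show ?thesis unfolding bdd_equivs_def using eq by blast
qed

lemma Lt_length: "Lt A a b \<Longrightarrow> length a = length b"
  unfolding Lt_eq_def by blast

lemma LtD: "Lt A a b \<Longrightarrow> finite B \<Longrightarrow> B \<subseteq> A \<Longrightarrow> E \<in> bdd_equivs M B (length a) \<Longrightarrow> (a, b) \<in> E"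
  unfolding Lt_eq_def by blast

lemma LtI:
  assumes "length a = length b"
    "\<And>B E. finite B \<Longrightarrow> B \<subseteq> A \<Longrightarrow> E \<in> bdd_equivs M B (length a) \<Longrightarrow> (a, b) \<in> E"
  shows "Lt A a b"
  using assms unfolding Lt_eq_def by blast

lemma bdd_equivs_equiv: "E \<in> bdd_equivs M B n \<Longrightarrow> equiv (tuples n CC) E"
  unfolding bdd_equivs_def by blast

lemma Lt_sym: "Lt A a b \<Longrightarrow> Lt A b a"
proof (rule LtI)
  assume L: "Lt A a b"
  show l: "length b = length a" using Lt_length[OF L] by simp
  fix B E assume B: "finite B" "B \<subseteq> A" "E \<in> bdd_equivs M B (length b)"
  have "(a, b) \<in> E" using LtD[OF L B(1,2)] B(3) l by metis
  moreover have "sym E" using bdd_equivs_equiv[OF B(3)] by (rule equivE)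
  ultimately show "(b, a) \<in> E" by (metis symD)
qed

lemma Lt_trans: "Lt A a b \<Longrightarrow> Lt A b c \<Longrightarrow> Lt A a c"
proof (rule LtI)
  assume L: "Lt A a b" "Lt A b c"
  show "length a = length c" using Lt_length[OF L(1)] Lt_length[OF L(2)] by simp
  fix B E assume B: "finite B" "B \<subseteq> A" "E \<in> bdd_equivs M B (length a)"
  have "(a, b) \<in> E" "(b, c) \<in> E"
    using LtD[OF L(1) B] LtD[OF L(2) B(1,2)] B(3) Lt_length[OF L(1)] by simp_all
  moreover have "trans E" using bdd_equivs_equiv[OF B(3)] by (rule equivE)
  ultimately show "(a, c) \<in> E" by (metis transD)
qed

lemma Lt_mono: "Lt A a b \<Longrightarrow> B \<subseteq> A \<Longrightarrow> Lt B a b"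
  by (rule LtI) (auto dest: Lt_length LtD)

text \<open>Equality of Galois types over a finite \<open>B\<close> is itself a member of
  \<open>E(B)\<close>.\<close>

lemma Lt_wt:
  assumes L: "Lt A a b" and A: "A \<subseteq> CC" and a: "set a \<subseteq> CC"
  shows "wt A a b"
proof (rule wtI)
  fix B assume B: "finite B" "B \<subseteq> A"
  let ?n = "length a"
  let ?E = "{(x, y). x \<in> tuples ?n CC \<and> y \<in> tuples ?n CC \<and> gt B x y}"
  have BC: "B \<subseteq> CC" using B(2) A by blast
  have "?E \<in> bdd_equivs M B ?n"
  proof (rule bdd_equivsI[OF B(1) BC])
    fix f x y assume f: "f \<in> Aut M B" and "(x, y) \<in> ?E"
    then have xy: "x \<in> tuples ?n CC" "y \<in> tuples ?n CC" "gt B x y" by auto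
    have xC: "set x \<subseteq> CC" using xy(1) by (simp add: tuples_def)
    have "gt B x (map f x)" "gt B y (map f y)" using gtI[OF f refl] by auto
    then have "gt B (map f x) (map f y)" using gt_trans[OF gt_sym[OF _ xC] gt_trans[OF xy(3)]] by blast
    then show "(map f x, map f y) \<in> ?E" using map_tuples[OF f] xy(1,2) by simp
  next
    fix x y assume "(x, y) \<in> ?E"
    then show "(y, x) \<in> ?E" using gt_sym[of B x y] by (auto simp: tuples_def)
  qed (auto simp: gt_refl intro: gt_trans dest: wtD[OF _ B(1)])
  then show "gt B a b" using LtD[OF L B] by blast
qed

lemma I_gt:
  assumes X: "model X" and I: "I c X D" and st: "set s \<subseteq> X \<union> D" "set t \<subseteq> X \<union> D" "wt X s t"
    and B: "finite B" "B \<subseteq> X"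
  shows "gt B (c @ s) (c @ t)"
proof -
  obtain E where E: "finite E" "E \<subseteq> X" "\<not> splits M c (X \<union> D) E" using I unfolding I_iff by blast
  let ?E = "E \<union> B"
  have E': "finite ?E" "?E \<subseteq> X" using E B by auto
  have "\<not> splits M c (X \<union> D) ?E" by (rule not_splits_base[OF E(3) E'(1)]) (use E' in auto)
  then have "gt ?E (c @ s) (c @ t)" using not_splitsD[OF _ E'(1) st(1,2) wtD[OF st(3) E']] by blast
  then show ?thesis using gt_mono by blast
qed

text \<open>As \<open>E\<close> has boundedly many classes, representatives of those meeting the
  type of \<open>a\<close> form a bounded set. A realisation \<open>c\<close> free from it over
  \<open>X\<close> is related to one of them, so \<open>E\<close> relates a free pair of
  realisations. Comparing with a realisation \<open>c'\<close> free from \<open>a\<close> and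
  \<open>b\<close>, uniqueness relates \<open>c'\<close> to both.\<close>

lemma wt_Lt:
  assumes X: "model X" and t: "wt X a b" and a: "set a \<subseteq> CC" and A: "A \<subseteq> X"
  shows "Lt A a b"
proof (rule LtI)
  show "length a = length b" using wt_length[OF t] .
  fix B E assume B: "finite B" "B \<subseteq> A" and E: "E \<in> bdd_equivs M B (length a)"
  let ?n = "length a"
  have b: "set b \<subseteq> CC" using wt_carr[OF t a] .
  have BX: "B \<subseteq> X" using B(2) A by blast
  note eq = bdd_equivs_equiv[OF E]
  have E_inv: "(map f x, map f y) \<in> E" if "f \<in> Aut M B" "(x, y) \<in> E" for f x y
  proof -
    have "E \<subseteq> tuples ?n CC \<times> tuples ?n CC" using eq by (auto elim: equivE)
    then show ?thesis using E that unfolding bdd_equivs_def by blast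
  qed
  let ?T = "tuples ?n CC // E"
  let ?ok = "\<lambda>c. wt X c a \<and> set c \<subseteq> CC"
  \<comment> \<open>Classes without a realisation of the type get the empty list, which adds nothing
    to the set of representatives.\<close>
  define rep where "rep = (\<lambda>C. if \<exists>c\<in>C. ?ok c then SOME c. c \<in> C \<and> ?ok c else [])"
  have rep: "rep C \<in> C \<and> ?ok (rep C)" if "c \<in> C" "?ok c" for c C
    unfolding rep_def using that someI[of "\<lambda>c. c \<in> C \<and> ?ok c" c] by auto
  let ?D = "\<Union>C\<in>?T. set (rep C)"
  have "set (rep C) \<subseteq> CC" for C
    using rep[of _ C] by (cases "\<exists>c\<in>C. ?ok c") (auto simp: rep_def)
  then have DC: "?D \<subseteq> CC" by blast
  have "bounded_set M ?T" using E unfolding bdd_equivs_def by blast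
  then have Db: "bounded_set M ?D" by (rule bd_UN) (simp add: bd_finite)
  obtain c where c: "wt X c a" "I c X ?D" "set c \<subseteq> CC" using I_ext[OF X DC Db a] by blast
  have ct: "c \<in> tuples ?n CC" using c(3) wt_length[OF c(1)] by (simp add: tuples_def)
  let ?s = "rep (E `` {c})"
  have "c \<in> E `` {c}" using equiv_class_self[OF eq ct] .
  then have s: "(c, ?s) \<in> E" "wt X ?s a" "set ?s \<subseteq> CC" using rep[of c "E `` {c}"] c(1,3) by auto
  have sD: "set ?s \<subseteq> ?D" using quotientI[OF ct, of E] by blast
  let ?d = "set ?s \<union> set a \<union> set b"
  have dC: "?d \<subseteq> CC" using s(3) a b by blast
  obtain c' where c': "wt X c' c" "I c' X ?d" "set c' \<subseteq> CC"
    using I_ext[OF X dC _ c(3)] bd_finite[of ?d] by auto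
  have "I c X (set ?s)" "I c' X (set ?s)"
    using I_mono[OF c(2) order_refl, of "set ?s"] I_mono[OF c'(2) order_refl, of "set ?s"] sD by auto
  then have "wt (X \<union> set ?s) c c'"
    using I_unique[OF X s(3) _ c(3) _ wt_sym[OF c'(1,3)]] by blast
  then have "wt X (c @ ?s) (c' @ ?s)" by (simp add: wt_Un)
  then have 1: "gt B (c @ ?s) (c' @ ?s)" using wtD B(1) BX by blast
  \<comment> \<open>\<open>c'\<close> does not split over a finite part of \<open>X\<close>, so its
    type with \<open>z\<close> is its type with \<open>?s\<close>, and invariance of
    \<open>E\<close> applies.\<close>
  have rel: "(c', z) \<in> E" if z: "wt X ?s z" "set z \<subseteq> ?d" for z
  proof -
    have "gt B (c' @ ?s) (c' @ z)" by (rule I_gt[OF X c'(2) _ _ z(1) B(1) BX]) (use z(2) in auto)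
    then have "gt B (c @ ?s) (c' @ z)" using 1 gt_trans by blast
    then obtain f where f: "f \<in> Aut M B" "map f c = c'" "map f ?s = z"
      using gt_app wt_length[OF c'(1)] by metis
    then show ?thesis using E_inv[OF f(1) s(1)] by simp
  qed
  have "(c', a) \<in> E" "(c', b) \<in> E" using rel s(2) wt_trans[OF s(2) t] by auto
  moreover have "sym E" "trans E" using eq by (auto elim: equivE)
  ultimately show "(a, b) \<in> E" by (metis symD transD)
qed

section \<open>Generic elements over finite sets\<close>

lemma U_image:
  assumes f: "f \<in> Aut M {}" and X: "X \<subseteq> CC" and a: "set a \<subseteq> CC"
  shows "U (map f a) (f ` X) = U a X"
proof (rule antisym)
  obtain k where k: "k \<in> Aut M {}" "\<forall>S. S \<subseteq> CC \<longrightarrow> k ` f ` S = S"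
    "\<forall>x. set x \<subseteq> CC \<longrightarrow> map k (map f x) = x" using Aut_image_inv[OF f] by metis
  show "U (map f a) (f ` X) \<le> U a X"
    using U_image_le[OF k(1) image_carr[OF f X] map_carr[OF f a]] k(2,3) X a by metis
qed (rule U_image_le[OF f X a])

lemma generic_ext:
  assumes X: "model X" "A \<subseteq> X" "finite A" and D: "D \<subseteq> CC" "bounded_set M D" and a: "set a \<subseteq> CC"
    and U: "U a X = UF a A"
  shows "\<exists>b Z. model Z \<and> X \<union> D \<subseteq> Z \<and> set b \<subseteq> CC \<and> wt X b a \<and> U b Z = UF a A \<and> UF b A = UF a A"
proof -
  obtain Z where Z: "model Z" "X \<union> D \<subseteq> Z"
    by (rule ex_model[of "X \<union> D"]) (use model_carr[OF X(1)] D bd_Un[OF model_bd[OF X(1)]] in auto)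
  obtain b where b: "wt X b a" "I b X Z" "set b \<subseteq> CC"
    using I_ext[OF X(1) model_carr[OF Z(1)] model_bd[OF Z(1)] a] by blast
  have "U b Z = U b X" using U_free[OF X(1) Z(1) _ b(3,2)] Z(2) by blast
  also have "\<dots> = U a X" using U_cong[OF X(1) b(1,3)] .
  finally have "U b Z = UF a A" using U by simp
  moreover have "gt A b a" using wtD[OF b(1) X(3,2)] .
  then have "UF b A = UF a A" using UF_cong[OF _ _ b(3)] X(2) model_carr[OF X(1)] by blast
  ultimately show ?thesis using Z b by blast
qed

lemma generic_Lascar:
  assumes X: "model X" "A \<subseteq> X" "finite A" and a: "set a \<subseteq> CC" and U: "U a X = UF a A"
    and c: "set c \<subseteq> X" "set d \<subseteq> X" "Lt A c d"
  shows "gt A (a @ c) (a @ d)"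
proof -
  let ?n = "length c"
  let ?gen = "\<lambda>X a. model X \<and> A \<subseteq> X \<and> set a \<subseteq> CC \<and> U a X = UF a A"
  let ?E = "{(c, d). c \<in> tuples ?n CC \<and> d \<in> tuples ?n CC \<and>
     (\<forall>X a. ?gen X a \<and> set c \<union> set d \<subseteq> X \<longrightarrow> gt A (a @ c) (a @ d))}"
  have AC: "A \<subseteq> CC" using X(2) model_carr[OF X(1)] by blast
  have ED: "gt A (b @ x) (b @ y)" if "(x, y) \<in> ?E" "?gen Z b" "set x \<subseteq> Z" "set y \<subseteq> Z" for x y b Z
    using that by blast
  have "?E \<in> bdd_equivs M A ?n"
  proof (rule bdd_equivsI[OF X(3) AC])
    show "?E \<subseteq> tuples ?n CC \<times> tuples ?n CC" by auto
    show "(x, x) \<in> ?E" if "x \<in> tuples ?n CC" for x using that gt_refl by auto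
  next
    fix x y assume xy: "(x, y) \<in> ?E"
    have "gt A (a @ y) (a @ x)" if g: "?gen Z a \<and> set y \<union> set x \<subseteq> Z" for Z a
    proof -
      have "gt A (a @ x) (a @ y)" using xy g by blast
      then show ?thesis by (rule gt_sym) (use g model_carr[of Z] in auto)
    qed
    then show "(y, x) \<in> ?E" using xy by blast
  next
    fix x y z assume xy: "(x, y) \<in> ?E" "(y, z) \<in> ?E"
    have "gt A (a @ x) (a @ z)" if g: "?gen Z a \<and> set x \<union> set z \<subseteq> Z" for Z a
    proof -
      have yC: "set y \<subseteq> CC" using xy by (auto simp: tuples_def)
      \<comment> \<open>The middle tuple \<open>y\<close> need not lie in \<open>Z\<close>; a
        generic extension with the type of \<open>a\<close> over \<open>Z\<close> brings it into a
        model.\<close>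
      obtain b W where b: "model W" "Z \<union> set y \<subseteq> W" "set b \<subseteq> CC" "wt Z b a" "U b W = UF a A" "UF b A = UF a A"
        using generic_ext[of Z A "set y" a] g X(3) yC bd_finite[of "set y"] by auto
      have gW: "?gen W b" using b g by auto
      have "gt A (b @ x) (b @ y)" using ED[OF xy(1) gW] b(2) g by blast
      moreover have "gt A (b @ y) (b @ z)" using ED[OF xy(2) gW] b(2) g by blast
      moreover have "gt A (b @ z) (a @ z)" using wtD_gt[OF b(4) X(3)] g by blast
      moreover have "gt A (a @ x) (b @ x)" using wtD_gt[OF wt_sym[OF b(4,3)] X(3)] g by blast
      ultimately show ?thesis using gt_trans by meson
    qed
    then show "(x, z) \<in> ?E" using xy by blast
  next
    fix f x y assume f: "f \<in> Aut M A" and xy: "(x, y) \<in> ?E"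
    obtain k where k: "k \<in> Aut M A" "\<forall>x\<in>CC. k (f x) = x" "\<forall>x\<in>CC. f (k x) = x" using Aut_inv[OF f] by blast
    note ke = Aut_empty[OF k(1)]
    have C: "set x \<subseteq> CC" "set y \<subseteq> CC" using xy by (auto simp: tuples_def)
    have "gt A (a @ map f x) (a @ map f y)" if g: "?gen Z a \<and> set (map f x) \<union> set (map f y) \<subseteq> Z" for Z a
    proof -
      have a: "set a \<subseteq> CC" and Z: "model Z" "A \<subseteq> Z" using g by auto
      let ?a = "map k a" and ?Z = "k ` Z"
      have fa: "map f ?a = a" using k(3) a by (simp add: subset_iff map_idI)
      have kf: "map k (map f x) = x" "map k (map f y) = y" using k(2) C by (simp_all add: subset_iff map_idI)
      have sub: "k ` set (map f x) \<subseteq> k ` Z" "k ` set (map f y) \<subseteq> k ` Z" using g by blast+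
      have xZ: "set x \<union> set y \<subseteq> ?Z" using sub kf by (metis Un_least set_map)
      have "U ?a ?Z = U a Z" using U_image[OF ke model_carr[OF Z(1)] a] .
      moreover have "UF a A = UF ?a A" using UF_cong[OF gtI[OF k(1) refl] AC a] .
      moreover have "A \<subseteq> ?Z" using Z(2) Aut_image_fix[OF k(1)] by blast
      ultimately have "?gen ?Z ?a" using model_image[OF k(1) Z(1)] map_carr[OF k(1) a] g by auto
      then have "gt A (?a @ x) (?a @ y)" using xy xZ by blast
      then have "gt (f ` A) (map f (?a @ x)) (map f (?a @ y))"
        by (rule gt_image[OF Aut_empty[OF f] _ AC]) (use map_carr[OF k(1) a] C in auto)
      then show ?thesis using fa Aut_image_fix[OF f] by simp
    qed
    then show "(map f x, map f y) \<in> ?E" using xy map_tuples[OF f] by blast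
  next
    fix Y x y assume Y: "model Y" "A \<subseteq> Y" and xy: "x \<in> tuples ?n CC" "y \<in> tuples ?n CC" "wt Y x y"
    have "gt A (a @ x) (a @ y)" if g: "?gen Z a \<and> set x \<union> set y \<subseteq> Z" for Z a
    proof -
      \<comment> \<open>The point behind boundedness: an element generic over a model around
        \<open>Y\<close> has no rank to lose above \<open>Y\<close>, so it is free over
        \<open>Y\<close> and cannot tell apart tuples of equal type over \<open>Y\<close>.\<close>
      obtain b W where b: "model W" "Z \<union> Y \<subseteq> W" "set b \<subseteq> CC" "wt Z b a" "U b W = UF a A" "UF b A = UF a A"
        using generic_ext[of Z A Y a] g X(3) model_carr[OF Y(1)] model_bd[OF Y(1)] by auto
      have YW: "Y \<subseteq> W" using b(2) by blast
      have "U b Y \<le> U b W" using UF_upper[OF Y(1,2), of b] b(5,6) by simp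
      then have "I b Y W" using U_free_conv[OF Y(1) b(1) YW b(3)] by blast
      then have "gt A (b @ x) (b @ y)" by (rule I_gt[OF Y(1) _ _ _ xy(3) X(3) Y(2)]) (use b(2) g in auto)
      moreover have "gt A (b @ y) (a @ y)" using wtD_gt[OF b(4) X(3)] g by blast
      moreover have "gt A (a @ x) (b @ x)" using wtD_gt[OF wt_sym[OF b(4,3)] X(3)] g by blast
      ultimately show ?thesis using gt_trans by meson
    qed
    then show "(x, y) \<in> ?E" using xy by blast
  qed
  then have "(c, d) \<in> ?E" using LtD[OF c(3) X(3)] by blast
  then show ?thesis using X a U c by blast
qed

lemma not_LsplitsD:
  assumes "\<not> Lascar_splits M a B A" "finite A" "set b \<subseteq> B" "set c \<subseteq> B" "Lt A b c"
  shows "gt A (a @ b) (a @ c)"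
  using assms unfolding Lascar_splits_def wt_fin[OF assms(2)] by blast

lemma Lsplits_mono: "Lascar_splits M a B A \<Longrightarrow> B \<subseteq> B' \<Longrightarrow> Lascar_splits M a B' A"
  unfolding Lascar_splits_def by blast

lemma generic_not_Lsplits:
  assumes X: "model X" "A \<subseteq> X" "finite A" and a: "set a \<subseteq> CC" and U: "U a X = UF a A"
  shows "\<not> Lascar_splits M a X A"
  using generic_Lascar[OF X a U] unfolding Lascar_splits_def wt_fin[OF X(3)] by blast

text \<open>The start is a model over which \<open>a\<close> itself attains its maximal rank. A free
  extension keeps the type over that model, and with it the Lascar type.\<close>

lemma generic_Lt:
  assumes D: "model D" "A \<subseteq> D" "finite A" and a: "set a \<subseteq> CC"
  shows "\<exists>b. Lt A b a \<and> set b \<subseteq> CC \<and> U b D = UF a A \<and> UF b A = UF a A"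
proof -
  have AC: "A \<subseteq> CC" using D(2) model_carr[OF D(1)] by blast
  obtain X where X: "model X" "A \<subseteq> X" "U a X = UF a A" using UF_attained[OF D(3) AC a] by blast
  obtain b Z where b: "model Z" "X \<union> D \<subseteq> Z" "set b \<subseteq> CC" "wt X b a" "U b Z = UF a A" "UF b A = UF a A"
    using generic_ext[OF X(1,2) D(3) model_carr[OF D(1)] model_bd[OF D(1)] a X(3)] by blast
  have "UF a A \<le> U b D" using U_mono[of D Z b] b(2,5) by auto
  then have "U b D = UF a A" using UF_upper[OF D(1,2), of b] b(6) by auto
  moreover have "Lt A b a" using wt_Lt[OF X(1) b(4,3) X(2)] .
  ultimately show ?thesis using b by blast
qed

text \<open>\<open>D'\<close> contains the replacements for tuples of \<open>D\<close> used in the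
  symmetry argument: of the same Lascar type over \<open>A\<close>, but generic over
  \<open>D\<close>.\<close>

definition rich :: "'a set \<Rightarrow> 'a set \<Rightarrow> 'a set \<Rightarrow> bool" where
  "rich A D D' \<longleftrightarrow> (\<forall>d. set d \<subseteq> D \<longrightarrow>
     (\<exists>d'. set d' \<subseteq> D' \<and> Lt A d' d \<and> U d' D = UF d A \<and> UF d' A = UF d A))"

text \<open>One replacement per code over a countable model around \<open>A\<close> is enough,
  because equal codes give equal types over that model and so equal Lascar types over
  \<open>A\<close>. This keeps the set of replacements bounded.\<close>

lemma ex_rich:
  assumes D: "model D" "A \<subseteq> D" "finite A"
  shows "\<exists>D'. model D' \<and> D \<subseteq> D' \<and> rich A D D'"
proof -
  have DC: "D \<subseteq> CC" using model_carr[OF D(1)] .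
  have AC: "A \<subseteq> CC" using D(2) DC by blast
  obtain Y where Y: "model Y" "A \<subseteq> Y" "countable Y"
    using ex_cmodel[OF AC countable_finite[OF D(3)]] .
  let ?Q = "\<lambda>c d'. \<exists>d. set d \<subseteq> CC \<and> codes Y d = c \<and> Lt A d' d \<and> set d' \<subseteq> CC \<and> U d' D = UF d A \<and> UF d' A = UF d A"
  let ?K = "codes Y ` {d. set d \<subseteq> CC}"
  have "\<forall>c\<in>?K. \<exists>d'. ?Q c d'"
  proof
    fix c assume "c \<in> ?K"
    then obtain d where "set d \<subseteq> CC" "codes Y d = c" by blast
    then show "\<exists>d'. ?Q c d'" using generic_Lt[OF D] by blast
  qed
  then obtain g where g: "\<forall>c\<in>?K. ?Q c (g c)" by (rule bchoice[THEN exE])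
  have gC: "set (g c) \<subseteq> CC" if "c \<in> ?K" for c using bspec[OF g that] by blast
  let ?S = "\<Union>c\<in>?K. set (g c)"
  have "bounded_set M ?K" by (rule bd_subset[OF _ bounded_codes[OF Y(1,3)]]) blast
  then have "bounded_set M ?S" by (rule bd_UN) (simp add: bd_finite)
  then have "bounded_set M (D \<union> ?S)" using bd_Un[OF model_bd[OF D(1)]] by blast
  moreover have "D \<union> ?S \<subseteq> CC" using DC gC by blast
  ultimately obtain D' where D': "model D'" "D \<union> ?S \<subseteq> D'" using ex_model by blast
  have "rich A D D'"
    unfolding rich_def
  proof (intro allI impI)
    fix d assume "set d \<subseteq> D"
    then have d: "set d \<subseteq> CC" using DC by blast
    then have dK: "codes Y d \<in> ?K" by blast
    let ?e = "g (codes Y d)"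
    obtain d1 where d1: "set d1 \<subseteq> CC" "codes Y d1 = codes Y d" "Lt A ?e d1" "U ?e D = UF d1 A" "UF ?e A = UF d1 A"
      using bspec[OF g dK] by blast
    have t: "wt Y d1 d" using codes_eq[OF Y(1) d1(1,2)] .
    have "Lt A d1 d" using wt_Lt[OF Y(1) t d1(1) Y(2)] .
    then have "Lt A ?e d" using d1(3) Lt_trans by blast
    moreover have "UF d1 A = UF d A" using UF_cong[OF wtD[OF t D(3) Y(2)] AC d1(1)] .
    moreover have "set ?e \<subseteq> D'" using D'(2) dK by blast
    ultimately show "\<exists>d'. set d' \<subseteq> D' \<and> Lt A d' d \<and> U d' D = UF d A \<and> UF d' A = UF d A"
      using d1(4,5) by (intro exI[of _ ?e]) simp
  qed
  then show ?thesis using D' by blast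
qed

text \<open>Harrington's symmetry argument: replace \<open>d\<close> by a generic \<open>d'\<close> of the same Lascar type; as
  \<open>d'\<close> is free from \<open>a\<close> and from \<open>b\<close>, its type does not distinguish \<open>a\<close> from \<open>b\<close>.\<close>

lemma Lascar_unique:
  assumes A: "finite A" "A \<subseteq> D" and D: "model D" "model D'" "D \<subseteq> D'" "rich A D D'"
    and a: "set a \<subseteq> CC" "I a D D'" "\<not> Lascar_splits M a D' A"
    and b: "set b \<subseteq> CC" "I b D D'" "\<not> Lascar_splits M b D' A"
    and L: "Lt A a b"
  shows "wt D a b"
proof (rule wtI_gt)
  fix d assume d: "set d \<subseteq> D"
  note DC = model_carr[OF D(1)] and DC' = model_carr[OF D(2)]
  have dD': "set d \<subseteq> D'" using d D(3) by blast
  obtain e where e: "set e \<subseteq> D'" "Lt A e d" "U e D = UF d A" "UF e A = UF d A"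
    using D(4) d unfolding rich_def by blast
  have eC: "set e \<subseteq> CC" using e(1) DC' by blast
  have UE: "U e D = UF e A" using e(3,4) by simp
  \<comment> \<open>\<open>e\<close> is free from \<open>a\<close> and from \<open>b\<close>, but
    perhaps not from both together. Its copy \<open>g\<close> is generic over one model containing
    both, as \<open>generic_Lascar\<close> demands.\<close>
  obtain g Z where g: "model Z" "D \<union> (set a \<union> set b) \<subseteq> Z" "set g \<subseteq> CC" "wt D g e" "U g Z = UF e A" "UF g A = UF e A"
    using generic_ext[OF D(1) A(2,1) _ _ eC UE, of "set a \<union> set b"] a(1) b(1)
      bd_finite[of "set a \<union> set b"] by auto
  have "I g D Z"
    by (rule U_free_conv[OF D(1) g(1) _ g(3)])
      (use g(2,5,6) UF_upper[OF D(1) A(2), of g] in auto)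
  then have Ig: "I g D (set a)" "I g D (set b)"
    using I_mono[of g D Z D "set a"] I_mono[of g D Z D "set b"] g(2) by auto
  \<comment> \<open>Over \<open>D\<close> both \<open>g\<close> and \<open>e\<close> are free from
    \<open>x\<close>, the latter by symmetry, so uniqueness identifies their types.\<close>
  have sw: "gt A (g @ x) (e @ x)" if x: "set x \<subseteq> CC" "I x D D'" "I g D (set x)" for x
  proof -
    have "I x D (set e)" by (rule I_mono[OF x(2)]) (use e(1) D(3) in auto)
    then have "I e D (set x)" using I_sym[OF D(1) eC x(1)] by blast
    then have "wt (D \<union> set x) g e" using I_unique[OF D(1) x(1) x(3) g(3) _ g(4)] by blast
    then have "wt D (g @ x) (e @ x)" by (simp add: wt_Un)
    then show ?thesis using wtD A by blast
  qed
  have lg: "length g = length e" using wt_length[OF g(4)] .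
  have gUF: "U g Z = UF g A" using g(5,6) by simp
  have "gt A (g @ a) (g @ b)"
    by (rule generic_Lascar[OF g(1) _ A(1) g(3) gUF _ _ L]) (use g(2) A(2) in auto)
  moreover have "gt A (e @ a) (g @ a)" by (rule gt_sym[OF sw[OF a(1,2) Ig(1)]]) (use g(3) a(1) in auto)
  ultimately have "gt A (e @ a) (e @ b)" using sw[OF b(1,2) Ig(2)] gt_trans by meson
  then have m: "gt A (a @ e) (b @ e)" by (rule gt_swap) simp
  have "gt A (a @ d) (a @ e)" by (rule not_LsplitsD[OF a(3) A(1) dD' e(1) Lt_sym[OF e(2)]])
  moreover have "gt A (b @ e) (b @ d)" by (rule not_LsplitsD[OF b(3) A(1) e(1) dD' e(2)])
  ultimately have "gt A (a @ d) (b @ d)" using m gt_trans by meson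
  then show "gt {} (a @ d) (b @ d)" using gt_mono by blast
qed

lemma Lt_UF: "finite A \<Longrightarrow> A \<subseteq> CC \<Longrightarrow> set a \<subseteq> CC \<Longrightarrow> Lt A a b \<Longrightarrow> UF a A = UF b A"
  using UF_cong Lt_wt wt_fin by blast

text \<open>Generic extensions to a rich \<open>D\<close> over \<open>X\<close> are free over
  \<open>X\<close> and have no Lascar splitting over \<open>A\<close>, which is what
  \<open>Lascar_unique\<close> asks for.\<close>

lemma generic_unique:
  assumes A: "finite A" "A \<subseteq> X" and X: "model X"
    and a: "set a \<subseteq> CC" "U a X = UF a A" and b: "set b \<subseteq> CC" "U b X = UF b A" and L: "Lt A a b"
  shows "wt X a b"
proof -
  obtain D where D: "model D" "X \<subseteq> D" "rich A X D" using ex_rich[OF X A(2,1)] by blast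
  have *: "\<exists>c. set c \<subseteq> CC \<and> wt X c a \<and> I c X D \<and> \<not> Lascar_splits M c D A"
    if a: "set a \<subseteq> CC" "U a X = UF a A" for a
  proof -
    obtain c Z where c: "model Z" "X \<union> D \<subseteq> Z" "set c \<subseteq> CC" "wt X c a" "U c Z = UF a A" "UF c A = UF a A"
      using generic_ext[OF X A(2,1) model_carr[OF D(1)] model_bd[OF D(1)] a] by blast
    have "I c X Z"
      by (rule U_free_conv[OF X c(1) _ c(3)]) (use c(2,5,6) UF_upper[OF X A(2), of c] in auto)
    then have "I c X D" by (rule I_mono) (use c(2) in auto)
    moreover have "\<not> Lascar_splits M c Z A"
      by (rule generic_not_Lsplits[OF c(1) _ A(1) c(3)]) (use c A(2) in auto)
    then have "\<not> Lascar_splits M c D A" using Lsplits_mono c(2) by blast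
    ultimately show ?thesis using c by blast
  qed
  obtain c where c: "set c \<subseteq> CC" "wt X c a" "I c X D" "\<not> Lascar_splits M c D A" using *[OF a] by blast
  obtain d where d: "set d \<subseteq> CC" "wt X d b" "I d X D" "\<not> Lascar_splits M d D A" using *[OF b] by blast
  have "Lt A c a" using wt_Lt[OF X c(2,1) A(2)] .
  moreover have "Lt A b d" using wt_Lt[OF X wt_sym[OF d(2,1)] b(1) A(2)] .
  ultimately have "Lt A c d" using L Lt_trans by blast
  then have "wt X c d" using Lascar_unique[OF A X D(1,2,3) c(1,3,4) d(1,3,4)] by blast
  then show ?thesis using wt_trans wt_sym[OF c(2,1)] d(2) by blast
qed

text \<open>In a tower of rich extensions \<open>b\<close> cannot depend on every step, since its
  rank is finite. At a free step it has the type of a generic \<open>c\<close> of the same Lascar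
  type, so it has full rank there, and therefore also over the smaller model
  \<open>X\<close>.\<close>

lemma invariant_generic:
  assumes A: "finite A" "A \<subseteq> C" and C: "C \<subseteq> X" and X: "model X" and a: "set a \<subseteq> CC"
    and H: "\<And>D. C \<subseteq> D \<Longrightarrow> D \<subseteq> CC \<Longrightarrow> bounded_set M D \<Longrightarrow>
      \<exists>b. set b \<subseteq> CC \<and> wt C b a \<and> \<not> Lascar_splits M b D A"
  shows "\<exists>b. set b \<subseteq> CC \<and> wt C b a \<and> U b X = UF a A"
proof -
  have CC': "C \<subseteq> CC" using C model_carr[OF X] by blast
  have AC: "A \<subseteq> CC" using A(2) CC' by blast
  obtain N where N: "\<forall>A. UF a A \<le> enat N" using UF_finite[OF a] by blast
  have "\<exists>D. \<forall>n::nat. (model (D n) \<and> X \<subseteq> D n) \<and> (D n \<subseteq> D (Suc n) \<and> rich A (D n) (D (Suc n)))"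
  proof (rule dependent_nat_choice)
    show "\<exists>D. model D \<and> X \<subseteq> D" using X by blast
    fix D :: "'a set" and n :: nat assume D: "model D \<and> X \<subseteq> D"
    then have "A \<subseteq> D" using A(2) C by blast
    then show "\<exists>D'. (model D' \<and> X \<subseteq> D') \<and> (D \<subseteq> D' \<and> rich A D D')"
      using ex_rich[of D A] D A(1) by blast
  qed
  then obtain D where D: "\<And>n::nat. model (D n)" "\<And>n. X \<subseteq> D n" "\<And>n. D n \<subseteq> D (Suc n)"
    "\<And>n. rich A (D n) (D (Suc n))" by metis
  have mono: "i \<le> j \<Longrightarrow> D i \<subseteq> D j" for i j
    by (rule lift_Suc_mono_le[of D]) (use D(3) in auto)
  \<comment> \<open>\<open>N + 1\<close> steps lead from \<open>D 0\<close> to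
    \<open>D (Suc N)\<close>; dependence at each of them would give rank \<open>N + 1\<close> over
    \<open>D 0\<close>.\<close>
  obtain b where b: "set b \<subseteq> CC" "wt C b a" "\<not> Lascar_splits M b (D (Suc N)) A"
    using H[of "D (Suc N)"] C D(2) model_carr[OF D(1)] model_bd[OF D(1)] by blast
  have UFb: "UF b A = UF a A" using UF_cong[OF wtD[OF b(2) A] AC b(1)] .
  have AD: "A \<subseteq> D n" for n using A(2) C D(2) by blast
  have "\<exists>i\<le>N. I b (D i) (D (Suc i))"
  proof (rule ccontr)
    assume neg: "\<not> ?thesis"
    have "U_ge M b j (D (Suc N - j))" if "j \<le> Suc N" for j
      using that
    proof (induction j)
      case (Suc j)
      have e: "Suc (N - j) = Suc N - j" using Suc.prems by simp
      have "\<not> I b (D (N - j)) (D (Suc (N - j)))" using neg by simp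
      moreover have "U_ge M b j (D (Suc (N - j)))" using Suc unfolding e by simp
      ultimately have "U_ge M b (Suc j) (D (N - j))" using D(1,3) by auto
      then show ?case by simp
    qed simp
    from this[of "Suc N"] have "U_ge M b (Suc N) (D 0)" by simp
    then have "enat (Suc N) \<le> U b (D 0)" using U_iff by blast
    also have "\<dots> \<le> UF b A" using UF_upper[OF D(1) AD] .
    also have "\<dots> \<le> enat N" using UFb N by simp
    finally show False by simp
  qed
  then obtain i where i: "i \<le> N" "I b (D i) (D (Suc i))" by blast
  have nb: "\<not> Lascar_splits M b (D (Suc i)) A"
    using b(3) Lsplits_mono mono[of "Suc i" "Suc N"] i(1) by (meson Suc_le_mono)
  obtain c where c: "Lt A c b" "set c \<subseteq> CC" "U c (D (Suc i)) = UF b A" "UF c A = UF b A"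
    using generic_Lt[OF D(1) AD A(1) b(1)] by blast
  have Ic: "I c (D i) (D (Suc i))"
    by (rule U_free_conv[OF D(1) D(1) D(3) c(2)]) (use c(3,4) UF_upper[OF D(1) AD, of c] in auto)
  have nc: "\<not> Lascar_splits M c (D (Suc i)) A"
    by (rule generic_not_Lsplits[OF D(1) AD A(1) c(2)]) (use c in auto)
  have "wt (D i) c b" using Lascar_unique[OF A(1) AD D(1) D(1) D(3) D(4) c(2) Ic nc b(1) i(2) nb c(1)] .
  then have "U b (D i) = U c (D i)" using U_cong[OF D(1) _ c(2)] by metis
  moreover have "U c (D (Suc i)) \<le> U c (D i)" by (rule U_mono[OF D(3)])
  moreover have "U b (D i) \<le> U b X" by (rule U_mono[OF D(2)])
  ultimately have "UF a A \<le> U b X" using c(3) UFb by simp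
  moreover have "U b X \<le> UF b A" by (rule UF_upper[OF X]) (use A(2) C in blast)
  ultimately show ?thesis using b UFb by (intro exI[of _ b]) auto
qed

section \<open>The rank over arbitrary sets and the rank criterion for independence\<close>

text \<open>The minimum over finite subsets is attained at a base \<open>E\<close> of the type. Free
  extensions keep this base, hence do not Lascar split over \<open>E\<close>, and
  \<open>invariant_generic\<close> applies.\<close>

lemma rk_model:
  assumes X: "model X" and a: "set a \<subseteq> CC"
  shows "rk a X = U a X"
proof (rule antisym)
  obtain E where E: "finite E" "E \<subseteq> X" "\<not> splits M a X E" using model_local[OF X a] by blast
  note XC = model_carr[OF X]
  have "\<exists>b. set b \<subseteq> CC \<and> wt X b a \<and> U b X = UF a E"
  proof (rule invariant_generic[OF E(1,2) order_refl X a])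
    fix D assume D: "X \<subseteq> D" "D \<subseteq> CC" "bounded_set M D"
    obtain b where b: "wt X b a" "I b X D" "set b \<subseteq> CC" using I_ext[OF X D(2,3) a] by blast
    have XD: "X \<union> D = D" using D(1) by blast
    obtain F where F: "finite F" "F \<subseteq> X" "\<not> splits M b D F" using b(2) unfolding I_iff XD by blast
    have "\<not> splits M b X E" using not_splits_cong[OF E(3,1,2) XC wt_sym[OF b(1,3)] a] .
    then have s: "\<not> splits M b D E" using not_splits_trans[OF X D(1,2) E(1,2) _ F b(3)] by blast
    have "gt E (b @ x) (b @ y)" if x: "set x \<subseteq> D" "set y \<subseteq> D" "Lt E x y" for x y
    proof -
      have "wt E x y" by (rule Lt_wt[OF x(3)]) (use E(2) XC x D(2) in auto)
      then have "gt E x y" using wt_fin[OF E(1)] by blast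
      then show ?thesis using not_splitsD[OF s E(1) x(1,2)] by blast
    qed
    then have "\<not> Lascar_splits M b D E" unfolding Lascar_splits_def wt_fin[OF E(1)] by blast
    then show "\<exists>b. set b \<subseteq> CC \<and> wt X b a \<and> \<not> Lascar_splits M b D E" using b by blast
  qed
  then obtain b where b: "set b \<subseteq> CC" "wt X b a" "U b X = UF a E" by blast
  have "U a X = UF a E" using U_cong[OF X b(2,1)] b(3) by simp
  then show "rk a X \<le> U a X" using rk_lower[OF E(1,2), of a] by simp
  show "U a X \<le> rk a X" using U_le_rk[OF X] by blast
qed

lemma U_rank_rk:
  assumes "set a \<subseteq> CC"
  shows "U_rank M a A = rk a A"
  unfolding U_rank_def using rk_model[OF _ assms] rk_fin by (auto simp: rk_def)

text \<open>Each finite \<open>F\<close> between \<open>A0\<close> and \<open>A\<close> has its own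
  generic element with the Lascar type of \<open>a\<close> over \<open>F\<close>. All of these are
  generic over \<open>A0\<close> too, so they share one type over \<open>X\<close>, and a single one
  works for every \<open>F\<close>.\<close>

lemma rk_ext:
  assumes A: "A \<subseteq> X" and X: "model X" and a: "set a \<subseteq> CC"
  shows "\<exists>b. set b \<subseteq> CC \<and> Lt A b a \<and> U b X = rk a A"
proof -
  have AC: "A \<subseteq> CC" using A model_carr[OF X] by blast
  obtain A0 where A0: "finite A0" "A0 \<subseteq> A" "rk a A = UF a A0" using rk_attained by blast
  have A0C: "A0 \<subseteq> CC" "A0 \<subseteq> X" using A0 AC A by auto
  have ex: "\<exists>b. Lt F b a \<and> set b \<subseteq> CC \<and> U b X = rk a A \<and> U b X = UF b A0"
    if F: "finite F" "A0 \<subseteq> F" "F \<subseteq> A" for F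
  proof -
    have e: "UF a F = rk a A"
      using UF_mono[OF F(2), of a] rk_lower[OF F(1,3), of a] A0(3) by auto
    have FX: "F \<subseteq> X" using F(3) A by blast
    obtain b where b: "Lt F b a" "set b \<subseteq> CC" "U b X = UF a F" "UF b F = UF a F"
      using generic_Lt[OF X FX F(1) a] by blast
    have "UF b A0 = UF a A0" using Lt_UF[OF A0(1) A0C(1) b(2) Lt_mono[OF b(1) F(2)]] .
    then show ?thesis using b e A0(3) by auto
  qed
  obtain b where b: "Lt A0 b a" "set b \<subseteq> CC" "U b X = rk a A" "U b X = UF b A0"
    using ex[OF A0(1) order_refl A0(2)] by blast
  have "Lt A b a"
  proof (rule LtI)
    show "length b = length a" using Lt_length[OF b(1)] .
    fix B E assume B: "finite B" "B \<subseteq> A" "E \<in> bdd_equivs M B (length b)"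
    let ?F = "A0 \<union> B"
    have F: "finite ?F" "A0 \<subseteq> ?F" "?F \<subseteq> A" using A0 B by auto
    obtain c where c: "Lt ?F c a" "set c \<subseteq> CC" "U c X = rk a A" "U c X = UF c A0"
      using ex[OF F] by blast
    have "Lt A0 b c" using b(1) Lt_sym[OF Lt_mono[OF c(1) F(2)]] Lt_trans by blast
    then have "wt X b c" using generic_unique[OF A0(1) A0C(2) X b(2,4) c(2,4)] by blast
    then have "Lt ?F b c" by (rule wt_Lt[OF X _ b(2)]) (use F(3) A in blast)
    then have "Lt ?F b a" using c(1) Lt_trans by blast
    then show "(b, a) \<in> E" using LtD[of ?F b a B E] B by blast
  qed
  then show ?thesis using b by blast
qed

text \<open>Left to right, the definition of \<open>indep\<close> provides the extensions that
  \<open>invariant_generic\<close> demands. Right to left, a finite set attaining the rank over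
  \<open>B\<close> serves as base, since extensions of full rank are generic over it.\<close>

lemma indep_iff:
  assumes B: "B \<union> C \<subseteq> CC" "bounded_set M (B \<union> C)" and a: "set a \<subseteq> CC"
  shows "indep M a B C \<longleftrightarrow> rk a (B \<union> C) = rk a B"
proof
  assume "indep M a B C"
  then obtain A where A: "finite A" "A \<subseteq> B"
    "\<forall>D. B \<union> C \<subseteq> D \<and> D \<subseteq> CC \<and> bounded_set M D \<longrightarrow>
        (\<exists>b. set b \<subseteq> CC \<and> wt (B \<union> C) b a \<and> \<not> Lascar_splits M b D A)"
    unfolding indep_def by blast
  obtain X where X: "model X" "B \<union> C \<subseteq> X" using ex_model[OF B] .
  have "\<exists>b. set b \<subseteq> CC \<and> wt (B \<union> C) b a \<and> U b X = UF a A"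
    by (rule invariant_generic[OF A(1) _ X(2,1) a]) (use A in auto)
  then obtain b where b: "set b \<subseteq> CC" "wt (B \<union> C) b a" "U b X = UF a A" by blast
  have "rk a B \<le> UF a A" using rk_lower[OF A(1,2)] .
  also have "\<dots> = U b X" using b(3) by simp
  also have "\<dots> \<le> rk b (B \<union> C)" using U_le_rk[OF X] .
  also have "\<dots> = rk a (B \<union> C)" using rk_cong[OF b(2) B(1) b(1)] .
  finally show "rk a (B \<union> C) = rk a B" using rk_mono[of B "B \<union> C" a] by auto
next
  assume eq: "rk a (B \<union> C) = rk a B"
  obtain A where A: "finite A" "A \<subseteq> B" "rk a B = UF a A" using rk_attained by blast
  have AC: "A \<subseteq> CC" using A(2) B(1) by blast
  have "\<exists>b. set b \<subseteq> CC \<and> wt (B \<union> C) b a \<and> \<not> Lascar_splits M b D A"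
    if D: "B \<union> C \<subseteq> D" "D \<subseteq> CC" "bounded_set M D" for D
  proof -
    obtain X where X: "model X" "D \<subseteq> X" using ex_model[OF D(2,3)] .
    have BX: "B \<union> C \<subseteq> X" using D(1) X(2) by blast
    obtain b where b: "set b \<subseteq> CC" "Lt (B \<union> C) b a" "U b X = rk a (B \<union> C)"
      using rk_ext[OF BX X(1) a] by blast
    have t: "wt (B \<union> C) b a" using Lt_wt[OF b(2) B(1) b(1)] .
    have "gt A b a" by (rule wtD[OF t A(1)]) (use A(2) in blast)
    then have "UF b A = UF a A" using UF_cong AC b(1) by blast
    then have "U b X = UF b A" using b(3) eq A(3) by simp
    then have "\<not> Lascar_splits M b X A"
      by (intro generic_not_Lsplits[OF X(1) _ A(1) b(1)]) (use A(2) BX in auto)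
    then have "\<not> Lascar_splits M b D A" using Lsplits_mono X(2) by blast
    then show ?thesis using b(1) t by blast
  qed
  then show "indep M a B C" using A(1,2) unfolding indep_def by blast
qed

subsection \<open>Additivity of rank and bounded closure\<close>

text \<open>For additivity, a dependent extension of a pair must lower one of the two ranks. A model
  \<open>Z\<close> around \<open>b\<close> is chosen free from \<open>Y\<close> over
  \<open>X\<close>, and \<open>a\<close> is replaced by \<open>c\<close> of full rank over a model
  around \<open>Z\<close> and \<open>Y\<close>; transitivity carries the independence of
  \<open>Y\<close> from \<open>Z\<close> to \<open>Z\<close> with \<open>c\<close>.\<close>

lemma free_pair:
  assumes X: "model X" and Y: "model Y" "X \<subseteq> Y" and ab: "set a \<subseteq> CC" "set b \<subseteq> CC"
    and I: "I b X Y" and r: "rk a (set b \<union> Y) = rk a (set b \<union> X)"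
  shows "I (a @ b) X Y"
proof -
  note XC = model_carr[OF X] and YC = model_carr[OF Y(1)]
  have XY: "X \<union> Y = Y" using Y(2) by blast
  obtain W where W: "model W" "X \<union> set b \<subseteq> W"
    by (rule ex_model[of "X \<union> set b"]) (use XC ab bd_Un[OF model_bd[OF X] bd_finite] in auto)
  obtain f where f: "f \<in> Aut M X" "\<forall>c. set c \<subseteq> f ` W \<longrightarrow> I c X Y"
    using free_copy[OF X W(1) _ Y] W(2) by blast
  have fb: "set (map f b) \<subseteq> f ` W" using W(2) by auto
  have "wt X (map f b) b" using gt_sym[OF gtI[OF f(1) refl] ab(2)] by (rule wt_gt)
  then have "wt Y (map f b) b"
    using I_unique[OF X YC _ map_carr[OF f(1) ab(2)] I] f(2) fb XY by metis
  then obtain g where g: "g \<in> Aut M Y" "map g (map f b) = b"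
    using model_gt[OF Y(1) _ map_carr[OF f(1) ab(2)]] by blast
  \<comment> \<open>\<open>f\<close> moves \<open>W\<close> to a free position, and
    \<open>g\<close>, which fixes \<open>Y\<close>, moves the copy of \<open>b\<close> back to
    \<open>b\<close>.\<close>
  define Z where "Z = g ` f ` W"
  have Z: "model Z" unfolding Z_def by (intro model_image[OF g(1)] model_image[OF f(1)] W(1))
  note ZC = model_carr[OF Z]
  have gX: "g ` X = X" "g ` Y = Y" using Aut_image_fix[OF Aut_mono[OF g(1) Y(2)]] Aut_image_fix[OF g(1)] by auto
  have "g ` f ` X \<subseteq> Z" unfolding Z_def using W(2) by blast
  then have XZ: "X \<subseteq> Z" using gX(1) Aut_image_fix[OF f(1)] by simp
  have "set (map g (map f b)) \<subseteq> Z" using W(2) unfolding Z_def by auto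
  then have bZ: "set b \<subseteq> Z" unfolding g(2) .
  have IZ: "I c X Y" if c: "set c \<subseteq> Z" for c
  proof -
    have "\<forall>x\<in>set c. \<exists>y. y \<in> f ` W \<and> g y = x" using c unfolding Z_def by (metis imageE subsetD)
    then obtain u where u: "\<forall>x\<in>set c. u x \<in> f ` W \<and> g (u x) = x" by metis
    have d: "set (map u c) \<subseteq> f ` W" "map g (map u c) = c" using u by (auto intro: map_idI)
    have "f ` W \<subseteq> CC" using image_carr[OF f(1) model_carr[OF W(1)]] .
    then have dC: "set (map u c) \<subseteq> CC" using d(1) by blast
    have "I (map u c) X Y" using f(2) d(1) by blast
    then have "I (map g (map u c)) (g ` X) (g ` Y)" by (rule I_image[OF Aut_empty[OF g(1)] _ XC YC dC])
    then show ?thesis unfolding d(2) gX .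
  qed
  obtain V where V: "model V" "Z \<union> Y \<subseteq> V"
    by (rule ex_model[of "Z \<union> Y"]) (use ZC YC bd_Un[OF model_bd[OF Z] model_bd[OF Y(1)]] in auto)
  have bYV: "set b \<union> Y \<subseteq> V" using bZ V(2) by blast
  have bYC: "set b \<union> Y \<subseteq> CC" using ab(2) YC by blast
  obtain c where c: "set c \<subseteq> CC" "Lt (set b \<union> Y) c a" "U c V = rk a (set b \<union> Y)"
    using rk_ext[OF bYV V(1) ab(1)] by blast
  have tc: "wt (set b \<union> Y) c a" using Lt_wt[OF c(2) bYC c(1)] .
  \<comment> \<open>The rank of \<open>c\<close> over \<open>Z\<close> is at most that over
    \<open>b\<close> and \<open>X\<close>, which by \<open>r\<close> is its rank over
    \<open>V\<close>; so nothing is lost between \<open>Z\<close> and \<open>V\<close>.\<close>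
  have "U c Z \<le> rk c (set b \<union> X)" by (rule U_le_rk[OF Z]) (use bZ XZ in blast)
  also have "\<dots> = rk a (set b \<union> X)"
    by (rule rk_cong[OF wt_mono[OF tc] _ c(1)]) (use Y(2) bYC in auto)
  also have "\<dots> = U c V" using c(3) r by simp
  finally have "I c Z V" using U_free_conv[OF Z V(1) _ c(1)] V(2) by blast
  then have IcY: "I c Z Y" by (rule I_mono) (use V(2) in auto)
  have "I (c @ b) X Y"
  proof (rule I_finite_char[OF X YC])
    show cb: "set (c @ b) \<subseteq> CC" using c(1) ab(2) by simp
    fix y assume y: "set y \<subseteq> Y"
    have yC: "set y \<subseteq> CC" using y YC by blast
    have 1: "I y X Z" by (rule sym_set[OF X ZC YC IZ y])
    have "I c Z (set y)" by (rule I_mono[OF IcY]) (use y in auto)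
    then have "I y Z (set c)" using I_sym[OF Z yC c(1)] by blast
    then have "I y Z (Z \<union> set c)" by (rule I_mono) auto
    moreover have "Z \<union> set c \<subseteq> CC" using ZC c(1) by blast
    ultimately have "I y X (Z \<union> set c)" using I_trans[OF Z XZ _ yC 1] by blast
    then have "I y X (set (c @ b))" by (rule I_mono) (use bZ in auto)
    then show "I (c @ b) X (set y)" using I_sym[OF X cb yC] by blast
  qed
  moreover have "wt Y (c @ b) (a @ b)" using tc wt_Un by (metis sup_commute)
  ultimately show ?thesis using I_cong[of "c @ b" X Y "a @ b"] c(1) ab(2) YC XY by simp
qed

text \<open>A dependent extension for \<open>b\<close> is one for the pair. At each step
  \<open>a\<close> is replaced by an element of the same type over \<open>b\<close> and
  \<open>X\<close> that keeps its rank over the extension; for \<open>m = 0\<close> that rank is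
  read off over a model around \<open>b\<close>.\<close>

lemma U_append_ge:
  "model X \<Longrightarrow> set a \<subseteq> CC \<Longrightarrow> set b \<subseteq> CC \<Longrightarrow> enat m \<le> U b X \<Longrightarrow> enat k \<le> rk a (set b \<union> X) \<Longrightarrow>
   enat (m + k) \<le> U (a @ b) X"
proof (induction m arbitrary: X a)
  case (0 X a)
  note X = 0(1) and a = 0(2) and b = 0(3) and XC = model_carr[OF 0(1)]
  obtain Z where Z: "model Z" "set b \<union> X \<subseteq> Z"
    by (rule ex_model[of "set b \<union> X"]) (use XC b bd_Un[OF bd_finite model_bd[OF X]] in auto)
  obtain c where c: "set c \<subseteq> CC" "Lt (set b \<union> X) c a" "U c Z = rk a (set b \<union> X)"
    using rk_ext[OF Z(2,1) a] by blast
  have "wt (set b \<union> X) c a" by (rule Lt_wt[OF c(2) _ c(1)]) (use b XC in auto)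
  then have t: "wt X (c @ b) (a @ b)" using wt_Un by (metis sup_commute)
  have "enat k \<le> U c Z" using 0(5) c(3) by simp
  also have "\<dots> \<le> U (c @ b) Z" by (rule U_subset) auto
  also have "\<dots> \<le> U (c @ b) X" by (rule U_mono) (use Z(2) in blast)
  also have "\<dots> = U (a @ b) X" using U_cong[OF X t] c(1) b by simp
  finally show ?case by simp
next
  case (Suc m X a)
  note X = Suc.prems(1) and a = Suc.prems(2) and b = Suc.prems(3) and XC = model_carr[OF Suc.prems(1)]
  obtain Y where Y: "model Y" "X \<subseteq> Y" "\<not> I b X Y" "U_ge M b m Y"
    using Suc.prems(4) unfolding U_iff by auto
  note YC = model_carr[OF Y(1)]
  obtain Z where Z: "model Z" "set b \<union> Y \<subseteq> Z"
    by (rule ex_model[of "set b \<union> Y"]) (use YC b bd_Un[OF bd_finite model_bd[OF Y(1)]] in auto)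
  have bX: "set b \<union> X \<subseteq> Z" using Z(2) Y(2) by blast
  obtain c where c: "set c \<subseteq> CC" "Lt (set b \<union> X) c a" "U c Z = rk a (set b \<union> X)"
    using rk_ext[OF bX Z(1) a] by blast
  have "wt (set b \<union> X) c a" by (rule Lt_wt[OF c(2) _ c(1)]) (use b XC in auto)
  then have t: "wt X (c @ b) (a @ b)" using wt_Un by (metis sup_commute)
  have cb: "set (c @ b) \<subseteq> CC" using c(1) b by simp
  have "enat k \<le> U c Z" using Suc.prems(5) c(3) by simp
  also have "\<dots> \<le> rk c (set b \<union> Y)" by (rule U_le_rk[OF Z])
  finally have "enat (m + k) \<le> U (c @ b) Y"
    using Suc.IH[OF Y(1) c(1) b] Y(4) unfolding U_iff by blast
  moreover have "\<not> I (c @ b) X Y" using I_subset[of "c @ b" X Y b] Y(3) by auto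
  ultimately have "U_ge M (c @ b) (Suc (m + k)) X" using Y(1,2) unfolding U_iff by auto
  then have "U_ge M (a @ b) (Suc (m + k)) X" using U_ge_cong[OF X t cb] by blast
  then show ?case unfolding U_iff by simp
qed

text \<open>By \<open>free_pair\<close> each dependent extension of the pair strictly lowers one
  summand, and both are finite.\<close>

lemma U_append_le:
  "model X \<Longrightarrow> set a \<subseteq> CC \<Longrightarrow> set b \<subseteq> CC \<Longrightarrow> U_ge M (a @ b) n X \<Longrightarrow>
   enat n \<le> rk a (set b \<union> X) + U b X"
proof (induction n arbitrary: X)
  case 0
  then show ?case by (simp flip: zero_enat_def)
next
  case (Suc n X)
  note X = Suc.prems(1) and a = Suc.prems(2) and b = Suc.prems(3)
  obtain Y where Y: "model Y" "X \<subseteq> Y" "\<not> I (a @ b) X Y" "U_ge M (a @ b) n Y"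
    using Suc.prems(4) by auto
  have IH: "enat n \<le> rk a (set b \<union> Y) + U b Y" using Suc.IH[OF Y(1) a b Y(4)] .
  obtain p p' where p: "rk a (set b \<union> X) = enat p" "rk a (set b \<union> Y) = enat p'"
    using rk_finite[OF a] by metis
  obtain q q' where q: "U b X = enat q" "U b Y = enat q'"
    using rk_finite[OF b] rk_model[OF X b] rk_model[OF Y(1) b] by metis
  have le: "p' \<le> p" "q' \<le> q"
    using rk_mono[of "set b \<union> X" "set b \<union> Y" a] U_mono[OF Y(2), of b] Y(2) p q by auto
  have "p' \<noteq> p \<or> q' \<noteq> q"
  proof (rule ccontr)
    assume "\<not> ?thesis"
    then have e: "p' = p" "q' = q" by auto
    have "I b X Y" using U_free_conv[OF X Y(1,2) b] q e by simp
    then have "I (a @ b) X Y" using free_pair[OF X Y(1,2) a b] p e by simp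
    then show False using Y(3) by blast
  qed
  then have "Suc n \<le> p + q" using le IH p q by auto
  then show ?case using p q by simp
qed

lemma U_append:
  assumes X: "model X" and ab: "set a \<subseteq> CC" "set b \<subseteq> CC"
  shows "U (a @ b) X = rk a (set b \<union> X) + U b X"
proof (rule antisym)
  show "U (a @ b) X \<le> rk a (set b \<union> X) + U b X"
    by (rule enat_leI) (use U_append_le[OF X ab] U_iff in blast)
  obtain p where p: "rk a (set b \<union> X) = enat p" using rk_finite[OF ab(1)] by metis
  obtain q where q: "U b X = enat q" using rk_finite[OF ab(2)] rk_model[OF X ab(2)] by metis
  show "rk a (set b \<union> X) + U b X \<le> U (a @ b) X"
    using U_append_ge[OF X ab, of q p] p q by (simp add: add.commute)
qed

lemma UF_image_le:
  assumes f: "f \<in> Aut M {}" and a: "set a \<subseteq> CC"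
  shows "UF a A \<le> UF (map f a) (f ` A)"
proof (rule UF_least)
  fix X assume X: "model X" "A \<subseteq> X"
  have "U a X \<le> U (map f a) (f ` X)" by (rule U_image_le[OF f model_carr[OF X(1)] a])
  also have "\<dots> \<le> UF (map f a) (f ` A)" by (rule UF_upper[OF model_image[OF f X(1)]]) (use X(2) in blast)
  finally show "U a X \<le> UF (map f a) (f ` A)" .
qed

text \<open>A weak type over an infinite set gives no single automorphism, but the rank is an
  infimum over finite sets, each using only a finite part of \<open>A\<close>.\<close>

lemma rk_pair_le:
  assumes t: "wt A (a @ b) (c @ d)" "length a = length c" and ab: "set a \<subseteq> CC" "set b \<subseteq> CC"
  shows "rk a (set b \<union> A) \<le> rk c (set d \<union> A)"
proof (rule rk_greatest)
  fix B assume B: "finite B" "B \<subseteq> set d \<union> A"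
  let ?F = "B \<inter> A"
  have "gt ?F (a @ b) (c @ d)" by (rule wtD[OF t(1)]) (use B in auto)
  then obtain f where f: "f \<in> Aut M ?F" "map f a = c" "map f b = d" using gt_app t(2) by blast
  have "rk a (set b \<union> A) \<le> UF a (set b \<union> ?F)" by (rule rk_lower) (use B in auto)
  also have "\<dots> \<le> UF (map f a) (f ` (set b \<union> ?F))" by (rule UF_image_le[OF Aut_empty[OF f(1)] ab(1)])
  also have "f ` (set b \<union> ?F) = set d \<union> ?F"
    unfolding image_Un Aut_image_fix[OF f(1)] using f(3) by auto
  also have "UF (map f a) (set d \<union> ?F) \<le> UF c B" unfolding f(2) by (rule UF_mono) (use B in blast)
  finally show "rk a (set b \<union> A) \<le> UF c B" .
qed

lemma rk_pair:
  assumes t: "wt A (a @ b) (c @ d)" "length a = length c" and ab: "set a \<subseteq> CC" "set b \<subseteq> CC"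
  shows "rk a (set b \<union> A) = rk c (set d \<union> A)"
proof (rule antisym[OF rk_pair_le[OF t ab]])
  have C: "set (c @ d) \<subseteq> CC" by (rule wt_carr[OF t(1)]) (use ab in auto)
  have "wt A (c @ d) (a @ b)" by (rule wt_sym[OF t(1)]) (use ab in auto)
  then show "rk c (set d \<union> A) \<le> rk a (set b \<union> A)" by (rule rk_pair_le) (use t(2) C in auto)
qed

text \<open>Additivity is known over models, so both ranks have to be realised over one model
  \<open>X\<close>: \<open>b\<close> is moved to \<open>b'\<close> of full rank over
  \<open>X\<close>, and \<open>a\<close> to an element of full rank over a model around
  \<open>X\<close> and \<open>b'\<close>.\<close>

lemma rk_append_ge:
  assumes A: "finite A" "A \<subseteq> CC" and a: "set a \<subseteq> CC" and b: "set b \<subseteq> CC"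
  shows "rk a (set b \<union> A) + rk b A \<le> UF (a @ b) A"
proof -
  obtain X where X: "model X" "A \<subseteq> X" using ex_model[OF A(2) bd_finite[OF A(1)]] .
  obtain b' where b': "set b' \<subseteq> CC" "Lt A b' b" "U b' X = rk b A" using rk_ext[OF X(2,1) b] by blast
  have "gt A b' b" using Lt_wt[OF b'(2) A(2) b'(1)] wt_fin[OF A(1)] by blast
  then have "gt A b b'" using gt_sym b'(1) by blast
  then obtain f where f: "f \<in> Aut M A" "map f b = b'" by (rule gtE)
  let ?c = "map f a"
  have cC: "set ?c \<subseteq> CC" by (rule map_carr[OF f(1) a])
  have g1: "gt A (a @ b) (?c @ b')" by (rule gtI[OF f(1)]) (use f(2) in simp)
  obtain Z where Z: "model Z" "X \<union> set b' \<subseteq> Z"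
    by (rule ex_model[of "X \<union> set b'"])
      (use model_carr[OF X(1)] b'(1) bd_Un[OF model_bd[OF X(1)] bd_finite] in auto)
  have AZ: "set b' \<union> A \<subseteq> Z" using X(2) Z(2) by blast
  obtain d where d: "set d \<subseteq> CC" "Lt (set b' \<union> A) d ?c" "U d Z = rk ?c (set b' \<union> A)"
    using rk_ext[OF AZ Z(1) cC] by blast
  have "wt (set b' \<union> A) d ?c" by (rule Lt_wt[OF d(2) _ d(1)]) (use b'(1) A(2) in auto)
  then have "wt A (d @ b') (?c @ b')" using wt_Un by (metis sup_commute)
  then have "gt A (d @ b') (?c @ b')" using wt_fin[OF A(1)] by blast
  moreover have "gt A (?c @ b') (a @ b)" by (rule gt_sym[OF g1]) (use a b in auto)
  ultimately have g2: "gt A (d @ b') (a @ b)" using gt_trans by blast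
  have "rk a (set b \<union> A) = rk ?c (set b' \<union> A)" by (rule rk_pair[OF wt_gt[OF g1] _ a b]) simp
  also have "\<dots> = U d Z" using d(3) by simp
  also have "\<dots> \<le> rk d (set b' \<union> X)" by (rule U_le_rk[OF Z(1)]) (use Z(2) in blast)
  finally have "rk a (set b \<union> A) + rk b A \<le> rk d (set b' \<union> X) + U b' X"
    unfolding b'(3) by (rule add_right_mono)
  also have "\<dots> = U (d @ b') X" using U_append[OF X(1) d(1) b'(1)] by simp
  also have "\<dots> \<le> UF (d @ b') A" by (rule UF_upper[OF X])
  also have "\<dots> = UF (a @ b) A" by (rule UF_cong[OF g2 A(2)]) (use d(1) b'(1) in auto)
  finally show ?thesis .
qed

text \<open>The upper bound comes from a realisation of full rank over a model, the lower bound from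
  a finite subset attaining the rank of the pair.\<close>

lemma rk_append:
  assumes A: "A \<subseteq> CC" "bounded_set M A" and a: "set a \<subseteq> CC" and b: "set b \<subseteq> CC"
  shows "rk (a @ b) A = rk a (set b \<union> A) + rk b A"
proof (rule antisym)
  obtain X where X: "model X" "A \<subseteq> X" using ex_model[OF A] .
  have abC: "set (a @ b) \<subseteq> CC" using a b by simp
  obtain c where c: "set c \<subseteq> CC" "Lt A c (a @ b)" "U c X = rk (a @ b) A"
    using rk_ext[OF X(2,1) abC] by blast
  have t: "wt A c (a @ b)" using Lt_wt[OF c(2) A(1) c(1)] .
  define a' b' where "a' = take (length a) c" and "b' = drop (length a) c"
  have "length c = length a + length b" using wt_length[OF t] by simp
  then have c': "c = a' @ b'" "length a' = length a" by (simp_all add: a'_def b'_def)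
  have C: "set a' \<subseteq> CC" "set b' \<subseteq> CC" using c(1) c'(1) by auto
  have t': "wt A (a' @ b') (a @ b)" using t c'(1) by simp
  have "rk (a @ b) A = rk a' (set b' \<union> X) + U b' X" using c(3) U_append[OF X(1) C] c'(1) by simp
  also have "\<dots> \<le> rk a' (set b' \<union> A) + rk b' A"
    by (intro add_mono rk_mono U_le_rk[OF X]) (use X(2) in blast)
  also have "rk a' (set b' \<union> A) = rk a (set b \<union> A)" by (rule rk_pair[OF t' c'(2) C])
  also have "rk b' A = rk b A" by (rule rk_cong[OF wt_app2[OF t' c'(2)] A(1) C(2)])
  finally show "rk (a @ b) A \<le> rk a (set b \<union> A) + rk b A" .
next
  obtain B where B: "finite B" "B \<subseteq> A" "rk (a @ b) A = UF (a @ b) B" using rk_attained by blast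
  have "rk a (set b \<union> A) + rk b A \<le> rk a (set b \<union> B) + rk b B"
    by (intro add_mono rk_mono) (use B(2) in auto)
  also have "\<dots> \<le> UF (a @ b) B" by (rule rk_append_ge[OF B(1) _ a b]) (use B(2) A(1) in blast)
  finally show "rk a (set b \<union> A) + rk b A \<le> rk (a @ b) A" using B(3) by simp
qed

text \<open>Both orders of the pair have the same rank, and finite ranks cancel in the two
  expansions.\<close>

lemma rk_symmetry:
  assumes A: "A \<subseteq> CC" "bounded_set M A" and ab: "set a \<subseteq> CC" "set b \<subseteq> CC"
    and r: "rk a (A \<union> set b) = rk a A"
  shows "rk b (A \<union> set a) = rk b A"
proof -
  have "rk (a @ b) A = rk (b @ a) A" by (intro antisym rk_subset) auto
  then have "rk a A + rk b A = rk b (set a \<union> A) + rk a A"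
    using rk_append[OF A ab] rk_append[OF A ab(2,1)] r by (simp add: sup_commute)
  moreover obtain p q s where "rk a A = enat p" "rk b A = enat q" "rk b (set a \<union> A) = enat s"
    using rk_finite[OF ab(1)] rk_finite[OF ab(2)] by metis
  ultimately show ?thesis by (simp add: sup_commute)
qed

section \<open>Bounded closure\<close>

lemma bcl_mono:
  assumes "A \<subseteq> B" shows "bcl M A \<subseteq> bcl M B"
proof
  fix x assume x: "x \<in> bcl M A"
  have "{y \<in> CC. wt B [y] [x]} \<subseteq> {y \<in> CC. wt A [y] [x]}" using wt_mono assms by blast
  then show "x \<in> bcl M B" using x bd_subset unfolding bcl_def by blast
qed

lemma bcl_carr: "bcl M A \<subseteq> CC"
  by (auto simp: bcl_def)

lemma subset_bcl:
  assumes "A \<subseteq> CC" shows "A \<subseteq> bcl M A"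
proof
  fix x assume x: "x \<in> A"
  have "y = x" if y: "y \<in> CC" "wt A [y] [x]" for y
  proof -
    have "gt {x} [y] [x]" by (rule wtD[OF y(2)]) (use x in auto)
    then obtain f where f: "f \<in> Aut M {x}" "map f [y] = [x]" by (rule gtE)
    then have "f y = f x" using Aut_fix[OF f(1), of x] by simp
    then show ?thesis using Aut_inj[OF f(1) y(1), of x] x assms by blast
  qed
  then have "{y \<in> CC. wt A [y] [x]} \<subseteq> {x}" by blast
  then have "bounded_set M {y \<in> CC. wt A [y] [x]}" using bd_finite finite_subset by blast
  then show "x \<in> bcl M A" using x assms unfolding bcl_def by blast
qed

text \<open>A type with boundedly many realisations has one independent from all of them, itself
  included, so it lies in \<open>X\<close>; an element of \<open>X\<close> is the only realisation
  of its type over \<open>X\<close>.\<close>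

lemma bcl_model:
  assumes X: "model X" shows "bcl M X = X"
proof
  note XC = model_carr[OF X]
  show "X \<subseteq> bcl M X" using subset_bcl[OF XC] .
  show "bcl M X \<subseteq> X"
  proof
    fix x assume x: "x \<in> bcl M X"
    let ?S = "{y \<in> CC. wt X [y] [x]}"
    have S: "bounded_set M ?S" "x \<in> CC" using x unfolding bcl_def by auto
    obtain y where y: "wt X y [x]" "I y X ?S" "set y \<subseteq> CC"
      using I_ext[OF X _ S(1), of "[x]"] S(2) by auto
    obtain z where z: "y = [z]" using wt_length[OF y(1)] by (cases y) auto
    have "z \<in> ?S" using y z by auto
    then have "I y X (set y)" using I_mono[OF y(2) order_refl, of "set y"] z by auto
    then have "set y \<subseteq> X" using I_self[OF X y(3)] by blast
    then have zX: "z \<in> X" using z by simp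
    have "gt {z} [z] [x]" by (rule wtD[OF y(1)[unfolded z]]) (use zX in auto)
    then obtain f where "f \<in> Aut M {z}" "map f [z] = [x]" by (rule gtE)
    then have "z = x" using Aut_fix[of f "{z}" z] by simp
    then show "x \<in> X" using zX by simp
  qed
qed

lemma U_model_0:
  assumes "set a \<subseteq> X" shows "U a X = 0"
proof -
  have "I a X Y" for Y
  proof -
    have "\<not> splits M a (X \<union> Y) (set a)"
    proof (rule not_splitsI)
      fix b c assume "gt (set a) b c"
      then obtain f where f: "f \<in> Aut M (set a)" "map f b = c" by (rule gtE)
      have "map f a = a" using Aut_fix[OF f(1)] by (intro map_idI) blast
      then show "gt (set a) (a @ b) (a @ c)" using f by (intro gtI[of f]) auto
    qed simp
    then show ?thesis using assms unfolding I_iff by blast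
  qed
  then have "\<not> U_ge M a (Suc 0) X" by simp
  then have "\<not> enat (Suc 0) \<le> U a X" using U_iff by blast
  then show ?thesis by (cases "U a X") (auto simp: zero_enat_def)
qed

lemma U_0_subset:
  assumes X: "model X" and a: "set a \<subseteq> CC" and U: "U a X = 0"
  shows "set a \<subseteq> X"
proof -
  obtain Z where Z: "model Z" "X \<union> set a \<subseteq> Z"
    by (rule ex_model[of "X \<union> set a"])
      (use model_carr[OF X] a bd_Un[OF model_bd[OF X] bd_finite] in auto)
  have "I a X Z" by (rule U_free_conv[OF X Z(1) _ a]) (use Z(2) U in auto)
  then have "I a X (set a)" by (rule I_mono) (use Z(2) in auto)
  then show ?thesis using I_self[OF X a] by blast
qed

text \<open>All conjugates of \<open>a\<close> over \<open>A0\<close> have rank 0 over a model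
  \<open>X\<close> containing \<open>A0\<close>, so they lie in \<open>X\<close>, which is
  bounded.\<close>

lemma rk_0_bcl:
  assumes A: "A \<subseteq> CC" and a: "set a \<subseteq> CC" and r: "rk a A = 0"
  shows "\<exists>A0. finite A0 \<and> A0 \<subseteq> A \<and> set a \<subseteq> bcl M A0"
proof -
  obtain A0 where A0: "finite A0" "A0 \<subseteq> A" "UF a A0 = 0" using rk_attained[of A a] r by auto
  have A0C: "A0 \<subseteq> CC" using A0(2) A by blast
  obtain X where X: "model X" "A0 \<subseteq> X" using ex_model[OF A0C bd_finite[OF A0(1)]] .
  have "x \<in> bcl M A0" if x: "x \<in> set a" for x
  proof -
    have xC: "x \<in> CC" using x a by blast
    have "{y \<in> CC. wt A0 [y] [x]} \<subseteq> X"
    proof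
      fix y assume y: "y \<in> {y \<in> CC. wt A0 [y] [x]}"
      then have "gt A0 [y] [x]" using wt_fin[OF A0(1)] by blast
      then have "gt A0 [x] [y]" using gt_sym[of A0 "[y]" "[x]"] y by auto
      then obtain f where f: "f \<in> Aut M A0" "map f [x] = [y]" by (rule gtE)
      have fa: "set (map f a) \<subseteq> CC" by (rule map_carr[OF f(1) a])
      have "U (map f a) X \<le> UF (map f a) A0" by (rule UF_upper[OF X])
      also have "\<dots> = UF a A0" using UF_cong[OF gtI[OF f(1) refl] A0C a] by simp
      finally have "U (map f a) X = 0" using A0(3) by simp
      then have "set (map f a) \<subseteq> X" by (rule U_0_subset[OF X(1) fa])
      then show "y \<in> X" using f(2) x by auto
    qed
    then have "bounded_set M {y \<in> CC. wt A0 [y] [x]}" using bd_subset model_bd[OF X(1)] by blast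
    then show ?thesis using xC unfolding bcl_def by blast
  qed
  then show ?thesis using A0 by blast
qed

text \<open>A realisation of full rank over a model \<open>X\<close> around \<open>A\<close> has its
  entries in \<open>bcl M A\<close>, which is contained in \<open>X\<close>, so that full rank is
  0.\<close>

lemma bcl_rk_0:
  assumes A: "A \<subseteq> CC" "bounded_set M A" and a: "set a \<subseteq> bcl M A"
  shows "rk a A = 0"
proof -
  obtain X where X: "model X" "A \<subseteq> X" using ex_model[OF A] .
  have aC: "set a \<subseteq> CC" using a bcl_carr by blast
  obtain b where b: "set b \<subseteq> CC" "Lt A b a" "U b X = rk a A" using rk_ext[OF X(2,1) aC] by blast
  have t: "wt A b a" using Lt_wt[OF b(2) A(1) b(1)] .
  have "y \<in> X" if y: "y \<in> set b" for y
  proof -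
    obtain i where i: "i < length b" "b ! i = y" using y by (metis in_set_conv_nth)
    have l: "length b = length a" using wt_length[OF t] .
    have yx: "wt A [y] [a ! i]"
    proof (rule wtI)
      fix B assume "finite B" "B \<subseteq> A"
      then obtain f where f: "f \<in> Aut M B" "map f b = a" using wtD[OF t] gtE by metis
      then have "f y = a ! i" using i by auto
      then show "gt B [y] [a ! i]" using f(1) by (intro gtI[of f]) auto
    qed
    have "a ! i \<in> bcl M A" using a i(1) l by auto
    then have "bounded_set M {z \<in> CC. wt A [z] [a ! i]}" unfolding bcl_def by blast
    moreover have "{z \<in> CC. wt A [z] [y]} \<subseteq> {z \<in> CC. wt A [z] [a ! i]}" using yx wt_trans by blast
    ultimately have "y \<in> bcl M A" using bd_subset y b(1) unfolding bcl_def by blast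
    then show ?thesis using bcl_mono[OF X(2)] bcl_model[OF X(1)] by blast
  qed
  then have "U b X = 0" by (intro U_model_0) blast
  then show ?thesis using b(3) by simp
qed

text \<open>An element of the closure of \<open>bcl M A\<close> has rank 0 over a finite
  \<open>c\<close> in \<open>bcl M A\<close>, and \<open>c\<close> has rank 0 over \<open>A\<close>;
  additivity does the rest.\<close>

lemma bcl_bcl:
  assumes A: "A \<subseteq> CC" "bounded_set M A"
  shows "bcl M (bcl M A) = bcl M A"
proof
  obtain X where X: "model X" "A \<subseteq> X" using ex_model[OF A] .
  have "bcl M A \<subseteq> X" using bcl_mono[OF X(2)] bcl_model[OF X(1)] by blast
  then have b: "bounded_set M (bcl M A)" using bd_subset model_bd[OF X(1)] by blast
  show "bcl M (bcl M A) \<subseteq> bcl M A"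
  proof
    fix x assume x: "x \<in> bcl M (bcl M A)"
    then have xC: "set [x] \<subseteq> CC" using bcl_carr by auto
    have "rk [x] (bcl M A) = 0" by (rule bcl_rk_0[OF bcl_carr b]) (use x in simp)
    then obtain C where C: "finite C" "C \<subseteq> bcl M A" "set [x] \<subseteq> bcl M C"
      using rk_0_bcl[OF bcl_carr xC] by blast
    obtain c where c: "set c = C" using finite_list[OF C(1)] by blast
    have cC: "set c \<subseteq> CC" using c C(2) bcl_carr by blast
    have "rk [x] (set c) = 0"
      by (rule bcl_rk_0[OF cC bd_finite]) (use C(3) c in auto)
    moreover have "rk [x] (set c \<union> A) \<le> rk [x] (set c)" by (rule rk_mono) blast
    moreover have "rk c A = 0" by (rule bcl_rk_0[OF A]) (use c C(2) in blast)
    ultimately have "rk ([x] @ c) A = 0" using rk_append[OF A xC cC] by simp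
    moreover have "rk [x] A \<le> rk ([x] @ c) A" by (rule rk_subset) auto
    ultimately have "rk [x] A = 0" by simp
    then obtain A0 where "A0 \<subseteq> A" "set [x] \<subseteq> bcl M A0" using rk_0_bcl[OF A(1) xC] by blast
    then show "x \<in> bcl M A" using bcl_mono by auto
  qed
  show "bcl M A \<subseteq> bcl M (bcl M A)" by (rule subset_bcl[OF bcl_carr])
qed

text \<open>The two ranks over \<open>A\<close> may be attained at different finite sets. On their
  union both are attained, and there \<open>generic_unique\<close> applies to realisations of full
  rank over a model.\<close>

lemma stationarity:
  assumes A: "A \<subseteq> B" "B \<subseteq> CC" "bounded_set M B" and ab: "set a \<subseteq> CC" "set b \<subseteq> CC"
    and L: "Lt A a b" and r: "rk a B = rk a A" "rk b B = rk b A"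
  shows "Lt B a b"
proof -
  obtain X where X: "model X" "B \<subseteq> X" using ex_model[OF A(2,3)] .
  obtain F G where F: "finite F" "F \<subseteq> A" "rk a A = UF a F" and G: "finite G" "G \<subseteq> A" "rk b A = UF b G"
    using rk_attained by metis
  let ?E = "F \<union> G"
  have E: "finite ?E" "?E \<subseteq> A" "?E \<subseteq> X" "?E \<subseteq> CC" using F G A X by auto
  have UE: "UF a ?E = rk a A" "UF b ?E = rk b A"
    using UF_mono[of F ?E a] UF_mono[of G ?E b] rk_lower[OF E(1,2), of a] rk_lower[OF E(1,2), of b] F(3) G(3)
    by auto
  obtain a' where a': "set a' \<subseteq> CC" "Lt B a' a" "U a' X = rk a B" using rk_ext[OF X(2,1) ab(1)] by blast
  obtain b' where b': "set b' \<subseteq> CC" "Lt B b' b" "U b' X = rk b B" using rk_ext[OF X(2,1) ab(2)] by blast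
  have EB: "?E \<subseteq> B" using E(2) A(1) by blast
  have "Lt ?E a' b'"
    using Lt_trans[OF Lt_mono[OF a'(2) EB] Lt_trans[OF Lt_mono[OF L E(2)] Lt_sym[OF Lt_mono[OF b'(2) EB]]]] .
  moreover have "U a' X = UF a' ?E"
    using a'(3) r UE Lt_UF[OF E(1,4) a'(1) Lt_mono[OF a'(2) EB]] by simp
  moreover have "U b' X = UF b' ?E"
    using b'(3) r UE Lt_UF[OF E(1,4) b'(1) Lt_mono[OF b'(2) EB]] by simp
  ultimately have "wt X a' b'" using generic_unique[OF E(1,3) X(1) a'(1) _ b'(1)] by blast
  then have "Lt B a' b'" by (rule wt_Lt[OF X(1) _ a'(1) X(2)])
  then show ?thesis using Lt_trans Lt_sym a'(2) b'(2) by blast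
qed

end

theorem theorem2p70:
  fixes M :: "('f, 'r, 'a) aec_monster"
    and A B C D :: "'a set"
  assumes fur: "FUR_class M"
    and monster: "monster_model M"
    and chain: "A \<subseteq> B" "B \<subseteq> C" "C \<subseteq> D" "D \<subseteq> univ (monster M)"
    and bounded: "bounded_set M D"
  shows
    \<comment> \<open>(i) local character\<close>
    "(\<forall>a. set a \<subseteq> univ (monster M) \<longrightarrow>
        (\<exists>A0. finite A0 \<and> A0 \<subseteq> A \<and> indep M a A0 A)) \<and>
    \<comment> \<open>(ii) finite character\<close>
     (\<forall>a. set a \<subseteq> univ (monster M) \<and> \<not> indep M a A B \<longrightarrow>
        (\<exists>b. set b \<subseteq> B \<and> \<not> indep M a A (set b))) \<and>
    \<comment> \<open>(iii) stationarity\<close>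
     (\<forall>a b. set a \<subseteq> univ (monster M) \<and> set b \<subseteq> univ (monster M) \<and>
        Lt_eq M A a b \<and> indep M a A B \<and> indep M b A B \<longrightarrow> Lt_eq M B a b) \<and>
    \<comment> \<open>(iv) extension\<close>
     (\<forall>a. set a \<subseteq> univ (monster M) \<longrightarrow>
        (\<exists>b. set b \<subseteq> univ (monster M) \<and> Lt_eq M A b a \<and> indep M b A B)) \<and>
    \<comment> \<open>(v) monotonicity\<close>
     (\<forall>a. set a \<subseteq> univ (monster M) \<and> indep M a A D \<longrightarrow> indep M a B C) \<and>
    \<comment> \<open>(vi) transitivity\<close>
     (\<forall>a. set a \<subseteq> univ (monster M) \<and> indep M a A B \<and> indep M a B C \<longrightarrow> indep M a A C) \<and>
    \<comment> \<open>(vii) symmetry\<close>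
     (\<forall>a b. set a \<subseteq> univ (monster M) \<and> set b \<subseteq> univ (monster M) \<and>
        indep M a A (set b) \<longrightarrow> indep M b A (set a)) \<and>
    \<comment> \<open>(viii) U-ranks\<close>
     (\<forall>a. set a \<subseteq> univ (monster M) \<longrightarrow>
        (indep M a A B \<longleftrightarrow> U_rank M a B = U_rank M a A)) \<and>
    \<comment> \<open>(ix) finiteness of U-rank\<close>
     (\<forall>a. set a \<subseteq> univ (monster M) \<longrightarrow> U_rank M a {} < \<infinity>) \<and>
    \<comment> \<open>(x) addition of ranks\<close>
     (\<forall>a b. set a \<subseteq> univ (monster M) \<and> set b \<subseteq> univ (monster M) \<longrightarrow>
        U_rank M (a @ b) A = U_rank M a (set b \<union> A) + U_rank M b A) \<and>
    \<comment> \<open>(xi) independence of bcl\<close>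
     (\<forall>a. set a \<subseteq> bcl M A \<longrightarrow> indep M a A B) \<and>
    \<comment> \<open>(xii) reflexivity\<close>
     (\<forall>a. set a \<subseteq> bcl M B \<and> \<not> set a \<subseteq> bcl M A \<longrightarrow> \<not> indep M a A B) \<and>
    \<comment> \<open>(xiii) local character of bcl\<close>
     (\<forall>a. set a \<subseteq> bcl M A \<longrightarrow> (\<exists>A0. finite A0 \<and> A0 \<subseteq> A \<and> set a \<subseteq> bcl M A0)) \<and>
    \<comment> \<open>(xiv) closure\<close>
     bcl M (bcl M A) = bcl M A \<and>
    \<comment> \<open>(xv) models are closed\<close>
     (\<forall>X. is_model M X \<longrightarrow> bcl M X = X)"
proof -
  interpret fur M by unfold_locales (rule fur, rule monster)
  have C: "A \<subseteq> CC" "B \<subseteq> CC" "C \<subseteq> CC" using chain by auto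
  have bds: "bounded_set M A" "bounded_set M B" "bounded_set M C"
    by (rule bd_subset[OF _ bounded]; use chain in blast)+
  \<comment> \<open>Independence becomes an equation of ranks, and most clauses turn into statements
    about \<open>rk\<close>.\<close>
  have ind: "indep M a P Q \<longleftrightarrow> rk a (P \<union> Q) = rk a P"
    if "set a \<subseteq> CC" "P \<subseteq> D" "Q \<subseteq> D" for a P Q
    by (rule indep_iff[OF _ bd_subset[OF _ bounded] that(1)]) (use that chain in auto)
  have AB: "A \<union> B = B" "B \<union> C = C" "A \<union> C = C" "A \<union> D = D" "A \<subseteq> D" "B \<subseteq> D" using chain by auto
  have iAB: "indep M a A B \<longleftrightarrow> rk a B = rk a A" if "set a \<subseteq> CC" for a
    using ind[OF that AB(5,6)] AB(1) by simp
  have iBC: "indep M a B C \<longleftrightarrow> rk a C = rk a B" if "set a \<subseteq> CC" for a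
    using ind[OF that AB(6) chain(3)] AB(2) by simp
  have iAC: "indep M a A C \<longleftrightarrow> rk a C = rk a A" if "set a \<subseteq> CC" for a
    using ind[OF that AB(5) chain(3)] AB(3) by simp
  have iAD: "indep M a A D \<longleftrightarrow> rk a D = rk a A" if "set a \<subseteq> CC" for a
    using ind[OF that AB(5) order_refl] AB(4) by simp
  have iAb: "indep M a A (set b) \<longleftrightarrow> rk a (A \<union> set b) = rk a A" if "set a \<subseteq> CC" "set b \<subseteq> CC" for a b
    by (rule indep_iff[OF _ bd_Un[OF bds(1) bd_finite] that(1)]) (use C(1) that(2) in auto)
  have i: "\<exists>A0. finite A0 \<and> A0 \<subseteq> A \<and> indep M a A0 A" if a: "set a \<subseteq> CC" for a
  proof -
    obtain A0 where A0: "finite A0" "A0 \<subseteq> A" "rk a A = UF a A0" using rk_attained by blast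
    have "A0 \<union> A = A" "A0 \<subseteq> D" using A0(2) AB(5) by auto
    then have "indep M a A0 A" using ind[OF a, of A0 A] AB(5) A0(3) rk_fin[OF A0(1)] by simp
    then show ?thesis using A0 by blast
  qed
  have ii: "\<exists>b. set b \<subseteq> B \<and> \<not> indep M a A (set b)" if a: "set a \<subseteq> CC" and n: "\<not> indep M a A B" for a
  proof -
    have "rk a B < rk a A" using n iAB[OF a] rk_mono[OF chain(1), of a] by auto
    \<comment> \<open>A finite subset of \<open>B\<close> attaining the rank over \<open>B\<close>
      already lowers the rank over \<open>A\<close>.\<close>
    obtain F where F: "finite F" "F \<subseteq> B" "rk a B = UF a F" using rk_attained by blast
    obtain b where b: "set b = F" using finite_list[OF F(1)] by blast
    have "rk a (A \<union> set b) \<le> UF a F" by (rule rk_lower[OF F(1)]) (use b in blast)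
    then have "rk a (A \<union> set b) \<noteq> rk a A" using \<open>rk a B < rk a A\<close> F(3) by auto
    then have "\<not> indep M a A (set b)" using iAb[OF a, of b] b F(2) C(2) by auto
    then show ?thesis using b F(2) by blast
  qed
  have iii: "Lt_eq M B a b"
    if "set a \<subseteq> CC" "set b \<subseteq> CC" "Lt_eq M A a b" "indep M a A B" "indep M b A B" for a b
    using stationarity[OF chain(1) C(2) bds(2) that(1-3)] that iAB by blast
  have iv: "\<exists>b. set b \<subseteq> CC \<and> Lt_eq M A b a \<and> indep M b A B" if a: "set a \<subseteq> CC" for a
  proof -
    obtain X where X: "is_model M X" "B \<subseteq> X" using ex_model[OF C(2) bds(2)] .
    have AX: "A \<subseteq> X" using X(2) chain(1) by blast
    obtain b where b: "set b \<subseteq> CC" "Lt_eq M A b a" "U_model M b X = rk a A"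
      using rk_ext[OF AX X(1) a] by blast
    have "rk b A = rk a A" using rk_cong[OF Lt_wt[OF b(2) C(1) b(1)] C(1) b(1)] .
    moreover have "U_model M b X \<le> rk b B" using U_le_rk[OF X] .
    ultimately have "rk b B = rk b A" using b(3) rk_mono[OF chain(1), of b] by auto
    then show ?thesis using b iAB by blast
  qed
  have v: "indep M a B C" if a: "set a \<subseteq> CC" and I: "indep M a A D" for a
    using I iAD[OF a] iBC[OF a] rk_mono[OF chain(1), of a] rk_mono[OF chain(2), of a]
      rk_mono[OF chain(3), of a] by auto
  have vi: "indep M a A C" if a: "set a \<subseteq> CC" and I: "indep M a A B" "indep M a B C" for a
    using I iAB[OF a] iBC[OF a] iAC[OF a] by simp
  have vii: "indep M b A (set a)" if a: "set a \<subseteq> CC" "set b \<subseteq> CC" and I: "indep M a A (set b)" for a b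
    using rk_symmetry[OF C(1) bds(1) a] I iAb[OF a] iAb[OF a(2,1)] by blast
  have viii: "indep M a A B \<longleftrightarrow> U_rank M a B = U_rank M a A" if a: "set a \<subseteq> CC" for a
    using iAB[OF a] U_rank_rk[OF a] by simp
  have ix: "U_rank M a {} < \<infinity>" if a: "set a \<subseteq> CC" for a
    using U_rank_rk[OF a, of "{}"] rk_finite[OF a, of "{}"] by auto
  have x: "U_rank M (a @ b) A = U_rank M a (set b \<union> A) + U_rank M b A"
    if a: "set a \<subseteq> CC" "set b \<subseteq> CC" for a b
    using rk_append[OF C(1) bds(1) a] U_rank_rk a by simp
  have bC: "set a \<subseteq> CC" if "set a \<subseteq> bcl M P" for a P using that bcl_carr by blast
  have xi: "indep M a A B" if a: "set a \<subseteq> bcl M A" for a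
    using iAB[OF bC[OF a]] bcl_rk_0[OF C(1) bds(1) a] rk_mono[OF chain(1), of a] by simp
  have xiii: "\<exists>A0. finite A0 \<and> A0 \<subseteq> A \<and> set a \<subseteq> bcl M A0" if a: "set a \<subseteq> bcl M A" for a
    using rk_0_bcl[OF C(1) bC[OF a] bcl_rk_0[OF C(1) bds(1) a]] .
  have xii: "\<not> indep M a A B" if a: "set a \<subseteq> bcl M B" and n: "\<not> set a \<subseteq> bcl M A" for a
  proof
    assume "indep M a A B"
    then have "rk a A = 0" using iAB[OF bC[OF a]] bcl_rk_0[OF C(2) bds(2) a] by simp
    then obtain A0 where "A0 \<subseteq> A" "set a \<subseteq> bcl M A0" using rk_0_bcl[OF C(1) bC[OF a]] by blast
    then show False using n bcl_mono by blast
  qed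
  show ?thesis
    by (intro conjI allI impI; (elim conjE)?;
        (rule i ii iii iv v vi vii viii ix x xi xii xiii bcl_bcl[OF C(1) bds(1)] bcl_model; assumption))
qed

end
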